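(* Let $\mathcal H=L^2([0,1],dx)$ and let $\{u(t)\}_{t\in\mathbb N}$ be the mild solution (at integer times) of the stochastic heat equation $du(t)=Au(t)\,dt+Q^{1/2}dW_t$ with homogeneous Dirichlet boundary conditions and initial condition $u(0)=u_0\in L^2(\Omega:\mathcal H)$, where $u_0$ is independent of $W$ and admits the centered chaos expansion $u_0=\sum_{r=1}^\infty\mathcal I_r(f_r)$, $f_r\in\mathfrak H^{\odot r}\otimes\mathcal H$. Let $u_\infty$ be the centered Gaussian random variable in $\mathcal H$ with covariance operator $$\mathcal T_{u_\infty}=\sum_{k=1}^\infty\frac{q_k}{2\lambda_k}\,e_k\otimes e_k.$$ Then $u(t)\to u_\infty$ with respect to the $d_2$ distance (and so in distribution in $\mathcal H$) as $t\to\infty$.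
   Context: $A=\frac{d^2}{dx^2}$ with domain $D(A)=H^2(0,1)\cap H_0^1(0,1)$, generating the semigroup $S(t)=e^{tA}$ on $\mathcal H$; $e_k(x)=\sqrt2\sin(k\pi x)$, $Ae_k=-\lambda_ke_k$, $\lambda_k=(k\pi)^2$, $k\ge1$; $e_k\otimes e_k$ denotes the operator $h\mapsto\langle h,e_k\rangle_{\mathcal H}e_k$. $W$ is a cylindrical Wiener process on $\mathcal H$, and $Q$ is a symmetric nonnegative trace-class operator with $Qe_k=q_ke_k$, $q_k>0$ for all $k$, $\sum_kq_k<\infty$. The mild solution is $u(t)=S(t)u_0+\int_0^tS(t-s)Q^{1/2}dW_s$. Chaos expansions are with respect to an isonormal Gaussian process over a real separable Hilbert space $\mathfrak H$, in terms of which both $u_0$ and the cylindrical Wiener process are expressed; in particular $\int_0^tS(t-s)Q^{1/2}dW_s=\mathcal I_1(h_t)$ for some $h_t\in\mathfrak H\otimes\mathcal H$. $I_r$ is the usual real-valued multiple Wiener–Itô integral of order $r$ (with $\mathbb E[I_r(f)I_s(g)]=\delta_{r,s}r!\langle f,g\rangle_{\mathfrak H^{\otimes r}}$), and $\mathcal I_r(f)=\sum_iI_r(\langle f,e_i\rangle_{\mathcal H})e_i$ for $f\in\mathfrak H^{\odot r}\otimes\mathcal H$, $\mathfrak H^{\odot r}$ being the symmetric tensor power. Distance $d_2$: $d_2(X,Y)=\sup|\mathbb E[h(X)]-\mathbb E[h(Y)]|$ over bounded, twice Fréchet differentiable $h:\mathcal H\to\mathbb R$ with $\sup_{x\in\mathcal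 H}\sum_{j=0}^2\|D_F^jh(x)\|_{\mathrm{op}}\le1$, where $D_F^jh(x)$ is the $j$-th Fréchet derivative viewed as a $j$-linear form with its operator norm (the $j=0$ term being the sup-norm of $h$). *)

theory Defs
  imports "HOL-Probability.Probability"
begin

section \<open>The Hilbert space \<open>L\<^sup>2([0,1], dx)\<close>\<close>

abbreviation leb01 :: "real measure" where
  "leb01 \<equiv> lebesgue_on {0..1}"

definition sq_int :: "(real \<Rightarrow> real) \<Rightarrow> bool" where
  "sq_int f \<longleftrightarrow> f \<in> borel_measurable leb01 \<and> integrable leb01 (\<lambda>x. (f x)\<^sup>2)"

lemma prob_space_leb01: "prob_space leb01"
  by (rule prob_spaceI) (simp add: emeasure_restrict_space)

lemma sq_int_mult:
  assumes "sq_int f" "sq_int g"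
  shows "integrable leb01 (\<lambda>x. f x * g x)"
proof (rule Bochner_Integration.integrable_bound)
  show "integrable leb01 (\<lambda>x. (f x)\<^sup>2 + (g x)\<^sup>2)"
    using assms by (auto simp: sq_int_def)
  show "(\<lambda>x. f x * g x) \<in> borel_measurable leb01"
    using assms by (auto simp: sq_int_def)
  show "AE x in leb01. norm (f x * g x) \<le> norm ((f x)\<^sup>2 + (g x)\<^sup>2)"
  proof (rule AE_I2)
    fix x
    have "2 * (\<bar>f x\<bar> * \<bar>g x\<bar>) \<le> \<bar>f x\<bar>\<^sup>2 + \<bar>g x\<bar>\<^sup>2"
      using sum_squares_bound[of "\<bar>f x\<bar>" "\<bar>g x\<bar>"] by (simp add: mult.assoc)
    moreover have "0 \<le> \<bar>f x\<bar> * \<bar>g x\<bar>" by simp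
    ultimately have "\<bar>f x\<bar> * \<bar>g x\<bar> \<le> (f x)\<^sup>2 + (g x)\<^sup>2"
      unfolding power2_abs by linarith
    then show "norm (f x * g x) \<le> norm ((f x)\<^sup>2 + (g x)\<^sup>2)"
      by (simp add: abs_mult)
  qed
qed

lemma sq_int_zero: "sq_int (\<lambda>x. 0)"
  by (simp add: sq_int_def)

lemma sq_int_add: "sq_int f \<Longrightarrow> sq_int g \<Longrightarrow> sq_int (\<lambda>x. f x + g x)"
  using sq_int_mult[of f g] by (auto simp: sq_int_def power2_sum mult.assoc)

lemma sq_int_scale: "sq_int f \<Longrightarrow> sq_int (\<lambda>x. c * f x)"
  by (auto simp: sq_int_def power_mult_distrib)

lemma sq_int_continuous:
  assumes "continuous_on {0..1} f"
  shows "sq_int f"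
proof -
  have "f \<in> borel_measurable leb01"
    using assms by (intro continuous_imp_measurable_on_sets_lebesgue) auto
  moreover have "integrable leb01 (\<lambda>x. (f x)\<^sup>2)"
  proof -
    have "(\<lambda>x. (f x)\<^sup>2) absolutely_integrable_on {0..1}"
      using assms by (intro absolutely_integrable_continuous_real continuous_intros) auto
    then show ?thesis
      by (simp add: integrable_restrict_space set_integrable_def)
  qed
  ultimately show ?thesis by (simp add: sq_int_def)
qed

quotient_type L2 = "real \<Rightarrow> real" / partial:
  "\<lambda>f g. sq_int f \<and> sq_int g \<and> (AE x in leb01. f x = g x)"
  by (rule part_equivpI) (auto intro!: exI[of _ "\<lambda>x. 0"] sympI transpI simp: sq_int_zero)

instantiation L2 :: real_vector
begin

lift_definition zero_L2 :: L2 is "\<lambda>x. 0" by (simp add: sq_int_zero)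

lift_definition plus_L2 :: "L2 \<Rightarrow> L2 \<Rightarrow> L2" is "\<lambda>f g x. f x + g x"
  by (auto simp: sq_int_add)

lift_definition scaleR_L2 :: "real \<Rightarrow> L2 \<Rightarrow> L2" is "\<lambda>c f x. c * f x"
  by (auto simp: sq_int_scale)

definition uminus_L2 :: "L2 \<Rightarrow> L2" where "uminus_L2 f = (-1) *\<^sub>R f"

definition minus_L2 :: "L2 \<Rightarrow> L2 \<Rightarrow> L2" where "minus_L2 f g = f + (-1) *\<^sub>R g"

instance
proof
  fix a b c :: L2 and r s :: real
  show "a + b + c = a + (b + c)"
    by transfer (auto simp: sq_int_add add.assoc)
  show "a + b = b + a"
    by transfer (auto simp: sq_int_add add.commute)
  show "0 + a = a"
    by transfer auto
  show "- a + a = 0"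
    unfolding uminus_L2_def
    using sq_int_scale[of _ "-1"]
    by transfer (auto intro: sq_int_add simp: sq_int_zero)
  show "a - b = a + - b"
    by (simp add: uminus_L2_def minus_L2_def)
  show "r *\<^sub>R (a + b) = r *\<^sub>R a + r *\<^sub>R b"
    by transfer (auto simp: sq_int_add sq_int_scale algebra_simps)
  show "(r + s) *\<^sub>R a = r *\<^sub>R a + s *\<^sub>R a"
    by transfer (auto simp: sq_int_add sq_int_scale distrib_right)
  show "r *\<^sub>R s *\<^sub>R a = (r * s) *\<^sub>R a"
    by transfer (auto simp: sq_int_scale mult.assoc)
  show "1 *\<^sub>R a = a"
    by transfer auto
qed

end

instantiation L2 :: real_inner
begin

lift_definition inner_L2 :: "L2 \<Rightarrow> L2 \<Rightarrow> real" is "\<lambda>f g. \<integral>x. f x * g x \<partial>leb01"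
  by (rule Bochner_Integration.integral_cong_AE) (auto simp: sq_int_def)

definition norm_L2 :: "L2 \<Rightarrow> real" where "norm_L2 f = sqrt (inner f f)"

definition sgn_L2 :: "L2 \<Rightarrow> L2" where "sgn_L2 f = inverse (norm f) *\<^sub>R f"

definition dist_L2 :: "L2 \<Rightarrow> L2 \<Rightarrow> real" where "dist_L2 f g = norm (f - g)"

definition uniformity_L2 :: "(L2 \<times> L2) filter" where
  "uniformity_L2 = (INF e\<in>{0<..}. principal {(x, y). dist x y < e})"

definition open_L2 :: "L2 set \<Rightarrow> bool" where
  "open_L2 U \<longleftrightarrow> (\<forall>x\<in>U. \<forall>\<^sub>F (x', y) in uniformity. x' = x \<longrightarrow> y \<in> U)"

instance
proof
  fix a b c :: L2 and r :: real and U :: "L2 set"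
  show "dist a b = norm (a - b)" by (rule dist_L2_def)
  show "sgn a = a /\<^sub>R norm a" by (rule sgn_L2_def)
  show "(uniformity :: (L2 \<times> L2) filter) = (INF e\<in>{0<..}. principal {(x, y). dist x y < e})"
    by (rule uniformity_L2_def)
  show "open U \<longleftrightarrow> (\<forall>x\<in>U. \<forall>\<^sub>F (x', y) in uniformity. x' = x \<longrightarrow> y \<in> U)"
    by (rule open_L2_def)
  show "inner a b = inner b a"
    by transfer (simp add: mult.commute)
  show "inner (a + b) c = inner a c + inner b c"
    by transfer (simp add: distrib_right sq_int_mult)
  show "inner (r *\<^sub>R a) b = r * inner a b"
    by transfer (simp add: mult.assoc)
  show "0 \<le> inner a a"
    by transfer simp
  show "inner a a = 0 \<longleftrightarrow> a = 0"
  proof (transfer, goal_cases)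
    case (1 f)
    then have "integrable leb01 (\<lambda>x. f x * f x)" by (intro sq_int_mult) auto
    then have "(\<integral>x. f x * f x \<partial>leb01) = 0 \<longleftrightarrow> (AE x in leb01. f x * f x = 0)"
      by (intro integral_nonneg_eq_0_iff_AE) auto
    with 1 show ?case by (simp add: sq_int_zero)
  qed
  show "norm a = sqrt (inner a a)" by (rule norm_L2_def)
qed

end

text \<open>The class of a function, with the class of \<open>0\<close> as value on functions that are not
  square-integrable.\<close>

lift_definition L2_of :: "(real \<Rightarrow> real) \<Rightarrow> L2" is "\<lambda>f. if sq_int f then f else (\<lambda>x. 0)"
  by (simp add: sq_int_zero)

lemma L2_exhaust:
  obtains f where "sq_int f" "F = L2_of f"
proof -
  have "\<exists>f. sq_int f \<and> F = L2_of f" by transfer auto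
  then show ?thesis using that by blast
qed

lemma inner_L2_of:
  "sq_int f \<Longrightarrow> sq_int g \<Longrightarrow> inner (L2_of f) (L2_of g) = (\<integral>x. f x * g x \<partial>leb01)"
  by transfer simp

lemma norm_L2_of: "sq_int f \<Longrightarrow> (norm (L2_of f))\<^sup>2 = (\<integral>x. (f x)\<^sup>2 \<partial>leb01)"
  by (simp add: norm_L2_def inner_L2_of power2_eq_square)

lemma L2_of_diff:
  "sq_int f \<Longrightarrow> sq_int g \<Longrightarrow> L2_of f - L2_of g = L2_of (\<lambda>x. f x - g x)"
  unfolding minus_L2_def
  using sq_int_scale[of g "-1"] sq_int_add[of f "\<lambda>x. -1 * g x"]
  by transfer auto

instance L2 :: complete_space
proof
  fix X :: "nat \<Rightarrow> L2" assume C: "Cauchy X"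
  interpret prob_space leb01 by (rule prob_space_leb01)
  have "\<forall>n. \<exists>f. sq_int f \<and> X n = L2_of f"
    by (metis L2_exhaust)
  then obtain f where f: "\<And>n. sq_int (f n)" "\<And>n. X n = L2_of (f n)"
    by metis
  have [measurable]: "f n \<in> borel_measurable leb01" for n
    using f(1)[of n] by (simp add: sq_int_def)
  have sqd: "sq_int (\<lambda>x. f m x - f n x)" for m n
    using sq_int_add[OF f(1)[of m] sq_int_scale[OF f(1)[of n], of "-1"]] by simp
  have dist_eq: "(dist (X m) (X n))\<^sup>2 = (\<integral>x. (f m x - f n x)\<^sup>2 \<partial>leb01)" for m n
    by (simp add: dist_norm f(2) L2_of_diff f(1) norm_L2_of sqd)
  have "\<forall>k. \<exists>N. \<forall>m\<ge>N. \<forall>n\<ge>N. dist (X m) (X n) < (1/2)^k"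
    using C by (auto simp: Cauchy_def)
  then obtain N where N: "\<And>k m n. m \<ge> N k \<Longrightarrow> n \<ge> N k \<Longrightarrow> dist (X m) (X n) < (1/2)^k"
    by metis
  define r where "r n = (\<Sum>k\<le>n. N k) + n" for n
  have rN: "r n \<ge> N n" for n
    unfolding r_def by (intro trans_le_add1 member_le_sum) auto
  have rSuc: "r (Suc n) \<ge> r n" for n
    by (simp add: r_def)
  have rge: "r n \<ge> n" for n by (simp add: r_def)
  define d where "d n x = f (r (Suc n)) x - f (r n) x" for n x
  have [measurable]: "d n \<in> borel_measurable leb01" for n
    unfolding d_def by measurable
  have sq1: "sq_int (\<lambda>x. 1)" by (simp add: sq_int_def)
  have norm1: "norm (L2_of (\<lambda>x. 1)) = 1"
  proof -
    have "(norm (L2_of (\<lambda>x. 1)))\<^sup>2 = 1"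
      using prob_space by (simp add: norm_L2_of sq1)
    then show ?thesis
      by (metis norm_ge_zero power2_eq_1_iff norm_not_less_zero neg_less_0_iff_less zero_less_one)
  qed
  have dabs: "sq_int (\<lambda>x. \<bar>d n x\<bar>)" for n
    using sqd[of "r (Suc n)" "r n"] by (auto simp: sq_int_def d_def)
  have int_d: "integrable leb01 (\<lambda>x. \<bar>d n x\<bar>)" for n
    using sq_int_mult[OF dabs[of n] sq1] by simp
  have dL1: "(\<integral>x. \<bar>d n x\<bar> \<partial>leb01) \<le> (1/2)^n" for n
  proof -
    have "(\<integral>x. \<bar>d n x\<bar> \<partial>leb01) = inner (L2_of (\<lambda>x. \<bar>d n x\<bar>)) (L2_of (\<lambda>x. 1))"
      by (simp add: inner_L2_of dabs sq1)
    also have "\<dots> \<le> norm (L2_of (\<lambda>x. \<bar>d n x\<bar>)) * norm (L2_of (\<lambda>x. 1))"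
      by (rule norm_cauchy_schwarz)
    also have "\<dots> = norm (L2_of (\<lambda>x. \<bar>d n x\<bar>))"
      by (simp add: norm1)
    also have "\<dots> = dist (X (r (Suc n))) (X (r n))"
    proof (rule power2_eq_imp_eq)
      show "(norm (L2_of (\<lambda>x. \<bar>d n x\<bar>)))\<^sup>2 = (dist (X (r (Suc n))) (X (r n)))\<^sup>2"
        unfolding norm_L2_of[OF dabs] dist_eq by (simp add: d_def)
    qed auto
    also have "\<dots> \<le> (1/2)^n"
      using N[of n "r (Suc n)" "r n"] rN[of n] rSuc[of n] by simp
    finally show ?thesis .
  qed
  have "(\<integral>\<^sup>+x. (\<Sum>n. ennreal \<bar>d n x\<bar>) \<partial>leb01) = (\<Sum>n. \<integral>\<^sup>+x. ennreal \<bar>d n x\<bar> \<partial>leb01)"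
    by (rule nn_integral_suminf) measurable
  also have "\<dots> = (\<Sum>n. ennreal (\<integral>x. \<bar>d n x\<bar> \<partial>leb01))"
    by (intro suminf_cong nn_integral_eq_integral int_d) auto
  also have "\<dots> \<le> (\<Sum>n. ennreal ((1/2)^n))"
    by (intro suminf_le ennreal_leI dL1) auto
  also have "\<dots> = ennreal (\<Sum>n. (1/2)^n)"
    by (rule suminf_ennreal2) auto
  finally have "(\<integral>\<^sup>+x. (\<Sum>n. ennreal \<bar>d n x\<bar>) \<partial>leb01) \<noteq> \<infinity>"
    by (auto simp: top_unique)
  then have "AE x in leb01. (\<Sum>n. ennreal \<bar>d n x\<bar>) \<noteq> \<infinity>"
    by (intro nn_integral_PInf_AE) measurable
  then have conv: "AE x in leb01. convergent (\<lambda>n. f (r n) x)"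
  proof eventually_elim
    fix x assume "(\<Sum>n. ennreal \<bar>d n x\<bar>) \<noteq> \<infinity>"
    then have "summable (\<lambda>n. \<bar>d n x\<bar>)"
      by (intro summable_suminf_not_top) auto
    then have "summable (\<lambda>n. d n x)"
      by (rule summable_rabs_cancel)
    then have "convergent (\<lambda>n. \<Sum>k<n. d k x)"
      by (simp add: summable_iff_convergent)
    moreover have "(\<Sum>k<n. d k x) = f (r n) x - f (r 0) x" for n
      unfolding d_def by (rule sum_lessThan_telescope)
    ultimately show "convergent (\<lambda>n. f (r n) x)"
      by (simp add: convergent_diff_const_right_iff)
  qed
  define g where "g x = lim (\<lambda>n. f (r n) x)" for x
  have [measurable]: "g \<in> borel_measurable leb01"
    unfolding g_def by (intro borel_measurable_lim_metric) measurable
  have lim: "AE x in leb01. (\<lambda>n. f (r n) x) \<longlonglongrightarrow> g x"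
    using conv by eventually_elim (simp add: g_def convergent_LIMSEQ_iff)
  have bound: "(\<integral>\<^sup>+x. ennreal ((f n x - g x)\<^sup>2) \<partial>leb01) \<le> ennreal (((1/2)^k)\<^sup>2)" if "n \<ge> N k" for n k
  proof -
    have "(\<integral>\<^sup>+x. ennreal ((f n x - g x)\<^sup>2) \<partial>leb01) =
          (\<integral>\<^sup>+x. liminf (\<lambda>m. ennreal ((f n x - f (r m) x)\<^sup>2)) \<partial>leb01)"
    proof (rule nn_integral_cong_AE, use lim in eventually_elim)
      fix x assume "(\<lambda>n. f (r n) x) \<longlonglongrightarrow> g x"
      then have "(\<lambda>m. ennreal ((f n x - f (r m) x)\<^sup>2)) \<longlonglongrightarrow> ennreal ((f n x - g x)\<^sup>2)"
        by (intro tendsto_intros tendsto_ennrealI)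
      then show "ennreal ((f n x - g x)\<^sup>2) = liminf (\<lambda>m. ennreal ((f n x - f (r m) x)\<^sup>2))"
        by (intro lim_imp_Liminf[symmetric]) auto
    qed
    also have "\<dots> \<le> liminf (\<lambda>m. \<integral>\<^sup>+x. ennreal ((f n x - f (r m) x)\<^sup>2) \<partial>leb01)"
      by (rule nn_integral_liminf) measurable
    also have "\<dots> \<le> ennreal (((1/2)^k)\<^sup>2)"
    proof (rule Liminf_le)
      show "\<forall>\<^sub>F m in sequentially. (\<integral>\<^sup>+x. ennreal ((f n x - f (r m) x)\<^sup>2) \<partial>leb01) \<le> ennreal (((1/2)^k)\<^sup>2)"
        using eventually_ge_at_top[of "N k"]
      proof eventually_elim
        fix m assume m: "m \<ge> N k"
        have "(\<integral>\<^sup>+x. ennreal ((f n x - f (r m) x)\<^sup>2) \<partial>leb01) =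
              ennreal (\<integral>x. (f n x - f (r m) x)\<^sup>2 \<partial>leb01)"
          using sqd by (intro nn_integral_eq_integral) (auto simp: sq_int_def)
        also have "\<dots> = ennreal ((dist (X n) (X (r m)))\<^sup>2)"
          by (simp add: dist_eq)
        also have "\<dots> \<le> ennreal (((1/2)^k)\<^sup>2)"
          using N[of k n "r m"] that m rge[of m]
          by (intro ennreal_leI power_mono) (auto intro: less_imp_le)
        finally show "(\<integral>\<^sup>+x. ennreal ((f n x - f (r m) x)\<^sup>2) \<partial>leb01) \<le> ennreal (((1/2)^k)\<^sup>2)" .
      qed
    qed auto
    finally show ?thesis .
  qed
  have sqfg: "sq_int (\<lambda>x. f n x - g x)" if "n \<ge> N k" for n k
    unfolding sq_int_def
  proof (intro conjI integrableI_bounded)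
    show "(\<integral>\<^sup>+x. ennreal (norm ((f n x - g x)\<^sup>2)) \<partial>leb01) < \<infinity>"
      using le_less_trans[OF bound[OF that]] by simp
  qed measurable
  have sqg: "sq_int g"
    using sq_int_add[OF f(1)[of "N 0"] sq_int_scale[OF sqfg[of 0 "N 0"], of "-1"]] by simp
  have dist_le: "dist (X n) (L2_of g) \<le> (1/2)^k" if "n \<ge> N k" for n k
  proof (rule power2_le_imp_le)
    have "ennreal (\<integral>x. (f n x - g x)\<^sup>2 \<partial>leb01) \<le> ennreal (((1/2)^k)\<^sup>2)"
      using bound[OF that] sqfg[OF that]
      by (subst nn_integral_eq_integral[symmetric]) (auto simp: sq_int_def)
    then have "(\<integral>x. (f n x - g x)\<^sup>2 \<partial>leb01) \<le> ((1/2)^k)\<^sup>2"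
      by (simp add: ennreal_le_iff)
    then show "(dist (X n) (L2_of g))\<^sup>2 \<le> ((1/2)^k)\<^sup>2"
      by (simp add: dist_norm f(2) L2_of_diff f(1) sqg norm_L2_of sqfg[OF that])
  qed auto
  have "X \<longlonglongrightarrow> L2_of g"
  proof (rule metric_LIMSEQ_I)
    fix e :: real assume "e > 0"
    then obtain k where "(1/2)^k < e"
      using real_arch_pow_inv[of e "1/2"] by auto
    then show "\<exists>no. \<forall>n\<ge>no. dist (X n) (L2_of g) < e"
      using dist_le by (meson le_less_trans)
  qed
  then show "convergent X" by (rule convergentI)
qed

instance L2 :: banach ..

section \<open>The Dirichlet Laplacian and its semigroup\<close>

lift_definition sine :: "nat \<Rightarrow> L2" is "\<lambda>k x. sqrt 2 * sin (real k * pi * x)"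
  by (auto intro!: sq_int_continuous continuous_intros)

definition eigval :: "nat \<Rightarrow> real" where
  "eigval k = (real k * pi)\<^sup>2"

text \<open>Test functions are \<open>C\<^sub>c\<^sup>1(0,1)\<close>, as in Brezis' treatment of one-dimensional Sobolev spaces.\<close>

definition test_function :: "(real \<Rightarrow> real) \<Rightarrow> bool" where
  "test_function \<phi> \<longleftrightarrow> \<phi> C1_differentiable_on UNIV \<and>
     (\<exists>a b. 0 < a \<and> b < 1 \<and> (\<forall>x. x \<notin> {a..b} \<longrightarrow> \<phi> x = 0))"

definition weak_deriv :: "L2 \<Rightarrow> L2 \<Rightarrow> bool" where
  "weak_deriv f g \<longleftrightarrow>
     (\<forall>\<phi>. test_function \<phi> \<longrightarrow> inner f (L2_of (deriv \<phi>)) = - inner g (L2_of \<phi>))"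

definition H2 :: "L2 set" where
  "H2 = {f. \<exists>g h. weak_deriv f g \<and> weak_deriv g h}"

text \<open>\<open>H\<^sub>0\<^sup>1(0,1)\<close> is the closure of the test functions in the norm of \<open>H\<^sup>1(0,1)\<close>.\<close>

definition H01 :: "L2 set" where
  "H01 = {f. \<exists>g \<phi>. weak_deriv f g \<and> (\<forall>n. test_function (\<phi> n)) \<and>
      (\<lambda>n. L2_of (\<phi> n)) \<longlonglongrightarrow> f \<and> (\<lambda>n. L2_of (deriv (\<phi> n))) \<longlonglongrightarrow> g}"

text \<open>Unbounded operators are represented by their graphs.\<close>

definition dirichlet_laplacian :: "(L2 \<times> L2) set" where
  "dirichlet_laplacian =
     {(f, h). f \<in> H2 \<inter> H01 \<and> (\<exists>g. weak_deriv f g \<and> weak_deriv g h)}"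

definition C0_semigroup :: "(real \<Rightarrow> 'a::real_normed_vector \<Rightarrow>\<^sub>L 'a) \<Rightarrow> bool" where
  "C0_semigroup S \<longleftrightarrow> S 0 = id_blinfun \<and>
     (\<forall>s\<ge>0. \<forall>t\<ge>0. S (s + t) = S s o\<^sub>L S t) \<and>
     (\<forall>x. ((\<lambda>t. S t x) \<longlongrightarrow> x) (at_right 0))"

definition generator :: "(real \<Rightarrow> 'a::real_normed_vector \<Rightarrow>\<^sub>L 'a) \<Rightarrow> ('a \<times> 'a) set" where
  "generator S = {(x, y). ((\<lambda>t. (1 / t) *\<^sub>R (S t x - x)) \<longlongrightarrow> y) (at_right 0)}"

section \<open>Operators on Hilbert spaces\<close>

definition symmetric_op :: "('h::real_inner \<Rightarrow>\<^sub>L 'h) \<Rightarrow> bool" where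
  "symmetric_op T \<longleftrightarrow> (\<forall>x y. inner (T x) y = inner x (T y))"

definition nonneg_op :: "('h::real_inner \<Rightarrow>\<^sub>L 'h) \<Rightarrow> bool" where
  "nonneg_op T \<longleftrightarrow> (\<forall>x. 0 \<le> inner (T x) x)"

text \<open>Trace-class operators as nuclear operators.\<close>

definition trace_class :: "('h::real_inner \<Rightarrow>\<^sub>L 'h) \<Rightarrow> bool" where
  "trace_class T \<longleftrightarrow> (\<exists>(a :: nat \<Rightarrow> 'h) b. summable (\<lambda>n. norm (a n) * norm (b n)) \<and>
     (\<forall>x. (\<lambda>n. inner x (a n) *\<^sub>R b n) sums T x))"

definition is_sqrt_op :: "('h::real_inner \<Rightarrow>\<^sub>L 'h) \<Rightarrow> ('h \<Rightarrow>\<^sub>L 'h) \<Rightarrow> bool" where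
  "is_sqrt_op Q R \<longleftrightarrow> symmetric_op R \<and> nonneg_op R \<and> R o\<^sub>L R = Q"

lift_definition rank_one :: "'h::real_inner \<Rightarrow> 'h \<Rightarrow> 'h \<Rightarrow>\<^sub>L 'h" is
  "\<lambda>y x h. inner h x *\<^sub>R y"
  by (intro bounded_linear_intros)

definition orthonormal :: "'h::real_inner set \<Rightarrow> bool" where
  "orthonormal B \<longleftrightarrow> pairwise orthogonal B \<and> (\<forall>b\<in>B. norm b = 1)"

text \<open>Squared Hilbert--Schmidt norm. The supremum over finite orthonormal sets equals the sum
  over any orthonormal basis.\<close>

definition hs_sq :: "('h::real_inner \<Rightarrow> 'k::real_normed_vector) \<Rightarrow> ennreal" where
  "hs_sq T = (SUP B\<in>{B. finite B \<and> orthonormal B}. \<Sum>b\<in>B. ennreal ((norm (T b))\<^sup>2))"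

text \<open>The Hilbert tensor product of \<open>r\<close> copies of \<open>\<HH>\<close> with \<open>K\<close> is realised as the space of
  \<open>r\<close>-linear Hilbert--Schmidt maps from \<open>\<HH>\<^sup>r\<close> to \<open>K\<close>; the tensor \<open>g\<^sub>1 \<otimes> \<dots> \<otimes> g\<^sub>r \<otimes> k\<close> is
  the map \<open>(v\<^sub>1, \<dots>, v\<^sub>r) \<mapsto> \<langle>v\<^sub>1, g\<^sub>1\<rangle> \<dots> \<langle>v\<^sub>r, g\<^sub>r\<rangle> k\<close>. Arguments are lists of length \<open>r\<close>; values
  on lists of other lengths are irrelevant.\<close>

definition tensor_sq :: "nat \<Rightarrow> ('g::real_inner list \<Rightarrow> 'k::real_normed_vector) \<Rightarrow> ennreal" where
  "tensor_sq r f = (SUP B\<in>{B. finite B \<and> orthonormal B}.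
     \<Sum>xs\<in>{xs. set xs \<subseteq> B \<and> length xs = r}. ennreal ((norm (f xs))\<^sup>2))"

definition symmetric_tensor :: "nat \<Rightarrow> ('g::real_inner list \<Rightarrow> 'k::real_normed_vector) \<Rightarrow> bool" where
  "symmetric_tensor r f \<longleftrightarrow>
     (\<forall>xs i. length xs = r \<and> i < r \<longrightarrow> linear (\<lambda>v. f (xs[i := v]))) \<and>
     (\<forall>xs ys. length xs = r \<and> mset xs = mset ys \<longrightarrow> f xs = f ys) \<and>
     tensor_sq r f < \<infinity>"

definition tensor_power :: "'g::real_inner \<Rightarrow> 'g list \<Rightarrow> real" where
  "tensor_power g xs = prod_list (map (\<lambda>v. inner v g) xs)"

section \<open>Gaussian objects\<close>

definition L2_tendsto ::
    "'w measure \<Rightarrow> (nat \<Rightarrow> 'w \<Rightarrow> 'k::real_normed_vector) \<Rightarrow> ('w \<Rightarrow> 'k) \<Rightarrow> bool" where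
  "L2_tendsto M Z Y \<longleftrightarrow>
     (\<lambda>n. \<integral>\<^sup>+\<omega>. ennreal ((norm (Z n \<omega> - Y \<omega>))\<^sup>2) \<partial>M) \<longlonglongrightarrow> 0"

definition centered_normal :: "'w measure \<Rightarrow> ('w \<Rightarrow> real) \<Rightarrow> bool" where
  "centered_normal M Y \<longleftrightarrow> Y \<in> borel_measurable M \<and>
     ((AE \<omega> in M. Y \<omega> = 0) \<or> (\<exists>\<sigma>>0. distributed M lborel Y (normal_density 0 \<sigma>)))"

definition gaussian_family :: "'w measure \<Rightarrow> 'i set \<Rightarrow> ('i \<Rightarrow> 'w \<Rightarrow> real) \<Rightarrow> bool" where
  "gaussian_family M I X \<longleftrightarrow>
     (\<forall>F c. finite F \<and> F \<subseteq> I \<longrightarrow> centered_normal M (\<lambda>\<omega>. \<Sum>i\<in>F. c i * X i \<omega>))"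

definition isonormal :: "'w measure \<Rightarrow> ('g::real_inner \<Rightarrow> 'w \<Rightarrow> real) \<Rightarrow> bool" where
  "isonormal M X \<longleftrightarrow> gaussian_family M UNIV X \<and>
     (\<forall>g h. (\<integral>\<omega>. X g \<omega> * X h \<omega> \<partial>M) = inner g h)"

definition cylindrical_wiener ::
    "'w measure \<Rightarrow> (real \<Rightarrow> 'h::real_inner \<Rightarrow> 'w \<Rightarrow> real) \<Rightarrow> bool" where
  "cylindrical_wiener M W \<longleftrightarrow>
     gaussian_family M ({0..} \<times> UNIV) (\<lambda>(t, x). W t x) \<and>
     (\<forall>s\<ge>0. \<forall>t\<ge>0. \<forall>x y. (\<integral>\<omega>. W s x \<omega> * W t y \<omega> \<partial>M) = min s t * inner x y) \<and>
     (\<forall>x. AE \<omega> in M. continuous_on {0..} (\<lambda>t. W t x \<omega>))"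

definition gaussian_rv :: "'w measure \<Rightarrow> ('w \<Rightarrow> 'h::real_inner) \<Rightarrow> bool" where
  "gaussian_rv M Y \<longleftrightarrow> Y \<in> borel_measurable M \<and>
     (\<forall>x. centered_normal M (\<lambda>\<omega>. inner (Y \<omega>) x))"

definition covariance_op :: "'w measure \<Rightarrow> ('w \<Rightarrow> 'h::real_inner) \<Rightarrow> ('h \<Rightarrow>\<^sub>L 'h) \<Rightarrow> bool" where
  "covariance_op M Y T \<longleftrightarrow>
     (\<forall>x y. (\<integral>\<omega>. inner (Y \<omega>) x * inner (Y \<omega>) y \<partial>M) = inner (T x) y)"

section \<open>Multiple Wiener--Ito integrals\<close>

text \<open>Probabilists' Hermite polynomials.\<close>

fun hermite :: "nat \<Rightarrow> real \<Rightarrow> real" where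
  "hermite 0 x = 1"
| "hermite (Suc 0) x = x"
| "hermite (Suc (Suc n)) x = x * hermite (Suc n) x - real (Suc n) * hermite n x"

text \<open>\<open>Z\<close> is a version of \<open>I\<^sub>r(f)\<close>, where \<open>I\<^sub>r\<close> is the continuous linear extension of
  \<open>I\<^sub>r(g\<^sup>\<otimes>\<^sup>r) = He\<^sub>r(X(g))\<close>, \<open>\<parallel>g\<parallel> = 1\<close>, from the span of these tensors to all symmetric ones.\<close>

definition multiple_integral ::
    "'w measure \<Rightarrow> ('g::real_inner \<Rightarrow> 'w \<Rightarrow> real) \<Rightarrow> nat \<Rightarrow> ('g list \<Rightarrow> real) \<Rightarrow> ('w \<Rightarrow> real) \<Rightarrow> bool" where
  "multiple_integral M X r f Z \<longleftrightarrow> Z \<in> borel_measurable M \<and>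
     (\<exists>(N :: nat \<Rightarrow> nat) (c :: nat \<Rightarrow> nat \<Rightarrow> real) (g :: nat \<Rightarrow> nat \<Rightarrow> 'g).
        (\<forall>n. \<forall>j<N n. norm (g n j) = 1) \<and>
        (\<lambda>n. tensor_sq r (\<lambda>xs. (\<Sum>j<N n. c n j * tensor_power (g n j) xs) - f xs)) \<longlonglongrightarrow> 0 \<and>
        L2_tendsto M (\<lambda>n \<omega>. \<Sum>j<N n. c n j * hermite r (X (g n j) \<omega>)) Z)"

text \<open>\<open>Z\<close> is a version of \<open>\<I>\<^sub>r(f) = (\<Sum>i. I\<^sub>r(\<langle>f, e\<^sub>i\<rangle>) e\<^sub>i)\<close>.\<close>

definition vec_multiple_integral ::
    "'w measure \<Rightarrow> ('g::real_inner \<Rightarrow> 'w \<Rightarrow> real) \<Rightarrow> nat \<Rightarrow> ('g list \<Rightarrow> L2) \<Rightarrow> ('w \<Rightarrow> L2) \<Rightarrow> bool" where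
  "vec_multiple_integral M X r f Z \<longleftrightarrow> Z \<in> borel_measurable M \<and>
     (\<exists>Y :: nat \<Rightarrow> 'w \<Rightarrow> real.
        (\<forall>i\<ge>1. multiple_integral M X r (\<lambda>xs. inner (f xs) (sine i)) (Y i)) \<and>
        L2_tendsto M (\<lambda>n \<omega>. \<Sum>i=1..n. Y i \<omega> *\<^sub>R sine i) Z)"

definition centered_chaos_expansion ::
    "'w measure \<Rightarrow> ('g::real_inner \<Rightarrow> 'w \<Rightarrow> real) \<Rightarrow> (nat \<Rightarrow> 'g list \<Rightarrow> L2) \<Rightarrow> ('w \<Rightarrow> L2) \<Rightarrow> bool" where
  "centered_chaos_expansion M X f U \<longleftrightarrow>
     (\<forall>r\<ge>1. symmetric_tensor r (f r)) \<and>
     (\<exists>Z :: nat \<Rightarrow> 'w \<Rightarrow> L2. (\<forall>r\<ge>1. vec_multiple_integral M X r (f r) (Z r)) \<and>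
        L2_tendsto M (\<lambda>n \<omega>. \<Sum>r=1..n. Z r \<omega>) U)"

section \<open>The stochastic heat equation\<close>

text \<open>\<open>Z\<close> is a version of \<open>\<integral>\<^sub>0\<^sup>T \<Phi>(s) dW\<^sub>s\<close> for a deterministic \<open>\<Phi>\<close>: the \<open>L\<^sup>2\<close>-limit of the
  integrals of finite-rank step functions that approximate \<open>\<Phi>\<close> in \<open>L\<^sup>2(0,T)\<close> with values in the
  Hilbert--Schmidt operators. The integral of \<open>1\<^bsub>(a,b]\<^esub> y \<otimes> x\<close> is \<open>(W\<^sub>b(x) - W\<^sub>a(x)) y\<close>.\<close>

definition wiener_integral ::
    "'w measure \<Rightarrow> (real \<Rightarrow> 'h::real_inner \<Rightarrow> 'w \<Rightarrow> real) \<Rightarrow> real \<Rightarrow> (real \<Rightarrow> 'h \<Rightarrow>\<^sub>L 'h) \<Rightarrow> ('w \<Rightarrow> 'h) \<Rightarrow> bool" where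
  "wiener_integral M W T \<Phi> Z \<longleftrightarrow> Z \<in> borel_measurable M \<and>
     (\<exists>(N :: nat \<Rightarrow> nat) (a :: nat \<Rightarrow> nat \<Rightarrow> real) b (x :: nat \<Rightarrow> nat \<Rightarrow> 'h) y.
        (\<forall>n. \<forall>j<N n. 0 \<le> a n j \<and> a n j \<le> b n j \<and> b n j \<le> T) \<and>
        (\<lambda>n. \<integral>\<^sup>+s\<in>{0..T}. hs_sq (blinfun_apply
           ((\<Sum>j<N n. indicator {a n j<..b n j} s *\<^sub>R rank_one (y n j) (x n j)) - \<Phi> s)) \<partial>lborel)
          \<longlonglongrightarrow> 0 \<and>
        L2_tendsto M (\<lambda>n \<omega>. \<Sum>j<N n. (W (b n j) (x n j) \<omega> - W (a n j) (x n j) \<omega>) *\<^sub>R y n j) Z)"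

text \<open>Mild solution, at integer times, of \<open>du = A u dt + B dW\<close>, where \<open>A\<close> generates \<open>S\<close>.\<close>

definition mild_solution ::
    "'w measure \<Rightarrow> (real \<Rightarrow> 'h::real_inner \<Rightarrow> 'w \<Rightarrow> real) \<Rightarrow> (real \<Rightarrow> 'h \<Rightarrow>\<^sub>L 'h) \<Rightarrow> ('h \<Rightarrow>\<^sub>L 'h) \<Rightarrow>
     ('w \<Rightarrow> 'h) \<Rightarrow> (nat \<Rightarrow> 'w \<Rightarrow> 'h) \<Rightarrow> bool" where
  "mild_solution M W S B u0 u \<longleftrightarrow> (\<forall>t. u t \<in> borel_measurable M \<and>
     (\<exists>Z. wiener_integral M W (real t) (\<lambda>s. S (real t - s) o\<^sub>L B) Z \<and>
        (AE \<omega> in M. u t \<omega> = S (real t) (u0 \<omega>) + Z \<omega>)))"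

text \<open>Independence of \<open>U\<close> and the whole family \<open>(W\<^sub>t(x))\<close>, as independence of the generated
  \<open>\<sigma>\<close>-algebras.\<close>

definition indep_of_wiener ::
    "'w measure \<Rightarrow> ('w \<Rightarrow> 'h::real_inner) \<Rightarrow> (real \<Rightarrow> 'h \<Rightarrow> 'w \<Rightarrow> real) \<Rightarrow> bool" where
  "indep_of_wiener M U W \<longleftrightarrow> prob_space.indep_set M
     (sets (vimage_algebra (space M) U borel))
     (sets (vimage_algebra (space M) (\<lambda>\<omega>. \<lambda>(t, x)\<in>{0..} \<times> UNIV. W t x \<omega>)
        (Pi\<^sub>M ({0..} \<times> UNIV) (\<lambda>_. borel))))"

definition limit_covariance :: "(nat \<Rightarrow> real) \<Rightarrow> L2 \<Rightarrow>\<^sub>L L2" where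
  "limit_covariance q =
     (\<Sum>k. (q (Suc k) / (2 * eigval (Suc k))) *\<^sub>R rank_one (sine (Suc k)) (sine (Suc k)))"

section \<open>Convergence of laws\<close>

text \<open>\<open>D2 x\<close> is the second Frechet derivative in curried form; its norm is the operator norm of
  the associated bilinear form.\<close>

definition d2_class :: "('h::real_normed_vector \<Rightarrow> real) set" where
  "d2_class = {h. bounded (range h) \<and>
     (\<exists>(D1 :: 'h \<Rightarrow> 'h \<Rightarrow>\<^sub>L real) (D2 :: 'h \<Rightarrow> 'h \<Rightarrow>\<^sub>L 'h \<Rightarrow>\<^sub>L real).
        (\<forall>x. (h has_derivative blinfun_apply (D1 x)) (at x)) \<and>
        (\<forall>x. (D1 has_derivative blinfun_apply (D2 x)) (at x)) \<and>
        (\<forall>x. (SUP y. \<bar>h y\<bar>) + norm (D1 x) + norm (D2 x) \<le> 1))}"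

definition d2 ::
    "'w measure \<Rightarrow> ('w \<Rightarrow> 'h::real_normed_vector) \<Rightarrow> 'v measure \<Rightarrow> ('v \<Rightarrow> 'h) \<Rightarrow> real" where
  "d2 M X N Y = (SUP h\<in>d2_class. \<bar>(\<integral>\<omega>. h (X \<omega>) \<partial>M) - (\<integral>\<omega>. h (Y \<omega>) \<partial>N)\<bar>)"

definition tendsto_in_distribution ::
    "'w measure \<Rightarrow> (nat \<Rightarrow> 'w \<Rightarrow> 'h::real_normed_vector) \<Rightarrow> 'v measure \<Rightarrow> ('v \<Rightarrow> 'h) \<Rightarrow> bool" where
  "tendsto_in_distribution M X N Y \<longleftrightarrow>
     (\<forall>g :: 'h \<Rightarrow> real. continuous_on UNIV g \<and> bounded (range g) \<longrightarrow>
        (\<lambda>n. \<integral>\<omega>. g (X n \<omega>) \<partial>M) \<longlonglongrightarrow> (\<integral>\<omega>. g (Y \<omega>) \<partial>N))"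

end

theory Submission
  imports Defs
begin

text \<open>
  Write \<open>u(t) = S(t) u\<^sub>0 + Z\<^sub>t\<close>. Since \<open>S(t) e\<^sub>k = e\<^bsup>-\<lambda>\<^sub>k t\<^esup> e\<^sub>k\<close> and the \<open>e\<^sub>k\<close> are complete,
  \<open>\<parallel>S(t) u\<^sub>0\<parallel> \<le> e\<^bsup>-\<lambda>\<^sub>1 t\<^esup> \<parallel>u\<^sub>0\<parallel>\<close>. The stochastic convolution \<open>Z\<^sub>t\<close> is a centered Gaussian with
  independent coordinates of variance \<open>q\<^sub>k (1 - e\<^bsup>-2\<lambda>\<^sub>k t\<^esup>) / (2\<lambda>\<^sub>k)\<close>, so it has the law of
  \<open>Y\<^sub>t = D\<^sub>t u\<^sub>\<infinity>\<close>, where \<open>D\<^sub>t\<close> is the diagonal operator with entries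
  \<open>(1 - e\<^bsup>-2\<lambda>\<^sub>k t\<^esup>)\<^sup>1\<^sup>/\<^sup>2\<close>, and \<open>\<parallel>Y\<^sub>t - u\<^sub>\<infinity>\<parallel> \<le> e\<^bsup>-\<lambda>\<^sub>1 t\<^esup> \<parallel>u\<^sub>\<infinity>\<parallel>\<close>. Hence for a bounded Lipschitz function \<open>h\<close>
  the difference \<open>E h(u(t)) - E h(u\<^sub>\<infinity>)\<close> is controlled, uniformly in \<open>h\<close>, by the means of
  \<open>min(2B, K e\<^bsup>-\<lambda>\<^sub>1 t\<^esup> \<parallel>u\<^sub>0\<parallel>)\<close> and \<open>min(2B, K e\<^bsup>-\<lambda>\<^sub>1 t\<^esup> \<parallel>u\<^sub>\<infinity>\<parallel>)\<close>, which vanish as \<open>t \<rightarrow> \<infinity>\<close>.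
  Convergence in distribution follows because a bounded continuous function is a pointwise
  increasing limit of bounded Lipschitz functions.
\<close>

section \<open>The sine basis\<close>

text \<open>The processes \<open>u\<close> and \<open>u_inf\<close> live on two probability spaces,
  so the coupling is carried out on \<open>N\<close> alone and is tied to \<open>M\<close> only by
  an equality of laws. Phased cosines \<open>cos (z + \<theta>)\<close> serve as a real form of
  characteristic functions. Passing from one coordinate to finitely many uses only the
  one-dimensional Levy uniqueness theorem, with nonnegative weights that absorb the coordinates
  already treated. The heat semigroup is given only through its generator. Its action on the sines
  needs two facts: the sines lie in the domain, where the boundary condition calls for a cutoff
  construction, and an eigenvector of a generator is an eigenvector of the semigroup, for which
  strong continuity must first yield local norm bounds. The Wiener integral is known only as an L2
  limit of step integrals, so its cosine transform is computed for steps and passed to the limit.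
  The rate of the coupling comes from 1 - sqrt (1 - x) <= x on [0, 1], applied to x = exp (-2
  \<open>eigval k\<close> t); the spare factor 2 in the exponent is given up so that both errors
  share one rate.\<close>

lemma integral_leb01_FTC:
  assumes "\<And>x. (F has_real_derivative f x) (at x)" and "continuous_on {0..1} f"
  shows "(\<integral>x. f x \<partial>leb01) = F 1 - F 0"
proof -
  have "f absolutely_integrable_on {0..1}"
    using assms(2) by (rule absolutely_integrable_continuous_real)
  then have "integrable leb01 f"
    by (simp add: integrable_restrict_space set_integrable_def)
  then have "(\<integral>x. f x \<partial>leb01) = integral {0..1} f"
    by (rule lebesgue_integral_eq_integral) simp
  also have "(f has_integral (F 1 - F 0)) {0..1}"
    using assms(1)
    by (intro fundamental_theorem_of_calculus)
       (auto simp flip: has_real_derivative_iff_has_vector_derivative intro: DERIV_subset)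
  then have "integral {0..1} f = F 1 - F 0" by (rule integral_unique)
  finally show ?thesis .
qed

lemma sq_int_sine: "sq_int (\<lambda>x. sqrt 2 * sin (real k * pi * x))"
  by (auto intro!: sq_int_continuous continuous_intros)

lemma sine_L2_of: "sine k = L2_of (\<lambda>x. sqrt 2 * sin (real k * pi * x))"
  using sq_int_sine[of k] by transfer auto

lemma integral_cos_int_pi:
  assumes "m \<noteq> 0"
  shows "(\<integral>x. cos (real_of_int m * pi * x) \<partial>leb01) = 0"
proof -
  have "(\<integral>x. cos (of_int m * pi * x) \<partial>leb01)
      = sin (of_int m * pi * 1) / (of_int m * pi) - sin (of_int m * pi * 0) / (of_int m * pi)"
    using assms
    by (intro integral_leb01_FTC[where F = "\<lambda>x. sin (of_int m * pi * x) / (of_int m * pi)"])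
       (auto intro!: derivative_eq_intros continuous_intros simp: field_simps)
  then show ?thesis by (simp add: sin_zero_iff_int2)
qed

lemma inner_sine:
  assumes "j \<ge> 1" "k \<ge> 1"
  shows "inner (sine j) (sine k) = (if j = k then 1 else 0)"
proof -
  have int: "integrable leb01 (\<lambda>x. cos (c * x))" for c :: real
  proof -
    have "(\<lambda>x. cos (c * x)) absolutely_integrable_on {0..1}"
      by (intro absolutely_integrable_continuous_real continuous_intros)
    then show ?thesis by (simp add: integrable_restrict_space set_integrable_def)
  qed
  have "inner (sine j) (sine k)
      = (\<integral>x. sqrt 2 * sin (real j * pi * x) * (sqrt 2 * sin (real k * pi * x)) \<partial>leb01)"
    by (simp add: sine_L2_of inner_L2_of sq_int_sine)
  also have "\<dots> = (\<integral>x. cos (of_int (int j - int k) * pi * x) - cos (of_int (int j + int k) * pi * x) \<partial>leb01)"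
  proof (rule Bochner_Integration.integral_cong[OF refl])
    fix x :: real
    have "sqrt 2 * sin (real j * pi * x) * (sqrt 2 * sin (real k * pi * x))
        = 2 * (sin (real j * pi * x) * sin (real k * pi * x))" by simp
    also have "\<dots> = cos (real j * pi * x - real k * pi * x) - cos (real j * pi * x + real k * pi * x)"
      by (simp add: sin_times_sin)
    finally show "sqrt 2 * sin (real j * pi * x) * (sqrt 2 * sin (real k * pi * x)) =
       cos (of_int (int j - int k) * pi * x) - cos (of_int (int j + int k) * pi * x)"
      by (simp add: algebra_simps)
  qed
  also have "\<dots> = (\<integral>x. cos (of_int (int j - int k) * pi * x) \<partial>leb01)
      - (\<integral>x. cos (of_int (int j + int k) * pi * x) \<partial>leb01)"
    by (intro Bochner_Integration.integral_diff int)
  also have "(\<integral>x. cos (of_int (int j + int k) * pi * x) \<partial>leb01) = 0"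
    using assms by (intro integral_cos_int_pi) auto
  also have "(\<integral>x. cos (of_int (int j - int k) * pi * x) \<partial>leb01) = (if j = k then 1 else 0)"
    using integral_cos_int_pi[of "int j - int k"] prob_space.prob_space[OF prob_space_leb01] by auto
  finally show ?thesis by simp
qed

lemma norm_sine: "k \<ge> 1 \<Longrightarrow> norm (sine k) = 1"
  using inner_sine[of k k] by (simp add: norm_eq_sqrt_inner)

text \<open>\<open>H\<close> is only integrable, so it cannot be tested against itself. It is tested
  against \<open>s (H x)\<close>, with \<open>s\<close> a bounded continuous function of the same
  sign as its argument: almost everywhere limits of continuous functions and dominated convergence
  give zero integral of \<open>H x * s (H x)\<close>, which is nonnegative and vanishes only where
  \<open>H\<close> does.\<close>

lemma AE_eq_0_if_orthogonal_to_continuous: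
  fixes H :: "real \<Rightarrow> real"
  assumes HI: "integrable leb01 H"
    and cont0: "\<And>g. continuous_on {0..1} g \<Longrightarrow> (\<integral>x. H x * g x \<partial>leb01) = 0"
  shows "AE x in leb01. H x = 0"
proof -
  have Hm[measurable]: "H \<in> borel_measurable leb01"
    using HI by (rule borel_measurable_integrable)
  have "H measurable_on {0..1}"
    by (simp add: measurable_on_iff_borel_measurable)
  then obtain Ng g where g: "negligible Ng" "\<And>n. continuous_on UNIV (g n)"
     "\<And>x. x \<notin> Ng \<Longrightarrow> (\<lambda>n. g n x) \<longlonglongrightarrow> (if x \<in> {0..1} then H x else 0)"
    unfolding measurable_on_def by blast
  define s where "s y = y / (1 + \<bar>y\<bar>)" for y :: real
  have s1: "\<bar>s y\<bar> \<le> 1" for y by (simp add: s_def field_simps)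
  have s2: "continuous_on UNIV s"
    unfolding s_def by (intro continuous_intros ballI) (simp add: add_nonneg_eq_0_iff)
  have AEg: "AE x in leb01. (\<lambda>n. g n x) \<longlonglongrightarrow> H x"
  proof -
    have "AE x in lebesgue. x \<notin> Ng"
      using g(1) by (intro AE_not_in) (simp flip: negligible_iff_null_sets)
    then have "AE x in lebesgue. x \<in> {0..1} \<longrightarrow> (\<lambda>n. g n x) \<longlonglongrightarrow> H x"
    proof eventually_elim
      case (elim x)
      then show ?case using g(3)[of x] by (cases "x \<in> {0..1}") auto
    qed
    then show ?thesis by (subst AE_restrict_space_iff) auto
  qed
  have lim: "(\<lambda>n. \<integral>x. H x * s (g n x) \<partial>leb01) \<longlonglongrightarrow> (\<integral>x. H x * s (H x) \<partial>leb01)"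
  proof (rule integral_dominated_convergence[where w = "\<lambda>x. \<bar>H x\<bar>"])
    have ms: "s \<in> borel_measurable borel" using s2 by (rule borel_measurable_continuous_onI)
    show "(\<lambda>x. H x * s (H x)) \<in> borel_measurable leb01"
      using ms by measurable
    show "(\<lambda>x. H x * s (g n x)) \<in> borel_measurable leb01" for n
    proof -
      have "g n \<in> borel_measurable leb01"
        using g(2) by (intro continuous_imp_measurable_on_sets_lebesgue) (auto intro: continuous_on_subset)
      then show ?thesis using ms by measurable
    qed
    show "integrable leb01 (\<lambda>x. \<bar>H x\<bar>)" using HI by simp
    show "AE x in leb01. (\<lambda>n. H x * s (g n x)) \<longlonglongrightarrow> H x * s (H x)"
      using AEg
    proof eventually_elim
      case (elim x)
      have "isCont s (H x)" using s2 by (simp add: continuous_on_eq_continuous_at)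
      then show ?case using elim by (intro tendsto_intros isCont_tendsto_compose[of _ s])
    qed
    show "AE x in leb01. norm (H x * s (g n x)) \<le> \<bar>H x\<bar>" for n
      using s1 by (auto simp: abs_mult intro!: mult_left_le)
  qed
  have "(\<integral>x. H x * s (g n x) \<partial>leb01) = 0" for n
    using g(2)[of n] s2 by (intro cont0) (auto intro: continuous_on_subset continuous_on_compose2[of UNIV s])
  with lim have "(\<integral>x. H x * s (H x) \<partial>leb01) = 0"
    by (simp add: LIMSEQ_const_iff)
  moreover have "integrable leb01 (\<lambda>x. H x * s (H x))"
  proof (rule Bochner_Integration.integrable_bound[OF HI])
    have ms: "s \<in> borel_measurable borel" using s2 by (rule borel_measurable_continuous_onI)
    show "(\<lambda>x. H x * s (H x)) \<in> borel_measurable leb01"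
      using ms by measurable
    show "AE x in leb01. norm (H x * s (H x)) \<le> norm (H x)"
      using s1 by (auto simp: abs_mult intro!: mult_left_le)
  qed
  moreover have "0 \<le> H x * s (H x)" for x by (simp add: s_def)
  ultimately have "AE x in leb01. H x * s (H x) = 0"
    by (subst (asm) integral_nonneg_eq_0_iff_AE) auto
  then show ?thesis by eventually_elim (auto simp: s_def)
qed

lemma AE_leb01_interior: "AE x in leb01. 0 < x \<and> x < 1"
proof -
  have "AE x in lebesgue. x \<notin> {0, 1::real}"
    by (intro AE_not_in) (simp flip: negligible_iff_null_sets)
  then have "AE x in lebesgue. x \<in> {0..1} \<longrightarrow> 0 < x \<and> x < (1::real)"
    by eventually_elim auto
  then show ?thesis by (subst AE_restrict_space_iff) auto
qed

text \<open>Orthogonality to all sines gives orthogonality of \<open>f x * sin (pi * x)\<close> to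
  every polynomial in cos (pi x). By Weierstrass these are dense in the continuous functions on
  [0, 1], and sin (pi x) has no zero inside the interval.\<close>

lemma sine_complete:
  assumes "\<And>k. k \<ge> 1 \<Longrightarrow> inner F (sine k) = 0"
  shows "F = 0"
proof -
  obtain f where f: "sq_int f" "F = L2_of f" by (rule L2_exhaust)
  have fm[measurable]: "f \<in> borel_measurable leb01" using f by (simp add: sq_int_def)
  have integrable_f: "integrable leb01 (\<lambda>x. f x * g x)" if "continuous_on {0..1} g" for g
    using sq_int_mult[OF f(1) sq_int_continuous[OF that]] .
  have sin0: "(\<integral>x. f x * sin (real k * pi * x) \<partial>leb01) = 0" for k
  proof (cases "k \<ge> 1")
    case True
    have "0 = (\<integral>x. f x * (sqrt 2 * sin (real k * pi * x)) \<partial>leb01)"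
      using assms[OF True] by (simp add: f sine_L2_of inner_L2_of sq_int_sine)
    also have "\<dots> = sqrt 2 * (\<integral>x. f x * sin (real k * pi * x) \<partial>leb01)"
      by (simp flip: integral_mult_right_zero add: ac_simps)
    finally show ?thesis by simp
  next
    case False
    then have "k = 0" by simp
    then show ?thesis by simp
  qed
  \<comment> \<open>Product-to-sum turns one factor cos (pi x) into the frequencies k + 1 and k - 1,
    so the induction on \<open>j\<close> keeps \<open>k\<close> arbitrary. The case k = 0, where k -
    1 would leave the naturals, is split off; there the sine vanishes.\<close>
  have pow0: "(\<integral>x. f x * (sin (real k * pi * x) * cos (pi * x) ^ j) \<partial>leb01) = 0" for k j
  proof (induction j arbitrary: k)
    case 0
    then show ?case using sin0 by simp
  next
    case (Suc j)
    show ?case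
    proof (cases k)
      case 0
      then show ?thesis by simp
    next
      case (Suc k')
      have *: "sin (real k * pi * x) * cos (pi * x) ^ Suc j =
          (sin (real (Suc k) * pi * x) * cos (pi * x) ^ j) / 2 + (sin (real k' * pi * x) * cos (pi * x) ^ j) / 2" for x
      proof -
        have "sin (real k * pi * x) * cos (pi * x) = (sin (real k * pi * x + pi * x) + sin (real k * pi * x - pi * x)) / 2"
          by (rule sin_times_cos)
        also have "real k * pi * x + pi * x = real (Suc k) * pi * x" by (simp add: algebra_simps)
        also have "real k * pi * x - pi * x = real k' * pi * x" by (simp add: Suc algebra_simps)
        finally have "sin (real k * pi * x) * cos (pi * x) * cos (pi * x) ^ j
            = (sin (real (Suc k) * pi * x) + sin (real k' * pi * x)) / 2 * cos (pi * x) ^ j" by simp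
        then show ?thesis by (simp add: algebra_simps add_divide_distrib del: of_nat_Suc)
      qed
      have "(\<integral>x. f x * (sin (real k * pi * x) * cos (pi * x) ^ Suc j) \<partial>leb01) =
        (\<integral>x. f x * (sin (real (Suc k) * pi * x) * cos (pi * x) ^ j) / 2
          + f x * (sin (real k' * pi * x) * cos (pi * x) ^ j) / 2 \<partial>leb01)"
        unfolding * by (simp add: algebra_simps add_divide_distrib)
      also have "\<dots> = (\<integral>x. f x * (sin (real (Suc k) * pi * x) * cos (pi * x) ^ j) / 2 \<partial>leb01)
          + (\<integral>x. f x * (sin (real k' * pi * x) * cos (pi * x) ^ j) / 2 \<partial>leb01)"
        by (intro Bochner_Integration.integral_add Bochner_Integration.integrable_divide integrable_f continuous_intros) 
      also have "\<dots> = 0" using Suc.IH by (simp del: of_nat_Suc)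
      finally show ?thesis .
    qed
  qed
  define H where "H x = f x * sin (pi * x)" for x
  have HI: "integrable leb01 H"
    unfolding H_def by (intro integrable_f continuous_intros)
  have [measurable]: "H \<in> borel_measurable leb01"
    using HI by (rule borel_measurable_integrable)
  have poly0: "(\<integral>x. H x * p (cos (pi * x)) \<partial>leb01) = 0" if p: "real_polynomial_function p" for p :: "real \<Rightarrow> real"
  proof -
    obtain a n where a: "p = (\<lambda>x. \<Sum>i\<le>n. a i * x ^ i)"
      using p unfolding real_polynomial_function_iff_sum by blast
    have "(\<integral>x. H x * p (cos (pi * x)) \<partial>leb01) = (\<integral>x. (\<Sum>i\<le>n. a i * (f x * (sin (real 1 * pi * x) * cos (pi * x) ^ i))) \<partial>leb01)"
      by (simp add: a H_def sum_distrib_left ac_simps)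
    also have "\<dots> = (\<Sum>i\<le>n. a i * (\<integral>x. f x * (sin (real 1 * pi * x) * cos (pi * x) ^ i) \<partial>leb01))"
      by (subst Bochner_Integration.integral_sum)
         (auto intro!: integrable_f continuous_intros Bochner_Integration.integrable_mult_right simp del: of_nat_1)
    also have "\<dots> = 0" using pow0[of 1] by simp
    finally show ?thesis .
  qed
  have cont0: "(\<integral>x. H x * g x \<partial>leb01) = 0" if g: "continuous_on {0..1} g" for g :: "real \<Rightarrow> real"
  proof -
    \<comment> \<open>The map cos (pi x) takes [0, 1] bijectively onto [-1, 1]. Thus
      \<open>g\<close> is a continuous function of cos (pi x), and ordinary polynomials on [-1, 1]
      approximate it.\<close>
    define G where "G y = g (arccos y / pi)" for y
    have G: "continuous_on {-1..1} G"
      unfolding G_def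
    proof (rule continuous_on_compose2[OF g])
      show "continuous_on {-1..1} (\<lambda>x. arccos x / pi)"
        by (intro continuous_intros continuous_on_arccos') auto
      show "(\<lambda>x. arccos x / pi) ` {-1..1} \<subseteq> {0..1}"
        by (auto simp: arccos_lbound arccos_ubound field_simps)
    qed
    have gG: "g x = G (cos (pi * x))" if "x \<in> {0..1}" for x
      using that by (simp add: G_def arccos_cos mult_le_cancel_left1)
    have Hg: "integrable leb01 (\<lambda>x. H x * g x)" 
      unfolding H_def mult.assoc by (intro integrable_f continuous_intros g)
    have le: "\<bar>\<integral>x. H x * g x \<partial>leb01\<bar> \<le> e * (\<integral>x. \<bar>H x\<bar> \<partial>leb01)" if "e > 0" for e
    proof -
      obtain p where p: "real_polynomial_function p" "\<And>y. y \<in> {-1..1} \<Longrightarrow> \<bar>G y - p y\<bar> < e"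
        using Stone_Weierstrass_real_polynomial_function[OF _ G \<open>e > 0\<close>] by auto
      have pc: "continuous_on UNIV p"
        using p(1) by (simp add: real_polynomial_function_eq continuous_on_polymonial_function)
      have Hp: "integrable leb01 (\<lambda>x. H x * p (cos (pi * x)))"
        unfolding H_def mult.assoc
        by (intro integrable_f continuous_intros continuous_on_compose2[OF pc]) auto
      have "(\<integral>x. H x * g x \<partial>leb01) = (\<integral>x. H x * g x \<partial>leb01) - (\<integral>x. H x * p (cos (pi * x)) \<partial>leb01)"
        using poly0[OF p(1)] by simp
      also have "\<dots> = (\<integral>x. H x * g x - H x * p (cos (pi * x)) \<partial>leb01)"
        using Hg Hp by simp
      also have "\<bar>\<dots>\<bar> \<le> (\<integral>x. e * \<bar>H x\<bar> \<partial>leb01)"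
      proof (rule order_trans[OF integral_abs_bound integral_mono])
        fix x assume "x \<in> space leb01"
        then have "\<bar>g x - p (cos (pi * x))\<bar> \<le> e"
          using p(2)[of "cos (pi * x)"] gG[of x] by auto
        then show "\<bar>H x * g x - H x * p (cos (pi * x))\<bar> \<le> e * \<bar>H x\<bar>"
          by (simp flip: right_diff_distrib add: abs_mult mult_left_mono mult.commute[of e])
      qed (use Hg Hp HI in auto)
      finally show ?thesis by simp
    qed
    have "\<bar>\<integral>x. H x * g x \<partial>leb01\<bar> \<le> 0"
    proof (rule tendsto_lowerbound)
      show "((\<lambda>e. e * (\<integral>x. \<bar>H x\<bar> \<partial>leb01)) \<longlongrightarrow> 0) (at_right 0)"
        by (auto intro!: tendsto_eq_intros)
      show "\<forall>\<^sub>F e in at_right 0. \<bar>\<integral>x. H x * g x \<partial>leb01\<bar> \<le> e * (\<integral>x. \<bar>H x\<bar> \<partial>leb01)"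
        using le by (auto simp: eventually_at_right_field intro!: exI[of _ 1])
    qed auto
    then show ?thesis by simp
  qed
  have H0: "AE x in leb01. H x = 0"
    using HI cont0 by (rule AE_eq_0_if_orthogonal_to_continuous)
  have ae: "AE x in leb01. f x = 0"
    using H0 AE_leb01_interior
  proof eventually_elim
    case (elim x)
    then have "0 < pi * x" "pi * x < pi" by auto
    then have "sin (pi * x) > 0" by (rule sin_gt_zero)
    with elim show "f x = 0" by (simp add: H_def)
  qed
  have "norm F ^ 2 = (\<integral>x. (f x)\<^sup>2 \<partial>leb01)" using f by (simp add: norm_L2_of)
  also have "\<dots> = (\<integral>x. 0 \<partial>leb01)"
    using ae by (intro integral_cong_AE) auto
  finally show ?thesis by simp
qed

text \<open>Coordinates are indexed by \<open>Suc k\<close> from here on, since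
  \<open>sine 0\<close> is the zero function and the basis starts at 1.\<close>

lemma L2_eqI:
  assumes "\<And>k. inner F (sine (Suc k)) = inner G (sine (Suc k))"
  shows "F = G"
proof -
  have "F - G = 0"
  proof (rule sine_complete)
    fix k :: nat assume "k \<ge> 1"
    then show "inner (F - G) (sine k) = 0"
      using assms[of "k - 1"] by (simp add: inner_diff_left)
  qed
  then show ?thesis by simp
qed

lemma norm_sum_sine:
  assumes "finite A"
  shows "(norm (\<Sum>k\<in>A. a k *\<^sub>R sine (Suc k)))\<^sup>2 = (\<Sum>k\<in>A. (a k)\<^sup>2)"
proof -
  have "(norm (\<Sum>k\<in>A. a k *\<^sub>R sine (Suc k)))\<^sup>2 = (\<Sum>k\<in>A. (norm (a k *\<^sub>R sine (Suc k)))\<^sup>2)"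
    using assms by (intro norm_sum_Pythagorean) (auto simp: pairwise_def orthogonal_def inner_sine)
  then show ?thesis by (simp add: norm_sine)
qed

lemma summable_sine:
  assumes a: "summable (\<lambda>k. (a k)\<^sup>2)"
  shows "summable (\<lambda>k. a k *\<^sub>R sine (Suc k))"
  unfolding summable_Cauchy
proof (intro allI impI)
  fix e :: real assume "e > 0"
  then obtain N where N: "\<And>m n. m \<ge> N \<Longrightarrow> norm (\<Sum>k\<in>{m..<n}. (a k)\<^sup>2) < e\<^sup>2"
    using a unfolding summable_Cauchy by (meson zero_less_power)
  have "norm (\<Sum>k\<in>{m..<n}. a k *\<^sub>R sine (Suc k)) < e" if "m \<ge> N" for m n
  proof (rule power2_less_imp_less)
    show "(norm (\<Sum>k\<in>{m..<n}. a k *\<^sub>R sine (Suc k)))\<^sup>2 < e\<^sup>2"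
      using N[OF that, of n] by (simp add: norm_sum_sine sum_nonneg)
  qed (use \<open>e > 0\<close> in simp)
  then show "\<exists>N. \<forall>m\<ge>N. \<forall>n. norm (\<Sum>k\<in>{m..<n}. a k *\<^sub>R sine (Suc k)) < e" by blast
qed

lemma inner_suminf_sine:
  assumes a: "summable (\<lambda>k. (a k)\<^sup>2)"
  shows "inner (\<Sum>k. a k *\<^sub>R sine (Suc k)) (sine (Suc j)) = a j"
proof -
  have "(\<lambda>k. inner (a k *\<^sub>R sine (Suc k)) (sine (Suc j))) sums inner (\<Sum>k. a k *\<^sub>R sine (Suc k)) (sine (Suc j))"
    by (intro bounded_linear.sums[OF bounded_linear_inner_left] summable_sums summable_sine a)
  moreover have "(\<lambda>k. inner (a k *\<^sub>R sine (Suc k)) (sine (Suc j))) = (\<lambda>k. if k = j then a k else 0)"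
    by (auto simp: inner_sine)
  moreover have "(\<lambda>k. if k = j then a k else 0) sums a j"
    by (rule sums_single)
  ultimately show ?thesis using sums_unique2 by metis
qed

text \<open>Bessel's inequality: the squared norm of the partial sum \<open>?s\<close> equals
  \<open>inner F ?s\<close>, so Cauchy-Schwarz gives \<open>norm ?s\<close> at most
  \<open>norm F\<close>.\<close>

lemma summable_inner_sine: "summable (\<lambda>k. (inner F (sine (Suc k)))\<^sup>2)"
proof (rule summableI_nonneg_bounded)
  fix n
  let ?s = "\<Sum>k<n. inner F (sine (Suc k)) *\<^sub>R sine (Suc k)"
  have s: "(norm ?s)\<^sup>2 = (\<Sum>k<n. (inner F (sine (Suc k)))\<^sup>2)" by (rule norm_sum_sine) simp
  also have "\<dots> = inner F ?s" by (simp add: inner_sum_right power2_eq_square)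
  also have "\<dots> \<le> norm F * norm ?s" by (rule norm_cauchy_schwarz)
  finally have "norm ?s \<le> norm F"
    by (cases "norm ?s = 0") (auto simp: power2_eq_square)
  then have "(norm ?s)\<^sup>2 \<le> (norm F)\<^sup>2" by (intro power_mono) auto
  then show "(\<Sum>k<n. (inner F (sine (Suc k)))\<^sup>2) \<le> (norm F)\<^sup>2" by (simp add: s)
qed simp

text \<open>The series converges by Bessel and completeness of the space. Its limit has the same
  coefficients as \<open>F\<close>, and completeness of the sines identifies the two.\<close>

lemma sums_sine: "(\<lambda>k. inner F (sine (Suc k)) *\<^sub>R sine (Suc k)) sums F"
proof -
  have "(\<Sum>k. inner F (sine (Suc k)) *\<^sub>R sine (Suc k)) = F"
    by (rule L2_eqI) (simp add: inner_suminf_sine summable_inner_sine)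
  then show ?thesis
    using summable_sums[OF summable_sine[OF summable_inner_sine[of F]]] by simp
qed

lemma parseval_sine: "(\<lambda>k. (inner F (sine (Suc k)))\<^sup>2) sums (norm F)\<^sup>2"
proof -
  have "(\<lambda>n. (norm (\<Sum>k<n. inner F (sine (Suc k)) *\<^sub>R sine (Suc k)))\<^sup>2) \<longlonglongrightarrow> (norm F)\<^sup>2"
    using sums_sine[of F] unfolding sums_def by (intro tendsto_intros)
  then show ?thesis by (simp add: norm_sum_sine sums_def)
qed

text \<open>Parseval turns a bound on diagonal entries into a norm bound. The semigroup decay and
  the estimates for diagonal operators all go through this comparison.\<close>

lemma norm_le_if_coeff_le:
  assumes "\<And>k. \<bar>inner F (sine (Suc k))\<bar> \<le> c * \<bar>inner G (sine (Suc k))\<bar>" "c \<ge> 0"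
  shows "norm F \<le> c * norm G"
proof (rule power2_le_imp_le)
  have "(inner F (sine (Suc k)))\<^sup>2 \<le> c\<^sup>2 * (inner G (sine (Suc k)))\<^sup>2" for k
    using power_mono[OF assms(1)[of k], of 2] by (simp add: power_mult_distrib)
  then have "(norm F)\<^sup>2 \<le> c\<^sup>2 * (norm G)\<^sup>2"
    by (rule sums_le[OF _ parseval_sine sums_mult[OF parseval_sine]])
  then show "(norm F)\<^sup>2 \<le> (c * norm G)\<^sup>2" by (simp add: power_mult_distrib)
qed (use assms(2) in simp)

section \<open>Separability of the space \<open>L2\<close>\<close>

text \<open>The dense set consists of the finite rational combinations of sines. It yields the
  second countability under which sums and differences of Borel functions into \<open>L2\<close> are
  Borel.\<close>

lemma countable_dense_L2: "\<exists>D :: L2 set. countable D \<and> (\<forall>F. \<forall>e>0. \<exists>d\<in>D. dist F d < e)"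
proof -
  define c where "c l = (\<Sum>k<length l. of_rat (l ! k) *\<^sub>R sine (Suc k))" for l :: "rat list"
  have "\<exists>l. dist F (c l) < e" if "e > 0" for F e
  proof -
    have "\<forall>\<^sub>F n in sequentially. dist (\<Sum>k<n. inner F (sine (Suc k)) *\<^sub>R sine (Suc k)) F < e / 2"
      using sums_sine[of F] that unfolding sums_def by (intro tendstoD) auto
    then obtain n where n: "dist (\<Sum>k<n. inner F (sine (Suc k)) *\<^sub>R sine (Suc k)) F < e / 2"
      by (auto simp: eventually_sequentially)
    \<comment> \<open>At most \<open>n\<close> coefficient errors of this size add up to at most e /
      2, since the sines have norm 1. The \<open>+ 1\<close> keeps the tolerance positive for n =
      0.\<close>
    have pos: "e / (2 * (real n + 1)) > 0" using that by (intro divide_pos_pos) auto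
    have "\<exists>r. \<bar>of_rat r - inner F (sine (Suc k))\<bar> < e / (2 * (real n + 1))" for k
    proof -
      obtain q where q: "q \<in> \<rat>" "inner F (sine (Suc k)) < q" "q < inner F (sine (Suc k)) + e / (2 * (real n + 1))"
        using Rats_dense_in_real[of "inner F (sine (Suc k))" "inner F (sine (Suc k)) + e / (2 * (real n + 1))"] pos
        by (metis less_add_same_cancel1)
      then obtain r where "q = of_rat r" by (auto elim: Rats_cases)
      then show ?thesis using q by (intro exI[of _ r]) auto
    qed
    then obtain r where r: "\<And>k. \<bar>of_rat (r k) - inner F (sine (Suc k))\<bar> < e / (2 * (real n + 1))" by metis
    have cr: "c (map r [0..<n]) = (\<Sum>k<n. of_rat (r k) *\<^sub>R sine (Suc k))"
      by (simp add: c_def)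
    have "dist (c (map r [0..<n])) (\<Sum>k<n. inner F (sine (Suc k)) *\<^sub>R sine (Suc k))
        = norm (\<Sum>k<n. (of_rat (r k) - inner F (sine (Suc k))) *\<^sub>R sine (Suc k))"
      by (simp add: cr dist_norm sum_subtractf scaleR_diff_left)
    also have "\<dots> \<le> (\<Sum>k<n. e / (2 * (real n + 1)))"
      by (intro sum_norm_le) (use r in \<open>auto simp: norm_sine less_imp_le\<close>)
    also have "\<dots> = (real n / (real n + 1)) * (e / 2)" by simp
    also have "\<dots> \<le> 1 * (e / 2)" using that by (intro mult_right_mono) auto
    finally have "dist (c (map r [0..<n])) (\<Sum>k<n. inner F (sine (Suc k)) *\<^sub>R sine (Suc k)) \<le> e / 2" by simp
    with n have "dist F (c (map r [0..<n])) < e"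
      using dist_triangle2[of F "c (map r [0..<n])" "\<Sum>k<n. inner F (sine (Suc k)) *\<^sub>R sine (Suc k)"]
        dist_commute[of F "\<Sum>k<n. inner F (sine (Suc k)) *\<^sub>R sine (Suc k)"] by linarith
    then show ?thesis by blast
  qed
  then show ?thesis by (intro exI[of _ "range c"]) auto
qed

instance L2 :: second_countable_topology
proof
  obtain D :: "L2 set" where D: "countable D" "\<And>F e. e > 0 \<Longrightarrow> \<exists>d\<in>D. dist F d < e"
    using countable_dense_L2 by blast
  define B where "B = (\<lambda>(d, n). ball d (1 / real (Suc n))) ` (D \<times> (UNIV :: nat set))"
  have "topological_basis B"
  proof (rule topological_basisI)
    fix U :: "L2 set" and F assume U: "open U" "F \<in> U"
    then obtain e where e: "e > 0" "ball F e \<subseteq> U" by (meson open_contains_ball)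
    obtain n where n: "1 / real (Suc n) < e / 2"
      using e(1) nat_approx_posE[of "e / 2"] by auto
    obtain d where d: "d \<in> D" "dist F d < 1 / real (Suc n)" using D(2)[of "1 / real (Suc n)"] by auto
    have "ball d (1 / real (Suc n)) \<subseteq> ball F e"
    proof
      fix G assume "G \<in> ball d (1 / real (Suc n))"
      then show "G \<in> ball F e"
        using dist_triangle[of F G d] d n by (auto simp: dist_commute)
    qed
    with e d show "\<exists>B'\<in>B. F \<in> B' \<and> B' \<subseteq> U"
      unfolding B_def by (intro bexI[of _ "ball d (1 / real (Suc n))"]) (auto simp: dist_commute)
  qed (auto simp: B_def)
  moreover have "countable B" unfolding B_def using D(1) by auto
  ultimately show "\<exists>B :: L2 set set. countable B \<and> open = generate_topology B"
    using topological_basis_imp_subbasis by blast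
qed

section \<open>The sines in the domain of the Dirichlet Laplacian\<close>

lemma test_function_deriv:
  assumes "test_function \<phi>"
  shows "(\<phi> has_real_derivative deriv \<phi> x) (at x)" "continuous_on UNIV (deriv \<phi>)"
proof -
  obtain D where D: "\<And>x. (\<phi> has_vector_derivative D x) (at x)" "continuous_on UNIV D"
    using assms unfolding test_function_def C1_differentiable_on_def by auto
  then have *: "(\<phi> has_real_derivative D x) (at x)" for x
    by (simp add: has_real_derivative_iff_has_vector_derivative)
  then have "deriv \<phi> = D" by (auto intro: DERIV_imp_deriv)
  with * D(2) show "(\<phi> has_real_derivative deriv \<phi> x) (at x)" "continuous_on UNIV (deriv \<phi>)" by auto
qed

lemma test_functionI:
  assumes "\<And>x. (\<phi> has_real_derivative D x) (at x)" "continuous_on UNIV D"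
    and "0 < a" "b < 1" "\<And>x. x \<notin> {a..b} \<Longrightarrow> \<phi> x = 0"
  shows "test_function \<phi>"
  unfolding test_function_def C1_differentiable_on_def
  using assms by (auto simp: has_real_derivative_iff_has_vector_derivative)

text \<open>Integration by parts: the boundary terms vanish because a test function is zero at 0 and
  1.\<close>

lemma weak_deriv_C1:
  assumes F: "\<And>x. (F has_real_derivative F' x) (at x)" "continuous_on UNIV F'"
  shows "weak_deriv (L2_of F) (L2_of F')"
  unfolding weak_deriv_def
proof (intro allI impI)
  fix \<phi> assume phi: "test_function \<phi>"
  have cF: "continuous_on UNIV F" using F(1) by (meson DERIV_continuous_on has_field_derivative_at_within)
  have cphi: "continuous_on UNIV \<phi>"
    using test_function_deriv(1)[OF phi] by (meson DERIV_continuous_on has_field_derivative_at_within)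
  have sq: "sq_int g" if "continuous_on UNIV g" for g
    using that by (auto intro: sq_int_continuous continuous_on_subset)
  have "\<phi> 0 = 0" "\<phi> 1 = 0" using phi unfolding test_function_def by fastforce+
  then have "(\<integral>x. F x * deriv \<phi> x + F' x * \<phi> x \<partial>leb01) = F 1 * \<phi> 1 - F 0 * \<phi> 0"
    using cF cphi F(2) test_function_deriv(2)[OF phi]
    by (intro integral_leb01_FTC)
       (auto intro!: derivative_eq_intros F(1) test_function_deriv(1)[OF phi] continuous_intros
         intro: continuous_on_subset)
  moreover have "(\<integral>x. F x * deriv \<phi> x + F' x * \<phi> x \<partial>leb01)
      = (\<integral>x. F x * deriv \<phi> x \<partial>leb01) + (\<integral>x. F' x * \<phi> x \<partial>leb01)"
    using cF cphi F(2) test_function_deriv(2)[OF phi]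
    by (intro Bochner_Integration.integral_add sq_int_mult sq)
  ultimately have "(\<integral>x. F x * deriv \<phi> x \<partial>leb01) = - (\<integral>x. F' x * \<phi> x \<partial>leb01)"
    using \<open>\<phi> 0 = 0\<close> \<open>\<phi> 1 = 0\<close> by simp
  then show "inner (L2_of F) (L2_of (deriv \<phi>)) = - inner (L2_of F') (L2_of \<phi>)"
    using cF cphi F(2) test_function_deriv(2)[OF phi] by (simp add: inner_L2_of sq)
qed

text \<open>Dominated convergence with a constant majorant. Pointwise convergence is asked only in
  the open interval, because the derivatives of the cutoff sines below vanish at the end points
  while their limit there is nonzero for k >= 1.\<close>

lemma tendsto_L2_of_bounded:
  assumes f: "\<And>n. continuous_on {0..1} (f n)" "continuous_on {0..1} g"
    and bound: "\<And>n x. x \<in> {0..1} \<Longrightarrow> \<bar>f n x\<bar> \<le> C" "\<And>x. x \<in> {0..1} \<Longrightarrow> \<bar>g x\<bar> \<le> C"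
    and lim: "\<And>x. 0 < x \<Longrightarrow> x < 1 \<Longrightarrow> (\<lambda>n. f n x) \<longlonglongrightarrow> g x"
  shows "(\<lambda>n. L2_of (f n)) \<longlonglongrightarrow> L2_of g"
proof -
  have sq: "sq_int (f n)" "sq_int g" "sq_int (\<lambda>x. f n x - g x)" for n
    using f by (auto intro!: sq_int_continuous continuous_intros)
  have "(\<lambda>n. \<integral>x. (f n x - g x)\<^sup>2 \<partial>leb01) \<longlonglongrightarrow> (\<integral>x. 0 \<partial>leb01)"
  proof (rule integral_dominated_convergence[where w = "\<lambda>x. (2 * C)\<^sup>2"])
    show "(\<lambda>x. (f n x - g x)\<^sup>2) \<in> borel_measurable leb01" for n
      using sq(3)[of n] by (auto simp: sq_int_def)
    show "integrable leb01 (\<lambda>x. (2 * C)\<^sup>2)" by simp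
    show "AE x in leb01. (\<lambda>n. (f n x - g x)\<^sup>2) \<longlonglongrightarrow> 0"
      using AE_leb01_interior
    proof eventually_elim
      case (elim x)
      then have "(\<lambda>n. (f n x - g x)\<^sup>2) \<longlonglongrightarrow> (g x - g x)\<^sup>2"
        by (intro tendsto_intros lim) auto
      then show ?case by simp
    qed
    show "AE x in leb01. norm ((f n x - g x)\<^sup>2) \<le> (2 * C)\<^sup>2" for n
    proof (rule AE_I2)
      fix x assume "x \<in> space leb01"
      then have "\<bar>f n x - g x\<bar> \<le> 2 * C" using bound(1)[of x n] bound(2)[of x] by auto
      then have "\<bar>f n x - g x\<bar>\<^sup>2 \<le> (2 * C)\<^sup>2" by (intro power_mono) auto
      then show "norm ((f n x - g x)\<^sup>2) \<le> (2 * C)\<^sup>2" by simp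
    qed
  qed simp
  then have "(\<lambda>n. sqrt ((dist (L2_of (f n)) (L2_of g))\<^sup>2)) \<longlonglongrightarrow> sqrt 0"
    by (intro tendsto_real_sqrt) (simp add: dist_norm L2_of_diff sq norm_L2_of)
  then show ?thesis by (subst tendsto_dist_iff) simp
qed

text \<open>The sine vanishes at both end points, so it is bounded linearly by the distance to the
  nearer one; the factor 2 covers passing from that distance to x (1 - x). In the cutoff argument
  this zero compensates the steep slope of the cutoff.\<close>

lemma abs_sin_int_pi_le:
  assumes "0 \<le> x" "x \<le> 1"
  shows "\<bar>sin (real k * pi * x)\<bar> \<le> 2 * real k * pi * (x * (1 - x))"
proof (cases "x \<le> 1 / 2")
  case True
  have "\<bar>sin (real k * pi * x)\<bar> \<le> real k * pi * x"
    using abs_sin_x_le_abs_x[of "real k * pi * x"] assms by (simp add: abs_mult)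
  also have "\<dots> = real k * pi * x * 1" by simp
  also have "\<dots> \<le> real k * pi * x * (2 * (1 - x))"
    using True assms by (intro mult_left_mono) auto
  finally show ?thesis by (simp add: algebra_simps)
next
  case False
  have "sin (real k * pi * x) = sin (real k * pi - real k * pi * (1 - x))"
    by (simp add: algebra_simps)
  also have "\<bar>\<dots>\<bar> = \<bar>sin (real k * pi * (1 - x))\<bar>"
    unfolding sin_diff by (simp add: abs_mult)
  also have "\<dots> \<le> real k * pi * (1 - x)"
    using abs_sin_x_le_abs_x[of "real k * pi * (1 - x)"] assms by (simp add: abs_mult)
  also have "\<dots> = real k * pi * (1 - x) * 1" by simp
  also have "\<dots> \<le> real k * pi * (1 - x) * (2 * x)"
    using False assms by (intro mult_left_mono) auto
  finally show ?thesis by (simp add: algebra_simps)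
qed

text \<open>Squaring makes the positive part continuously differentiable, so cutoffs built from it
  are admissible as C1 test functions.\<close>

lemma DERIV_max_0_square: "((\<lambda>z. (max 0 z)\<^sup>2) has_real_derivative 2 * max 0 z) (at z)"
proof (cases "z = 0")
  case True
  have "((\<lambda>h. ((max 0 (0 + h))\<^sup>2 - (max 0 0)\<^sup>2) / h) \<longlongrightarrow> 0) (at (0::real))"
  proof (rule Lim_null_comparison)
    show "((\<lambda>h::real. \<bar>h\<bar>) \<longlongrightarrow> 0) (at 0)" by (intro tendsto_eq_intros) auto
    show "\<forall>\<^sub>F h::real in at 0. norm (((max 0 (0 + h))\<^sup>2 - (max 0 0)\<^sup>2) / h) \<le> \<bar>h\<bar>"
      by (intro always_eventually allI) (auto simp: max_def power2_eq_square)
  qed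
  then show ?thesis by (simp add: True DERIV_def)
next
  case False
  then consider "z > 0" | "z < 0" by linarith
  then show ?thesis
  proof cases
    case 1
    show ?thesis
    proof (rule has_field_derivative_transform_within_open[of "\<lambda>z. z\<^sup>2" _ _ "{0<..}"])
      show "((\<lambda>z. z\<^sup>2) has_real_derivative 2 * max 0 z) (at z)"
        using 1 by (auto intro!: derivative_eq_intros)
    qed (use 1 in auto)
  next
    case 2
    show ?thesis
    proof (rule has_field_derivative_transform_within_open[of "\<lambda>z. 0" _ _ "{..<0}"])
      show "((\<lambda>z. 0) has_real_derivative 2 * max 0 z) (at z)"
        using 2 by (auto intro!: derivative_eq_intros)
    qed (use 2 in auto)
  qed
qed

text \<open>The sine is multiplied by P^2 / (P^2 + E^2) with P = max 0 (x (1 - x) - E) and E = 1 /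
  (n + 1). This factor is C1, lies in [0, 1], vanishes near the end points and tends to 1 inside.
  Its slope near the boundary is of order 1 / E, but the sine is there of order x (1 - x) = P + E,
  so the products have uniformly bounded derivatives and dominated convergence applies to functions
  and derivatives alike.\<close>

lemma sine_in_H01: "sine k \<in> H01"
proof -
  define e where "e n = 1 / real (Suc n)" for n
  have e: "e n > 0" "e n \<le> 1" for n by (auto simp: e_def)
  have e0: "e \<longlonglongrightarrow> 0" unfolding e_def by (rule LIMSEQ_Suc[OF lim_1_over_n])
  define p where "p n x = max 0 (x * (1 - x) - e n)" for n x
  define K where "K = real k * pi"
  have K: "K \<ge> 0" by (simp add: K_def)
  define \<phi> where "\<phi> n x = sqrt 2 * sin (K * x) * ((p n x)\<^sup>2 / ((p n x)\<^sup>2 + (e n)\<^sup>2))" for n x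
  define \<phi>' where "\<phi>' n x = sqrt 2 * K * cos (K * x) * ((p n x)\<^sup>2 / ((p n x)\<^sup>2 + (e n)\<^sup>2))
     + sqrt 2 * sin (K * x) * (2 * p n x * (1 - 2 * x) * (e n)\<^sup>2 / ((p n x)\<^sup>2 + (e n)\<^sup>2)\<^sup>2)" for n x
  have den: "(p n x)\<^sup>2 + (e n)\<^sup>2 > 0" for n x
    using e(1)[of n] by (intro add_nonneg_pos) auto
  have en0: "e n \<noteq> 0" for n
    using e(1)[of n] by simp
  have dp: "((\<lambda>x. (p n x)\<^sup>2) has_real_derivative 2 * p n x * (1 - 2 * x)) (at x)" for n x
    unfolding p_def
    by (rule DERIV_chain'[OF _ DERIV_max_0_square, THEN DERIV_cong])
       (auto intro!: derivative_eq_intros simp: algebra_simps)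
  have d\<phi>: "(\<phi> n has_real_derivative \<phi>' n x) (at x)" for n x
    unfolding \<phi>_def \<phi>'_def
    by (rule derivative_eq_intros dp refl)+
       (use den[of n x] in \<open>auto simp: field_simps power2_eq_square\<close>)
  have cp: "continuous_on A (p n)" for n A
    unfolding p_def by (intro continuous_intros)
  have c\<phi>': "continuous_on A (\<phi>' n)" for n A
    unfolding \<phi>'_def
    by (intro continuous_on_add continuous_on_mult continuous_on_divide continuous_on_power continuous_on_const
        continuous_on_sin continuous_on_cos continuous_on_id continuous_on_diff cp ballI)
       (simp_all add: en0)
  have c\<phi>: "continuous_on A (\<phi> n)" for n A
    unfolding \<phi>_def by (intro continuous_intros cp ballI) (simp_all add: en0)
  have test: "test_function (\<phi> n)" for n
  proof (rule test_functionI[OF d\<phi> c\<phi>'])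
    show "0 < e n" "1 - e n < 1" using e(1)[of n] by auto
    fix x assume x: "x \<notin> {e n..1 - e n}"
    have "x * (1 - x) \<le> e n"
    proof (cases "0 < x \<and> x < 1")
      case True
      then have "x * (1 - x) \<le> x" "x * (1 - x) \<le> 1 - x"
        by (auto simp: mult_left_le mult_left_le_one_le)
      with x show ?thesis by auto
    next
      case False
      then have "x * (1 - x) \<le> 0" by (auto simp: mult_le_0_iff)
      with e(1)[of n] show ?thesis by linarith
    qed
    then show "\<phi> n x = 0" by (simp add: \<phi>_def p_def)
  qed
  have frac: "0 \<le> (p n x)\<^sup>2 / ((p n x)\<^sup>2 + (e n)\<^sup>2)" "(p n x)\<^sup>2 / ((p n x)\<^sup>2 + (e n)\<^sup>2) \<le> 1" for n x
    using den[of n x] by (auto simp: field_simps)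
  have s2: "sqrt 2 \<le> 2" using real_sqrt_le_mono[of 2 4] by simp
  have b\<phi>: "\<bar>\<phi> n x\<bar> \<le> 2" for n x
  proof -
    have "\<bar>\<phi> n x\<bar> \<le> 2 * 1 * 1"
      unfolding \<phi>_def abs_mult using frac[of n x] s2 by (intro mult_mono) auto
    then show ?thesis by simp
  qed
  \<comment> \<open>Of the constant 10, the derivative of the sine contributes 2, with sqrt 2
    rounded up to 2. The derivative of the cutoff contributes 8 = 2 * 2 * 2: again sqrt 2, the
    factor 2 in the sine bound, and the 2 from differentiating the square.\<close>
  have b\<phi>': "\<bar>\<phi>' n x\<bar> \<le> 10 * K" if x: "x \<in> {0..1}" for n x
  proof -
    have "\<bar>sqrt 2 * K * cos (K * x) * ((p n x)\<^sup>2 / ((p n x)\<^sup>2 + (e n)\<^sup>2))\<bar> \<le> 2 * K * 1 * 1"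
      unfolding abs_mult using frac[of n x] s2 K by (intro mult_mono) auto
    moreover have "\<bar>sqrt 2 * sin (K * x) * (2 * p n x * (1 - 2 * x) * (e n)\<^sup>2 / ((p n x)\<^sup>2 + (e n)\<^sup>2)\<^sup>2)\<bar> \<le> 8 * K"
    proof (cases "p n x = 0")
      case True
      then show ?thesis using K by simp
    next
      case False
      define P E where "P = p n x" and "E = e n"
      have P: "P > 0" "x * (1 - x) = P + E" using False by (auto simp: P_def E_def p_def max_def split: if_splits)
      have E: "E > 0" using e by (simp add: E_def)
      have "\<bar>sin (K * x)\<bar> \<le> 2 * K * (P + E)"
        using abs_sin_int_pi_le[of x k] x by (simp add: K_def P(2) mult.assoc)
      \<comment> \<open>Both sides are homogeneous of degree 4, so the resulting bound does not
        depend on \<open>n\<close>. This is where the zero of the sine, of size P + E, cancels the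
        slope of the cutoff.\<close>
      have "(P + E) * (P * E\<^sup>2) \<le> (P\<^sup>2 + E\<^sup>2)\<^sup>2"
      proof -
        have "2 * (P * E) \<le> P\<^sup>2 + E\<^sup>2" using sum_squares_bound[of P E] by (simp add: mult.assoc)
        then have "E\<^sup>2 * (2 * (P * E)) \<le> E\<^sup>2 * (P\<^sup>2 + E\<^sup>2)" by (rule mult_left_mono) simp
        moreover have "0 \<le> P^4" "0 \<le> P\<^sup>2 * E\<^sup>2" "0 \<le> E^4" by auto
        ultimately show ?thesis by (simp add: power2_eq_square power4_eq_xxxx algebra_simps)
      qed
      then have q: "(P + E) * (P * E\<^sup>2) / (P\<^sup>2 + E\<^sup>2)\<^sup>2 \<le> 1"
        using den[of n x] by (subst divide_le_eq_1_pos) (simp_all add: P_def E_def en0)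
      have "\<bar>sqrt 2 * sin (K * x) * (2 * P * (1 - 2 * x) * E\<^sup>2 / (P\<^sup>2 + E\<^sup>2)\<^sup>2)\<bar>
          = sqrt 2 * \<bar>sin (K * x)\<bar> * \<bar>1 - 2 * x\<bar> * (2 * P * E\<^sup>2 / (P\<^sup>2 + E\<^sup>2)\<^sup>2)"
        using P(1) by (simp add: abs_mult)
      also have "\<dots> \<le> 2 * (2 * K * (P + E)) * 1 * (2 * P * E\<^sup>2 / (P\<^sup>2 + E\<^sup>2)\<^sup>2)"
        using s2 K P(1) E x \<open>\<bar>sin (K * x)\<bar> \<le> 2 * K * (P + E)\<close>
        by (intro mult_mono) (auto intro!: mult_nonneg_nonneg)
      also have "\<dots> = 8 * K * ((P + E) * (P * E\<^sup>2) / (P\<^sup>2 + E\<^sup>2)\<^sup>2)"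
        by simp
      also have "\<dots> \<le> 8 * K * 1" using K q by (intro mult_left_mono) auto
      finally show ?thesis by (simp add: P_def E_def)
    qed
    ultimately show ?thesis
      unfolding \<phi>'_def by (intro order_trans[OF abs_triangle_ineq]) linarith
  qed
  have plim: "(\<lambda>n. p n x) \<longlonglongrightarrow> x * (1 - x)" if "0 < x" "x < 1" for x
  proof -
    have "(\<lambda>n. p n x) \<longlonglongrightarrow> max 0 (x * (1 - x) - 0)"
      unfolding p_def by (intro tendsto_intros e0)
    then show ?thesis using that by (simp add: max_def)
  qed
  have lim\<phi>: "(\<lambda>n. \<phi> n x) \<longlonglongrightarrow> sqrt 2 * sin (K * x)" if x: "0 < x" "x < 1" for x
  proof -
    have "(\<lambda>n. \<phi> n x) \<longlonglongrightarrow> sqrt 2 * sin (K * x) * ((x * (1 - x))\<^sup>2 / ((x * (1 - x))\<^sup>2 + 0\<^sup>2))"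
      unfolding \<phi>_def using x by (intro tendsto_intros plim e0) auto
    then show ?thesis using x by simp
  qed
  have lim\<phi>': "(\<lambda>n. \<phi>' n x) \<longlonglongrightarrow> sqrt 2 * K * cos (K * x)" if x: "0 < x" "x < 1" for x
  proof -
    have "(\<lambda>n. \<phi>' n x) \<longlonglongrightarrow> sqrt 2 * K * cos (K * x) * ((x * (1 - x))\<^sup>2 / ((x * (1 - x))\<^sup>2 + 0\<^sup>2))
       + sqrt 2 * sin (K * x) * (2 * (x * (1 - x)) * (1 - 2 * x) * 0\<^sup>2 / ((x * (1 - x))\<^sup>2 + 0\<^sup>2)\<^sup>2)"
      unfolding \<phi>'_def using x by (intro tendsto_intros plim e0) auto
    then show ?thesis using x by simp
  qed
  have "(\<lambda>n. L2_of (\<phi> n)) \<longlonglongrightarrow> L2_of (\<lambda>x. sqrt 2 * sin (K * x))"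
  proof (rule tendsto_L2_of_bounded[where C = 2])
    show "\<bar>sqrt 2 * sin (K * x)\<bar> \<le> 2" for x
    proof -
      have "\<bar>sqrt 2\<bar> * \<bar>sin (K * x)\<bar> \<le> 2 * 1" using s2 by (intro mult_mono) auto
      then show ?thesis by (simp add: abs_mult)
    qed
  qed (auto intro!: c\<phi> b\<phi> lim\<phi> continuous_intros)
  moreover have "(\<lambda>n. L2_of (deriv (\<phi> n))) \<longlonglongrightarrow> L2_of (\<lambda>x. sqrt 2 * K * cos (K * x))"
  proof -
    have "(\<lambda>n. L2_of (\<phi>' n)) \<longlonglongrightarrow> L2_of (\<lambda>x. sqrt 2 * K * cos (K * x))"
    proof (rule tendsto_L2_of_bounded[where C = "10 * K"])
      show "\<bar>sqrt 2 * K * cos (K * x)\<bar> \<le> 10 * K" for x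
      proof -
        have "\<bar>sqrt 2\<bar> * \<bar>K\<bar> * \<bar>cos (K * x)\<bar> \<le> 2 * K * 1" using s2 K by (intro mult_mono) auto
        then show ?thesis using K by (simp add: abs_mult)
      qed
    qed (auto intro!: c\<phi>' b\<phi>' lim\<phi>' continuous_intros)
    moreover have "deriv (\<phi> n) = \<phi>' n" for n using d\<phi> by (auto intro: DERIV_imp_deriv)
    ultimately show ?thesis by simp
  qed
  moreover have "weak_deriv (L2_of (\<lambda>x. sqrt 2 * sin (K * x))) (L2_of (\<lambda>x. sqrt 2 * K * cos (K * x)))"
    by (intro weak_deriv_C1) (auto intro!: derivative_eq_intros continuous_intros)
  ultimately show ?thesis
    unfolding H01_def sine_L2_of K_def using test by blast
qed

lemma sine_dirichlet_laplacian: "(sine k, - eigval k *\<^sub>R sine k) \<in> dirichlet_laplacian"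
proof -
  define K where "K = real k * pi"
  let ?g = "L2_of (\<lambda>x. sqrt 2 * K * cos (K * x))"
  have g: "weak_deriv (sine k) ?g"
    unfolding sine_L2_of K_def[symmetric]
    by (intro weak_deriv_C1) (auto intro!: derivative_eq_intros continuous_intros)
  have "weak_deriv ?g (L2_of (\<lambda>x. - eigval k * (sqrt 2 * sin (K * x))))"
    by (intro weak_deriv_C1)
       (auto intro!: derivative_eq_intros continuous_intros simp: eigval_def K_def power2_eq_square)
  moreover have "L2_of (\<lambda>x. - eigval k * (sqrt 2 * sin (K * x))) = - eigval k *\<^sub>R sine k"
    unfolding sine_L2_of K_def using sq_int_sine[of k] sq_int_scale[OF sq_int_sine[of k], of "- eigval k"]
    by transfer simp
  ultimately have h: "weak_deriv ?g (- eigval k *\<^sub>R sine k)" by simp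
  show ?thesis
    unfolding dirichlet_laplacian_def H2_def using g h sine_in_H01 by blast
qed

section \<open>Eigenvectors of semigroups\<close>

text \<open>Banach-Steinhaus by a gliding hump. The k-th step has length at most 4^-k and makes
  \<open>T (nn k)\<close> large at the new point; all later steps together are at most a third of
  4^-k long and cannot undo the gain, so the limit point contradicts pointwise boundedness.\<close>

lemma uniform_boundedness:
  fixes T :: "nat \<Rightarrow> 'a::banach \<Rightarrow>\<^sub>L 'b::real_normed_vector"
  assumes bdd: "\<And>x. bounded (range (\<lambda>n. T n x))"
  shows "bounded (range T)"
proof (rule ccontr)
  assume unb: "\<not> bounded (range T)"
  have big: "\<exists>n. norm (T n) > c" for c
    using unb unfolding bounded_iff by (auto simp: not_le)
  have step: "\<exists>y. dist y x \<le> r \<and> norm (T n y) \<ge> r * norm (T n) / 2" if "r > 0" for x r n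
  proof (cases "norm (T n) = 0")
    case True
    with that show ?thesis by (intro exI[of _ x]) auto
  next
    case False
    then have "norm (T n) / 2 < norm (T n)" by simp
    then obtain z where z: "norm (T n z) > norm (T n) / 2 * norm z"
      by (metis norm_blinfun_bound not_less norm_ge_zero divide_nonneg_pos zero_less_numeral)
    then have "z \<noteq> 0" by auto
    define w where "w = (r / norm z) *\<^sub>R z"
    have w: "norm w = r" "norm (T n w) \<ge> r * norm (T n) / 2"
      using \<open>z \<noteq> 0\<close> z that by (auto simp: w_def blinfun.scaleR_right field_simps)
    \<comment> \<open>one of \<open>x + w\<close>, \<open>x - w\<close> works, since their images differ by \<open>2 T w\<close>\<close>
    have "norm (T n (x + w)) \<ge> r * norm (T n) / 2 \<or> norm (T n (x - w)) \<ge> r * norm (T n) / 2"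
    proof (rule ccontr)
      assume "\<not> ?thesis"
      then have "norm (T n (x + w)) + norm (T n (x - w)) < 2 * norm (T n w)" using w(2) by auto
      moreover have "norm (T n (x + w) - T n (x - w)) = norm (2 *\<^sub>R T n w)"
        by (simp add: blinfun.add_right blinfun.diff_right scaleR_2)
      ultimately show False
        using norm_triangle_ineq4[of "T n (x + w)" "T n (x - w)"] by simp
    qed
    moreover have "dist (x + w) x = r" "dist (x - w) x = r" using w(1) by (auto simp: dist_norm)
    ultimately show ?thesis by (metis order_refl)
  qed
  \<comment> \<open>The gain of the k-th step is 1/2 of 4^-k times \<open>norm (T (nn k))\<close>,
    the later loss at most 1/3 of it. The remaining 1/6 explains the factor 6, and 4^k offsets the
    shrinking step.\<close>
  define nn where "nn k = (SOME n. norm (T n) > 6 * (real k + 1) * 4 ^ k)" for k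
  have nn: "norm (T (nn k)) > 6 * (real k + 1) * 4 ^ k" for k
    unfolding nn_def by (rule someI_ex[OF big])
  have "\<exists>X. \<forall>k. True \<and> dist (X (Suc k)) (X k) \<le> (1/4)^k \<and>
      norm (T (nn k) (X (Suc k))) \<ge> (1/4)^k * norm (T (nn k)) / 2"
    by (rule dependent_nat_choice) (use step in auto)
  then obtain X where X: "\<And>k. dist (X (Suc k)) (X k) \<le> (1/4)^k"
      "\<And>k. norm (T (nn k) (X (Suc k))) \<ge> (1/4)^k * norm (T (nn k)) / 2" by blast
  have tail: "dist (X (k + d)) (X k) \<le> (1/4)^k * 4 / 3 * (1 - (1/4)^d)" for k d
  proof (induction d)
    case (Suc d)
    have "dist (X (k + Suc d)) (X k) \<le> dist (X (Suc (k + d))) (X (k + d)) + dist (X (k + d)) (X k)"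
      using dist_triangle by simp
    also have "\<dots> \<le> (1/4)^(k + d) + (1/4)^k * 4 / 3 * (1 - (1/4)^d)"
      by (intro add_mono X Suc)
    also have "\<dots> = (1/4)^k * 4 / 3 * (1 - (1/4)^Suc d)"
      by (simp add: power_add field_simps)
    finally show ?case .
  qed simp
  have tail': "dist (X m) (X k) \<le> (1/4)^k * 4 / 3" if "m \<ge> k" for m k
  proof -
    have "(1/4)^k * 4 / 3 * (1 - (1/4)^(m - k)) \<le> (1/4)^k * 4 / (3::real)"
      by (intro mult_left_le) auto
    with tail[of k "m - k"] have "dist (X (k + (m - k))) (X k) \<le> (1/4)^k * 4 / 3"
      by (rule order_trans)
    then show ?thesis using that by simp
  qed
  have "Cauchy X"
  proof (rule metric_CauchyI)
    fix e :: real assume "e > 0"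
    then obtain k where k: "(1/4)^k < e * 3 / 8"
      using real_arch_pow_inv[of "e * 3 / 8" "1/4"] by auto
    have "dist (X m) (X n) < e" if "m \<ge> k" "n \<ge> k" for m n
      using dist_triangle2[of "X m" "X n" "X k"] tail'[OF that(1)] tail'[OF that(2)] k by simp
    then show "\<exists>M. \<forall>m\<ge>M. \<forall>n\<ge>M. dist (X m) (X n) < e" by blast
  qed
  then obtain x where x: "X \<longlonglongrightarrow> x"
    using Cauchy_convergent convergent_def by blast
  have dx: "dist x (X k) \<le> (1/4)^k * 4 / 3" for k
  proof (rule tendsto_upperbound[OF tendsto_dist[OF x tendsto_const]])
    show "\<forall>\<^sub>F m in sequentially. dist (X m) (X k) \<le> (1/4)^k * 4 / 3"
      by (rule eventually_sequentiallyI[of k]) (rule tail')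
  qed simp
  have "norm (T (nn k) x) \<ge> real k + 1" for k
  proof -
    have "norm (x - X (Suc k)) \<le> (1/4)^k / 3"
      using dx[of "Suc k"] by (simp add: dist_norm)
    then have "norm (T (nn k) (x - X (Suc k))) \<le> norm (T (nn k)) * ((1/4)^k / 3)"
      by (intro order_trans[OF norm_blinfun] mult_left_mono) auto
    moreover have "norm (T (nn k) (X (Suc k))) - norm (T (nn k) (x - X (Suc k))) \<le> norm (T (nn k) x)"
      using norm_triangle_ineq2[of "T (nn k) (X (Suc k))" "- T (nn k) (x - X (Suc k))"]
      by (simp add: blinfun.diff_right norm_minus_commute)
    ultimately have "norm (T (nn k) x) \<ge> (1/4)^k * norm (T (nn k)) / 6"
      using X(2)[of k] by (simp add: algebra_simps)
    moreover have "(1/4)^k * norm (T (nn k)) / 6 \<ge> real k + 1"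
      using nn[of k] by (simp add: field_simps)
    ultimately show ?thesis by linarith
  qed
  moreover obtain B where "\<And>n. norm (T n x) \<le> B"
    using bdd[of x] unfolding bounded_iff by auto
  moreover obtain k where "real k > B" using reals_Archimedean2 by blast
  ultimately show False by (smt (verit))
qed

lemma C0_semigroup_add:
  "C0_semigroup S \<Longrightarrow> s \<ge> 0 \<Longrightarrow> t \<ge> 0 \<Longrightarrow> S (s + t) x = S s (S t x)"
  unfolding C0_semigroup_def by simp

text \<open>If norms were unbounded near 0, a sequence of times tending to 0 would have unbounded
  norms although strong continuity makes every orbit along it convergent, against uniform
  boundedness. The semigroup law then spreads the bound near 0 over any bounded interval.\<close>

lemma C0_semigroup_locally_bounded:
  fixes S :: "real \<Rightarrow> 'a::banach \<Rightarrow>\<^sub>L 'a"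
  assumes S: "C0_semigroup S"
  obtains B where "B > 0" "\<And>s. 0 \<le> s \<Longrightarrow> s \<le> t \<Longrightarrow> norm (S s) \<le> B"
proof -
  have "\<exists>\<delta>>0. \<exists>B. \<forall>s. 0 < s \<longrightarrow> s < \<delta> \<longrightarrow> norm (S s) \<le> B"
  proof (rule ccontr)
    assume "\<not> ?thesis"
    then have "\<forall>n. \<exists>s. 0 < s \<and> s < 1 / real (Suc n) \<and> norm (S s) > real n"
      by (metis not_less zero_less_divide_1_iff of_nat_0_less_iff zero_less_Suc)
    then obtain s where s: "\<And>n. 0 < s n" "\<And>n. s n < 1 / real (Suc n)" "\<And>n. norm (S (s n)) > real n"
      by metis
    have "s \<longlonglongrightarrow> 0"
      by (rule tendsto_sandwich[OF _ _ tendsto_const LIMSEQ_Suc[OF lim_1_over_n]])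
         (use s in \<open>auto intro!: always_eventually less_imp_le\<close>)
    then have "filterlim s (at_right 0) sequentially"
      using s(1) by (intro tendsto_imp_filterlim_at_right) auto
    moreover have "((\<lambda>t. S t x) \<longlongrightarrow> x) (at_right 0)" for x
      using S by (simp add: C0_semigroup_def)
    ultimately have "(\<lambda>n. S (s n) x) \<longlonglongrightarrow> x" for x
      by (rule filterlim_compose[rotated])
    then have "bounded (range (\<lambda>n. S (s n)))"
      by (intro uniform_boundedness convergent_imp_bounded)
    then obtain B where "\<And>n. norm (S (s n)) \<le> B"
      unfolding bounded_iff by auto
    moreover obtain n where "real n > B" using reals_Archimedean2 by blast
    ultimately show False using s(3)[of n] by (smt (verit))
  qed
  then obtain \<delta> B where B: "\<delta> > 0" "\<And>s. 0 < s \<Longrightarrow> s < \<delta> \<Longrightarrow> norm (S s) \<le> B" by blast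
  obtain n where n: "real n * (\<delta> / 2) > t"
    using reals_Archimedean3[of "\<delta> / 2"] B(1) by auto
  have add: "S (a + b) = S a o\<^sub>L S b" if "a \<ge> 0" "b \<ge> 0" for a b
    using S that by (simp add: C0_semigroup_def)
  define C where "C = max 1 B"
  have 0: "norm (S s) \<le> C" if "0 \<le> s" "s < \<delta>" for s
  proof (cases "s = 0")
    case True
    then have "S s = id_blinfun" using S by (simp add: C0_semigroup_def)
    then have "norm (S s) \<le> 1" by (simp add: norm_blinfun_id_le)
    then show ?thesis by (simp add: C_def)
  qed (use B(2)[of s] that in \<open>auto simp: C_def\<close>)
  \<comment> \<open>Time steps of half the radius stay strictly below \<delta>, where the bound
    \<open>C\<close> holds. Taking \<open>C\<close> at least 1 makes its powers increasing, so one
    power serves all shorter times.\<close>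
  have *: "norm (S s) \<le> C ^ Suc m" if "0 \<le> s" "s \<le> real m * (\<delta> / 2)" for m s
    using that
  proof (induction m arbitrary: s)
    case 0
    with B(1) show ?case using \<open>\<And>s. 0 \<le> s \<Longrightarrow> s < \<delta> \<Longrightarrow> norm (S s) \<le> C\<close>[of s] by simp
  next
    case (Suc m)
    have C1: "C \<ge> 1" by (simp add: C_def)
    show ?case
    proof (cases "s \<le> \<delta> / 2")
      case True
      then have "norm (S s) \<le> C" using Suc.prems B(1) by (intro 0) auto
      also have "C ^ 1 \<le> C ^ Suc (Suc m)" using C1 by (intro power_increasing) auto
      then have "C \<le> C ^ Suc (Suc m)" by simp
      finally show ?thesis .
    next
      case False
      have "S s = S (\<delta> / 2 + (s - \<delta> / 2))" by simp
      also have "\<dots> = S (\<delta> / 2) o\<^sub>L S (s - \<delta> / 2)"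
        using False B(1) by (intro add) auto
      finally have "norm (S s) \<le> norm (S (\<delta> / 2)) * norm (S (s - \<delta> / 2))"
        using norm_blinfun_compose by metis
      also have "\<dots> \<le> C * C ^ Suc m"
        using False Suc.prems B(1) C1 by (intro mult_mono 0 Suc.IH) (auto simp: algebra_simps)
      finally show ?thesis by simp
    qed
  qed
  show ?thesis
  proof (rule that[of "C ^ Suc n"])
    show "C ^ Suc n > 0" by (simp add: C_def)
    show "\<And>s. 0 \<le> s \<Longrightarrow> s \<le> t \<Longrightarrow> norm (S s) \<le> C ^ Suc n" using * n by force
  qed
qed

text \<open>The generator gives \<open>S h x = exp (\<mu> * h) *\<^sub>R x + r h\<close> with an
  error \<open>r h\<close> of order o(h). Cutting [0, t] into n + 1 equal steps accumulates n + 1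
  such errors, each magnified by a bounded factor, hence a total of order t o(h) / h, which tends to
  0.\<close>

lemma C0_semigroup_eigenvector:
  fixes S :: "real \<Rightarrow> 'a::banach \<Rightarrow>\<^sub>L 'a"
  assumes S: "C0_semigroup S" and x: "(x, \<mu> *\<^sub>R x) \<in> generator S" and t: "t \<ge> 0"
  shows "S t x = exp (\<mu> * t) *\<^sub>R x"
proof -
  obtain B where B: "B > 0" "\<And>s. 0 \<le> s \<Longrightarrow> s \<le> t \<Longrightarrow> norm (S s) \<le> B"
    using C0_semigroup_locally_bounded[OF S] by metis
  define r where "r h = S h x - exp (\<mu> * h) *\<^sub>R x" for h
  \<comment> \<open>telescoping \<open>S(h)\<^sup>n x - e\<^bsup>\<mu>nh\<^esup> x\<close>\<close>
  have tel: "norm (S (real n * h) x - exp (\<mu> * (real n * h)) *\<^sub>R x)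
      \<le> real n * B * norm (r h) * exp (\<bar>\<mu>\<bar> * (real n * h))"
    if "h \<ge> 0" "real n * h \<le> t" for n h
    using that(2)
  proof (induction n)
    case 0
    have "S 0 x = x" using S by (simp add: C0_semigroup_def)
    then show ?case by simp
  next
    case (Suc n)
    have nh: "0 \<le> real n * h" "real n * h \<le> t" using Suc.prems that(1) by (auto simp: algebra_simps)
    have eq: "real (Suc n) * h = real n * h + h" by (simp add: algebra_simps)
    have "S (real (Suc n) * h) x - exp (\<mu> * (real (Suc n) * h)) *\<^sub>R x =
       S (real n * h) (r h) + exp (\<mu> * h) *\<^sub>R (S (real n * h) x - exp (\<mu> * (real n * h)) *\<^sub>R x)"
      unfolding eq r_def C0_semigroup_add[OF S nh(1) that(1)] distrib_left exp_add
      by (simp add: blinfun.diff_right blinfun.scaleR_right scaleR_diff_right mult.commute)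
    also have "norm \<dots> \<le> norm (S (real n * h)) * norm (r h)
        + exp (\<mu> * h) * norm (S (real n * h) x - exp (\<mu> * (real n * h)) *\<^sub>R x)"
      by (rule norm_triangle_le) (simp add: norm_blinfun)
    also have "\<dots> \<le> B * norm (r h)
        + exp (\<bar>\<mu>\<bar> * h) * (real n * B * norm (r h) * exp (\<bar>\<mu>\<bar> * (real n * h)))"
      using nh that(1) B(1) by (intro add_mono mult_mono B Suc.IH) (auto intro!: mult_right_mono)
    \<comment> \<open>With the absolute value of \<mu> the exponential is at least 1 and increasing
      in time, whatever the sign of \<mu>, so the new error can carry the same factor as the old
      ones.\<close>
    also have "B * norm (r h) * 1 \<le> B * norm (r h) * exp (\<bar>\<mu>\<bar> * (real (Suc n) * h))"
      using B(1) that(1) by (intro mult_left_mono) auto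
    then have "B * norm (r h) \<le> B * norm (r h) * exp (\<bar>\<mu>\<bar> * (real (Suc n) * h))" by simp
    finally show ?case unfolding eq
      by (simp add: distrib_left exp_add algebra_simps)
  qed
  show ?thesis
  proof (cases "t = 0")
    case True
    then show ?thesis using tel[of 0 0] t by simp
  next
    case False
    with t have t0: "t > 0" by simp
    have h0: "filterlim (\<lambda>n. t / real (Suc n)) (at_right 0) sequentially"
    proof (rule tendsto_imp_filterlim_at_right)
      show "(\<lambda>n. t / real (Suc n)) \<longlonglongrightarrow> 0"
        by (rule LIMSEQ_Suc) (rule lim_const_over_n)
    qed (use t0 in auto)
    have "((\<lambda>h. exp (\<mu> * h)) has_real_derivative \<mu>) (at 0)"
      by (auto intro!: derivative_eq_intros)
    then have lim1: "((\<lambda>h. (exp (\<mu> * h) - 1) / h) \<longlongrightarrow> \<mu>) (at_right 0)"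
      by (simp add: has_field_derivative_iff filterlim_at_split)
    have lim2: "((\<lambda>h. (1 / h) *\<^sub>R (S h x - x)) \<longlongrightarrow> \<mu> *\<^sub>R x) (at_right 0)"
      using x by (simp add: generator_def)
    have "((\<lambda>h. (1 / h) *\<^sub>R (S h x - x) - ((exp (\<mu> * h) - 1) / h) *\<^sub>R x) \<longlongrightarrow> \<mu> *\<^sub>R x - \<mu> *\<^sub>R x) (at_right 0)"
      by (intro tendsto_diff[OF lim2 tendsto_scaleR[OF lim1 tendsto_const]])
    moreover have "(1 / h) *\<^sub>R (S h x - x) - ((exp (\<mu> * h) - 1) / h) *\<^sub>R x = (1 / h) *\<^sub>R r h" for h
      by (simp add: r_def algebra_simps diff_divide_distrib)
    ultimately have "((\<lambda>h. (1 / h) *\<^sub>R r h) \<longlongrightarrow> 0) (at_right 0)" by simp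
    then have "(\<lambda>n. (1 / (t / real (Suc n))) *\<^sub>R r (t / real (Suc n))) \<longlonglongrightarrow> 0"
      using h0 by (rule filterlim_compose)
    then have "(\<lambda>n. norm ((1 / (t / real (Suc n))) *\<^sub>R r (t / real (Suc n))) * (t * B * exp (\<bar>\<mu>\<bar> * t))) \<longlonglongrightarrow> norm (0::'a) * (t * B * exp (\<bar>\<mu>\<bar> * t))"
      by (intro tendsto_intros)
    then have lim: "(\<lambda>n. norm ((1 / (t / real (Suc n))) *\<^sub>R r (t / real (Suc n))) * (t * B * exp (\<bar>\<mu>\<bar> * t))) \<longlonglongrightarrow> 0"
      by simp
    have "norm (S t x - exp (\<mu> * t) *\<^sub>R x) \<le> 0"
    proof (rule tendsto_lowerbound[OF lim always_eventually], rule allI)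
      fix n
      define m where "m = real (Suc n)"
      have m: "m > 0" "m * (t / m) = t" by (auto simp: m_def)
      have "norm (S t x - exp (\<mu> * t) *\<^sub>R x) \<le> m * B * norm (r (t / m)) * exp (\<bar>\<mu>\<bar> * t)"
        using tel[of "t / m" "Suc n"] t0 m unfolding m_def[symmetric] by simp
      also have "\<dots> = norm ((1 / (t / m)) *\<^sub>R r (t / m)) * (t * B * exp (\<bar>\<mu>\<bar> * t))"
        using t0 m(1) by (simp add: field_simps)
      finally show "norm (S t x - exp (\<mu> * t) *\<^sub>R x)
        \<le> norm ((1 / (t / real (Suc n))) *\<^sub>R r (t / real (Suc n))) * (t * B * exp (\<bar>\<mu>\<bar> * t))"
        by (simp only: m_def)
    qed simp
    then show ?thesis by simp
  qed
qed

section \<open>The heat semigroup, the square root of \<open>Q\<close> and diagonal operators in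
  sine coordinates\<close>

lemma eigval_pos: "k \<ge> 1 \<Longrightarrow> eigval k > 0"
  by (simp add: eigval_def)

lemma eigval_mono: "j \<le> k \<Longrightarrow> eigval j \<le> eigval k"
  unfolding eigval_def by (intro power_mono mult_right_mono) auto

lemma heat_semigroup_sine:
  assumes "C0_semigroup S" "generator S = dirichlet_laplacian" "t \<ge> 0"
  shows "S t (sine k) = exp (- eigval k * t) *\<^sub>R sine k"
  using assms sine_dirichlet_laplacian[of k] by (intro C0_semigroup_eigenvector) auto

text \<open>The bounded operator \<open>S t\<close> acts term by term on the sine expansion of
  \<open>F\<close>, and orthonormality leaves only the k-th term.\<close>

lemma heat_semigroup_coeff:
  assumes "C0_semigroup S" "generator S = dirichlet_laplacian" "t \<ge> 0"
  shows "inner (S t F) (sine (Suc k)) = exp (- eigval (Suc k) * t) * inner F (sine (Suc k))"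
proof -
  have "bounded_linear (\<lambda>G. inner (S t G) (sine (Suc k)))"
    by (intro bounded_linear_inner_left_comp blinfun.bounded_linear_right)
  then have "(\<lambda>j. inner (S t (inner F (sine (Suc j)) *\<^sub>R sine (Suc j))) (sine (Suc k))) sums inner (S t F) (sine (Suc k))"
    using sums_sine by (rule bounded_linear.sums)
  also have "(\<lambda>j. inner (S t (inner F (sine (Suc j)) *\<^sub>R sine (Suc j))) (sine (Suc k)))
      = (\<lambda>j. if j = k then exp (- eigval (Suc j) * t) * inner F (sine (Suc j)) else 0)"
    by (auto simp: blinfun.scaleR_right heat_semigroup_sine[OF assms] inner_sine)
  finally show ?thesis by (rule sums_unique2[OF _ sums_single])
qed

lemma heat_semigroup_decay:
  assumes "C0_semigroup S" "generator S = dirichlet_laplacian" "t \<ge> 0"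
  shows "norm (S t F) \<le> exp (- eigval 1 * t) * norm F"
proof (rule norm_le_if_coeff_le)
  fix k
  have "exp (- eigval (Suc k) * t) \<le> exp (- eigval 1 * t)"
    using eigval_mono[of 1 "Suc k"] assms(3) by (simp add: mult_right_mono)
  then show "\<bar>inner (S t F) (sine (Suc k))\<bar> \<le> exp (- eigval 1 * t) * \<bar>inner F (sine (Suc k))\<bar>"
    unfolding heat_semigroup_coeff[OF assms] abs_mult by (intro mult_right_mono) auto
qed simp

text \<open>The root is specified only by \<open>is_sqrt_op\<close>; its square fixes the eigenvalue
  up to sign, and nonnegativity selects the sign.\<close>

lemma sqrt_op_eigenvector:
  assumes R: "is_sqrt_op Q R" and e: "Q e = q *\<^sub>R e" and q: "q > 0"
  shows "R e = sqrt q *\<^sub>R e"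
proof -
  define v where "v = R e - sqrt q *\<^sub>R e"
  have RR: "R (R e) = q *\<^sub>R e"
    using R e unfolding is_sqrt_op_def by (metis blinfun_apply_blinfun_compose)
  \<comment> \<open>\<open>(R + \<surd>q)(R - \<surd>q) e = 0\<close>, so \<open>v\<close> would be an eigenvector with eigenvalue \<open>-\<surd>q < 0\<close>\<close>
  have "R v = - sqrt q *\<^sub>R v"
    using q by (simp add: v_def blinfun.diff_right blinfun.scaleR_right RR scaleR_diff_right)
  moreover have "0 \<le> inner (R v) v"
    using R by (simp add: is_sqrt_op_def nonneg_op_def)
  ultimately have "sqrt q * (norm v)\<^sup>2 \<le> 0" by (simp add: power2_norm_eq_inner)
  then have "v = 0" using q by (simp add: mult_le_0_iff)
  then show ?thesis by (simp add: v_def)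
qed

text \<open>This is the operator \<open>D\<^sub>t\<close> of the overview when \<open>m k\<close> is
  the square root of 1 - exp (-2 \<open>eigval (Suc k)\<close> t).\<close>

definition sine_multiplier :: "(nat \<Rightarrow> real) \<Rightarrow> L2 \<Rightarrow> L2" where
  "sine_multiplier m F = (\<Sum>k. (m k * inner F (sine (Suc k))) *\<^sub>R sine (Suc k))"

lemma sine_multiplier_coeff:
  assumes m: "\<And>k. \<bar>m k\<bar> \<le> 1"
  shows "inner (sine_multiplier m F) (sine (Suc k)) = m k * inner F (sine (Suc k))"
  unfolding sine_multiplier_def
proof (rule inner_suminf_sine, rule summable_comparison_test'[OF summable_inner_sine[of F]])
  fix n
  have "(m n)\<^sup>2 \<le> 1" using m[of n] by (simp add: abs_square_le_1)
  then show "norm ((m n * inner F (sine (Suc n)))\<^sup>2) \<le> (inner F (sine (Suc n)))\<^sup>2"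
    by (simp add: power_mult_distrib mult_left_le_one_le)
qed

text \<open>Coordinatewise the map is a contraction, hence continuous. This supplies the Borel
  measurability of the coupled variable.\<close>

lemma continuous_on_sine_multiplier:
  assumes m: "\<And>k. \<bar>m k\<bar> \<le> 1"
  shows "continuous_on UNIV (sine_multiplier m)"
proof (rule continuous_on_iff[THEN iffD2], intro ballI allI impI)
  fix F :: L2 and e :: real assume "e > 0"
  have "norm (sine_multiplier m G - sine_multiplier m F) \<le> 1 * norm (G - F)" for G
  proof (rule norm_le_if_coeff_le)
    fix k
    show "\<bar>inner (sine_multiplier m G - sine_multiplier m F) (sine (Suc k))\<bar> \<le> 1 * \<bar>inner (G - F) (sine (Suc k))\<bar>"
      using m[of k] unfolding inner_diff_left sine_multiplier_coeff[OF m] right_diff_distrib[symmetric]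
      by (simp add: abs_mult mult_left_le_one_le)
  qed simp
  then show "\<exists>d>0. \<forall>G\<in>UNIV. dist G F < d \<longrightarrow> dist (sine_multiplier m G) (sine_multiplier m F) < e"
    using \<open>e > 0\<close> by (intro exI[of _ e]) (auto simp: dist_norm intro: le_less_trans)
qed

lemma sine_multiplier_diff_le:
  assumes m: "\<And>k. \<bar>m k\<bar> \<le> 1" and c: "\<And>k. \<bar>m k - 1\<bar> \<le> c"
  shows "norm (sine_multiplier m F - F) \<le> c * norm F"
proof (rule norm_le_if_coeff_le)
  fix k
  have "inner (sine_multiplier m F - F) (sine (Suc k)) = (m k - 1) * inner F (sine (Suc k))"
    by (simp add: inner_diff_left sine_multiplier_coeff[OF m] left_diff_distrib)
  then show "\<bar>inner (sine_multiplier m F - F) (sine (Suc k))\<bar> \<le> c * \<bar>inner F (sine (Suc k))\<bar>"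
    using c[of k] by (simp add: abs_mult mult_right_mono)
qed (use c[of 0] in linarith)

text \<open>\<open>limit_covariance\<close> is an infinite sum in the operator norm, so convergence
  of the series must be shown before the sum can be evaluated. The rank one terms have norm at most
  1 and \<open>eigval\<close> is smallest at 1, so the summable \<open>q\<close> provides a
  majorant.\<close>

lemma limit_covariance_quadratic:
  assumes q: "\<forall>k\<ge>1. q k > 0" "summable (\<lambda>k. q (Suc k))"
  shows "(\<lambda>k. q (Suc k) / (2 * eigval (Suc k)) * (inner v (sine (Suc k)))\<^sup>2) sums inner (limit_covariance q v) v"
proof -
  let ?T = "\<lambda>k. (q (Suc k) / (2 * eigval (Suc k))) *\<^sub>R rank_one (sine (Suc k)) (sine (Suc k))"
  have "summable ?T"
  proof (rule summable_norm_cancel, rule summable_comparison_test'[OF summable_mult[OF q(2), of "1 / (2 * eigval 1)"]])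
    fix k
    have "norm (rank_one (sine (Suc k)) (sine (Suc k))) \<le> 1"
    proof (rule norm_blinfun_bound)
      fix x
      have "\<bar>inner x (sine (Suc k))\<bar> \<le> norm x * norm (sine (Suc k))" by (rule Cauchy_Schwarz_ineq2)
      then show "norm (rank_one (sine (Suc k)) (sine (Suc k)) x) \<le> 1 * norm x"
        by (simp add: rank_one.rep_eq norm_sine)
    qed simp
    then have "q (Suc k) / (2 * eigval (Suc k)) * norm (rank_one (sine (Suc k)) (sine (Suc k)))
        \<le> q (Suc k) / (2 * eigval (Suc k)) * 1"
      using q(1)[rule_format, of "Suc k"] eigval_pos[of "Suc k"] by (intro mult_left_mono) auto
    then have "norm (?T k) \<le> q (Suc k) / (2 * eigval (Suc k))"
      using q(1)[rule_format, of "Suc k"] eigval_pos[of "Suc k"] by simp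
    also have "\<dots> \<le> q (Suc k) / (2 * eigval 1)"
      using q(1)[rule_format, of "Suc k"] eigval_pos[of 1] eigval_mono[of 1 "Suc k"]
      by (intro divide_left_mono) (auto intro!: mult_pos_pos)
    finally show "norm (norm (?T k)) \<le> 1 / (2 * eigval 1) * q (Suc k)" by simp
  qed
  then have "?T sums limit_covariance q"
    unfolding limit_covariance_def by (rule summable_sums)
  moreover have "bounded_linear (\<lambda>T :: L2 \<Rightarrow>\<^sub>L L2. inner (T v) v)"
    by (intro bounded_linear_inner_left_comp blinfun.bounded_linear_left)
  ultimately have "(\<lambda>k. inner (?T k v) v) sums inner (limit_covariance q v) v"
    by (rule bounded_linear.sums[rotated])
  then show ?thesis
    by (simp add: blinfun.scaleR_left rank_one.rep_eq power2_eq_square inner_commute[of _ v] mult.assoc)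
qed

section \<open>Characteristic functions and Gaussian laws\<close>

text \<open>Both weights have the same mass \<open>a\<close>, by the hypothesis at zero frequency
  and phase. Divided by \<open>a\<close> they become probability densities, and Levy uniqueness
  identifies the laws of \<open>X\<close> and \<open>Y\<close> under them. The weights are what
  allows events in other coordinates to be carried along in the multivariate statement.\<close>

lemma tilted_law_eq:
  fixes X :: "'a \<Rightarrow> real" and Y :: "'b \<Rightarrow> real"
  assumes M: "prob_space M" and N: "prob_space N"
    and X[measurable]: "X \<in> borel_measurable M" and Y[measurable]: "Y \<in> borel_measurable N"
    and w[measurable]: "w \<in> borel_measurable M" "\<And>\<omega>. 0 \<le> w \<omega>" "\<And>\<omega>. w \<omega> \<le> (C::real)"
    and v[measurable]: "v \<in> borel_measurable N" "\<And>\<omega>. 0 \<le> v \<omega>" "\<And>\<omega>. v \<omega> \<le> C"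
    and eq: "\<And>s \<theta>. (\<integral>\<omega>. w \<omega> * cos (s * X \<omega> + \<theta>) \<partial>M) = (\<integral>\<omega>. v \<omega> * cos (s * Y \<omega> + \<theta>) \<partial>N)"
    and A[measurable]: "A \<in> sets borel"
  shows "(\<integral>\<omega>. w \<omega> * indicator A (X \<omega>) \<partial>M) = (\<integral>\<omega>. v \<omega> * indicator A (Y \<omega>) \<partial>N)"
proof -
  interpret M: prob_space M by (rule M)
  interpret N: prob_space N by (rule N)
  define a where "a = (\<integral>\<omega>. w \<omega> \<partial>M)"
  have iw: "integrable M (\<lambda>\<omega>. w \<omega> * g \<omega>)" if "g \<in> borel_measurable M" "\<And>\<omega>. \<bar>g \<omega>\<bar> \<le> 1" for g
    using that w by (intro M.integrable_const_bound[where B = C]) (auto simp: abs_mult intro!: mult_left_le order_trans[OF mult_left_le w(3)])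
  have iv: "integrable N (\<lambda>\<omega>. v \<omega> * g \<omega>)" if "g \<in> borel_measurable N" "\<And>\<omega>. \<bar>g \<omega>\<bar> \<le> 1" for g
    using that v by (intro N.integrable_const_bound[where B = C]) (auto simp: abs_mult intro!: mult_left_le order_trans[OF mult_left_le v(3)])
  have av: "a = (\<integral>\<omega>. v \<omega> \<partial>N)" using eq[of 0 0] by (simp add: a_def)
  have a0: "a \<ge> 0" unfolding a_def by (simp add: w)
  show ?thesis
  \<comment> \<open>A zero mass cannot be normalised, but then both weights vanish almost
    everywhere.\<close>
  proof (cases "a = 0")
    case True
    have "AE \<omega> in M. w \<omega> = 0"
      using True iw[of "\<lambda>_. 1"] w(2) by (subst integral_nonneg_eq_0_iff_AE[symmetric]) (auto simp: a_def)
    then have "(\<integral>\<omega>. w \<omega> * indicator A (X \<omega>) \<partial>M) = 0"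
      by (intro integral_eq_zero_AE) auto
    moreover have "AE \<omega> in N. v \<omega> = 0"
      using True iv[of "\<lambda>_. 1"] v(2) by (subst integral_nonneg_eq_0_iff_AE[symmetric]) (auto simp: av)
    then have "(\<integral>\<omega>. v \<omega> * indicator A (Y \<omega>) \<partial>N) = 0"
      by (intro integral_eq_zero_AE) auto
    ultimately show ?thesis by simp
  next
    case False
    with a0 have a: "a > 0" by simp
    \<comment> \<open>Stated for a generic space \<open>P\<close>, so that it applies both to
      \<open>X\<close> on \<open>M\<close> and to \<open>Y\<close> on \<open>N\<close>.\<close>
    have tilt: "real_distribution (distr (density P (\<lambda>\<omega>. ennreal (f \<omega> / a))) borel U) \<and>
        measure (distr (density P (\<lambda>\<omega>. ennreal (f \<omega> / a))) borel U) A = (\<integral>\<omega>. f \<omega> * indicator A (U \<omega>) \<partial>P) / a \<and>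
        (\<forall>t. char (distr (density P (\<lambda>\<omega>. ennreal (f \<omega> / a))) borel U) t
          = Complex ((\<integral>\<omega>. f \<omega> * cos (t * U \<omega>) \<partial>P) / a) ((\<integral>\<omega>. f \<omega> * sin (t * U \<omega>) \<partial>P) / a))"
      if [measurable]: "f \<in> borel_measurable P" "U \<in> borel_measurable P" and f0: "\<And>\<omega>. 0 \<le> f \<omega>"
        and int: "\<And>g. g \<in> borel_measurable P \<Longrightarrow> (\<And>\<omega>. \<bar>g \<omega>\<bar> \<le> 1) \<Longrightarrow> integrable P (\<lambda>\<omega>. f \<omega> * g \<omega>)"
        and fa: "(\<integral>\<omega>. f \<omega> \<partial>P) = a" for P :: "'c measure" and f U
    proof -
      let ?D = "density P (\<lambda>\<omega>. ennreal (f \<omega> / a))"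
      have nn: "(\<integral>\<^sup>+\<omega>. ennreal (f \<omega> / a) * indicator B \<omega> \<partial>P) = ennreal ((\<integral>\<omega>. f \<omega> * indicator B \<omega> \<partial>P) / a)"
        if [measurable]: "B \<in> sets P" for B
      proof -
        have "(\<integral>\<^sup>+\<omega>. ennreal (f \<omega> / a) * indicator B \<omega> \<partial>P) = (\<integral>\<^sup>+\<omega>. ennreal (f \<omega> * indicator B \<omega> / a) \<partial>P)"
          by (intro nn_integral_cong) (auto simp: indicator_def)
        also have "\<dots> = ennreal (\<integral>\<omega>. f \<omega> * indicator B \<omega> / a \<partial>P)"
          using f0 a by (intro nn_integral_eq_integral Bochner_Integration.integrable_divide int) (auto simp: indicator_def)
        finally show ?thesis by simp
      qed
      have pD: "prob_space ?D"
      proof (rule prob_spaceI)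
        show "emeasure ?D (space ?D) = 1"
          using nn[of "space P"] fa a by (simp add: emeasure_density cong: Bochner_Integration.integral_cong)
      qed
      then interpret D: prob_space ?D .
      have 1: "real_distribution (distr ?D borel U)" by (rule D.real_distribution_distr) simp
      have "measure (distr ?D borel U) A = (\<integral>\<omega>. f \<omega> * indicator A (U \<omega>) \<partial>P) / a"
      proof -
        have "emeasure (distr ?D borel U) A = emeasure ?D (U -` A \<inter> space P)"
          by (subst emeasure_distr) auto
        also have "\<dots> = ennreal ((\<integral>\<omega>. f \<omega> * indicator (U -` A \<inter> space P) \<omega> \<partial>P) / a)"
          by (subst emeasure_density) (auto intro!: nn)
        also have "(\<integral>\<omega>. f \<omega> * indicator (U -` A \<inter> space P) \<omega> \<partial>P) = (\<integral>\<omega>. f \<omega> * indicator A (U \<omega>) \<partial>P)"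
          by (intro Bochner_Integration.integral_cong) (auto simp: indicator_def)
        finally show ?thesis
          using a by (simp add: measure_def f0)
      qed
      moreover have "char (distr ?D borel U) t
          = Complex ((\<integral>\<omega>. f \<omega> * cos (t * U \<omega>) \<partial>P) / a) ((\<integral>\<omega>. f \<omega> * sin (t * U \<omega>) \<partial>P) / a)" for t
      proof -
        have ii: "integrable P (\<lambda>\<omega>. (f \<omega> / a) *\<^sub>R iexp (t * U \<omega>))"
        proof (rule Bochner_Integration.integrable_bound)
          show "integrable P (\<lambda>\<omega>. f \<omega> / a)" using int[of "\<lambda>_. 1"] by simp
        qed (use f0 in \<open>auto simp: norm_mult\<close>)
        have "char (distr ?D borel U) t = (CLINT \<omega>|?D. iexp (t * U \<omega>))"
          unfolding char_def by (subst integral_distr) auto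
        also have "\<dots> = (CLINT \<omega>|P. (f \<omega> / a) *\<^sub>R iexp (t * U \<omega>))"
          using f0 a by (subst integral_density) auto
        finally have *: "char (distr ?D borel U) t = (CLINT \<omega>|P. (f \<omega> / a) *\<^sub>R iexp (t * U \<omega>))" .
        show ?thesis
        proof (rule complex_eqI)
          have "Re (char (distr ?D borel U) t) = (\<integral>\<omega>. Re ((f \<omega> / a) *\<^sub>R iexp (t * U \<omega>)) \<partial>P)"
            unfolding * using ii by (rule integral_Re[symmetric])
          then show "Re (char (distr ?D borel U) t) = Re (Complex ((\<integral>\<omega>. f \<omega> * cos (t * U \<omega>) \<partial>P) / a) ((\<integral>\<omega>. f \<omega> * sin (t * U \<omega>) \<partial>P) / a))"
            by (simp add: Re_exp)
          have "Im (char (distr ?D borel U) t) = (\<integral>\<omega>. Im ((f \<omega> / a) *\<^sub>R iexp (t * U \<omega>)) \<partial>P)"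
            unfolding * using ii by (rule integral_Im[symmetric])
          then show "Im (char (distr ?D borel U) t) = Im (Complex ((\<integral>\<omega>. f \<omega> * cos (t * U \<omega>) \<partial>P) / a) ((\<integral>\<omega>. f \<omega> * sin (t * U \<omega>) \<partial>P) / a))"
            by (simp add: Im_exp)
        qed
      qed
      ultimately show ?thesis using 1 by blast
    qed
    \<comment> \<open>The free phase lets the cosine hypothesis cover the imaginary part of the
      characteristic function as well.\<close>
    have sin_cos: "sin z = cos (z + (- pi / 2))" for z :: real
      by (simp add: cos_diff)
    let ?P = "distr (density M (\<lambda>\<omega>. ennreal (w \<omega> / a))) borel X"
    let ?Q = "distr (density N (\<lambda>\<omega>. ennreal (v \<omega> / a))) borel Y"
    note P = tilt[OF w(1) X w(2) iw a_def[symmetric]] and Q = tilt[OF v(1) Y v(2) iv av[symmetric]]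
    have "char ?P = char ?Q"
    proof
      fix t
      have "(\<integral>\<omega>. w \<omega> * sin (t * X \<omega>) \<partial>M) = (\<integral>\<omega>. v \<omega> * sin (t * Y \<omega>) \<partial>N)"
        unfolding sin_cos by (rule eq)
      then show "char ?P t = char ?Q t" using P Q eq[of t 0] by simp
    qed
    then have "?P = ?Q" using P Q Levy_uniqueness by blast
    then have "(\<integral>\<omega>. w \<omega> * indicator A (X \<omega>) \<partial>M) / a = (\<integral>\<omega>. v \<omega> * indicator A (Y \<omega>) \<partial>N) / a"
      using P Q by metis
    with a show ?thesis by simp
  qed
qed

text \<open>Coordinates are moved one at a time from the frequency side to the event side: after m
  rounds \<open>key\<close> has indicators in the first m coordinates and a phased cosine of a
  linear form in the others. After n rounds it compares the measures of rectangles, which determine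
  a finite measure on the product space.\<close>

lemma joint_law_eq:
  fixes \<xi> :: "nat \<Rightarrow> 'a \<Rightarrow> real" and \<eta> :: "nat \<Rightarrow> 'b \<Rightarrow> real"
  assumes M: "prob_space M" and N: "prob_space N"
    and xi: "\<And>i. \<xi> i \<in> borel_measurable M" and eta: "\<And>i. \<eta> i \<in> borel_measurable N"
    and char: "\<And>c \<theta>. (\<integral>\<omega>. cos ((\<Sum>i<n. c i * \<xi> i \<omega>) + \<theta>) \<partial>M) = (\<integral>\<omega>. cos ((\<Sum>i<n. c i * \<eta> i \<omega>) + \<theta>) \<partial>N)"
  shows "distr M (Pi\<^sub>M {..<n} (\<lambda>_. borel)) (\<lambda>\<omega>. \<lambda>i\<in>{..<n}. \<xi> i \<omega>)
    = distr N (Pi\<^sub>M {..<n} (\<lambda>_. borel)) (\<lambda>\<omega>. \<lambda>i\<in>{..<n}. \<eta> i \<omega>)"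
proof -
  interpret M: prob_space M by (rule M)
  interpret N: prob_space N by (rule N)
  note [measurable] = xi eta
  define G where "G m A x = (\<Prod>i<m. indicator (A i) (x i) :: real)" for m and A :: "nat \<Rightarrow> real set" and x
  have G: "0 \<le> G m A x" "G m A x \<le> 1" for m A x
    unfolding G_def by (auto intro!: prod_nonneg prod_le_1 simp: indicator_def)
  have G_Suc: "G (Suc m) A x = G m A x * indicator (A m) (x m)" for m A x
    by (simp add: G_def mult.commute)
  have GM: "(\<lambda>\<omega>. G m A (\<lambda>i. \<xi> i \<omega>)) \<in> borel_measurable M" if "\<And>i. A i \<in> sets borel" for m A
    using that unfolding G_def by (intro borel_measurable_prod measurable_compose[OF xi borel_measurable_indicator]) auto
  have GN: "(\<lambda>\<omega>. G m A (\<lambda>i. \<eta> i \<omega>)) \<in> borel_measurable N" if "\<And>i. A i \<in> sets borel" for m A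
    using that unfolding G_def by (intro borel_measurable_prod measurable_compose[OF eta borel_measurable_indicator]) auto
  have key: "(\<integral>\<omega>. G m A (\<lambda>i. \<xi> i \<omega>) * cos ((\<Sum>i=m..<n. c i * \<xi> i \<omega>) + \<theta>) \<partial>M)
     = (\<integral>\<omega>. G m A (\<lambda>i. \<eta> i \<omega>) * cos ((\<Sum>i=m..<n. c i * \<eta> i \<omega>) + \<theta>) \<partial>N)"
    if "m \<le> n" and A: "\<And>i. A i \<in> sets borel" for m A c \<theta>
    using that(1)
  proof (induction m arbitrary: c \<theta>)
    case 0
    then show ?case using char[of c \<theta>] by (simp add: G_def atLeast0LessThan)
  next
    case (Suc m)
    then have IH: "(\<integral>\<omega>. G m A (\<lambda>i. \<xi> i \<omega>) * cos ((\<Sum>i=m..<n. c i * \<xi> i \<omega>) + \<theta>) \<partial>M)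
     = (\<integral>\<omega>. G m A (\<lambda>i. \<eta> i \<omega>) * cos ((\<Sum>i=m..<n. c i * \<eta> i \<omega>) + \<theta>) \<partial>N)" for c \<theta>
      by simp
    note [measurable] = GM[OF A, of m] GN[OF A, of m] A
    have split: "(\<Sum>i=m..<n. (c(m := s)) i * x i) = s * x m + (\<Sum>i=Suc m..<n. c i * x i)" for s c and x :: "nat \<Rightarrow> real"
      using Suc.prems by (subst sum.atLeast_Suc_lessThan) auto
    have iM: "integrable M (\<lambda>\<omega>. G m A (\<lambda>i. \<xi> i \<omega>) * g \<omega>)"
      if "g \<in> borel_measurable M" "\<And>\<omega>. \<bar>g \<omega>\<bar> \<le> 1" for g
      using that G by (intro M.integrable_const_bound[where B = 1]) (auto simp: abs_mult intro!: mult_le_one)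
    have iN: "integrable N (\<lambda>\<omega>. G m A (\<lambda>i. \<eta> i \<omega>) * g \<omega>)"
      if "g \<in> borel_measurable N" "\<And>\<omega>. \<bar>g \<omega>\<bar> \<le> 1" for g
      using that G by (intro N.integrable_const_bound[where B = 1]) (auto simp: abs_mult intro!: mult_le_one)
    have abs_mult1: "\<bar>x * y\<bar> \<le> 1" if "\<bar>x\<bar> \<le> 1" "\<bar>y\<bar> \<le> 1" for x y :: real
      using that by (auto simp: abs_mult intro!: mult_le_one)
    \<comment> \<open>the law of the \<open>m\<close>-th coordinate under the tilted weight \<open>G (1 + b cos \<dots>) \<ge> 0\<close>; the cases
      \<open>b = 0\<close> and \<open>b = 1\<close> differ by the wanted quantity\<close>
    have tilt: "(\<integral>\<omega>. G m A (\<lambda>i. \<xi> i \<omega>) * (1 + b * cos ((\<Sum>i=Suc m..<n. c i * \<xi> i \<omega>) + \<theta>)) * indicator (A m) (\<xi> m \<omega>) \<partial>M)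
      = (\<integral>\<omega>. G m A (\<lambda>i. \<eta> i \<omega>) * (1 + b * cos ((\<Sum>i=Suc m..<n. c i * \<eta> i \<omega>) + \<theta>)) * indicator (A m) (\<eta> m \<omega>) \<partial>N)"
      if b: "0 \<le> b" "b \<le> 1" for b
    proof (rule tilted_law_eq[OF M N xi eta, where C = 2])
      have c1: "0 \<le> 1 + b * cos z \<and> 1 + b * cos z \<le> 2" for z
      proof -
        have "\<bar>b * cos z\<bar> \<le> 1" using b by (intro abs_mult1) auto
        then show ?thesis by linarith
      qed
      show "0 \<le> G m A (\<lambda>i. \<xi> i \<omega>) * (1 + b * cos ((\<Sum>i=Suc m..<n. c i * \<xi> i \<omega>) + \<theta>))" for \<omega>
        using c1 G by (intro mult_nonneg_nonneg) auto
      show "0 \<le> G m A (\<lambda>i. \<eta> i \<omega>) * (1 + b * cos ((\<Sum>i=Suc m..<n. c i * \<eta> i \<omega>) + \<theta>))" for \<omega>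
        using c1 G by (intro mult_nonneg_nonneg) auto
      have "G m A x * (1 + b * cos z) \<le> 1 * 2" for x z
        using c1[of z] G[of m A x] by (intro mult_mono) auto
      then show "G m A (\<lambda>i. \<xi> i \<omega>) * (1 + b * cos ((\<Sum>i=Suc m..<n. c i * \<xi> i \<omega>) + \<theta>)) \<le> 2"
        "G m A (\<lambda>i. \<eta> i \<omega>') * (1 + b * cos ((\<Sum>i=Suc m..<n. c i * \<eta> i \<omega>') + \<theta>)) \<le> 2" for \<omega> \<omega>'
        by auto
      fix s \<theta>'
      \<comment> \<open>Product-to-sum puts the frequency \<open>s\<close> of coordinate m into the
        linear form. The three resulting forms differ in that entry, or drop the other frequencies,
        and each falls under the induction hypothesis.\<close>
      define c0 c1 c2 :: "nat \<Rightarrow> real"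
        where "c0 = (\<lambda>_. 0)(m := s)" and "c1 = c(m := s)" and "c2 = c(m := - s)"
      have expand: "G m A x * (1 + b * cos ((\<Sum>i=Suc m..<n. c i * x i) + \<theta>)) * cos (s * x m + \<theta>')
        = G m A x * cos ((\<Sum>i=m..<n. c0 i * x i) + \<theta>')
          + b / 2 * (G m A x * cos ((\<Sum>i=m..<n. c2 i * x i) + (\<theta> - \<theta>')))
          + b / 2 * (G m A x * cos ((\<Sum>i=m..<n. c1 i * x i) + (\<theta> + \<theta>')))" for x
      proof -
        define z where "z = (\<Sum>i=Suc m..<n. c i * x i) + \<theta>"
        define y where "y = s * x m + \<theta>'"
        have "cos z * cos y = (cos (z - y) + cos (z + y)) / 2" by (rule cos_times_cos)
        then have "G m A x * cos y + b * G m A x * (cos z * cos y)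
            = G m A x * cos y + b / 2 * (G m A x * cos (z - y)) + b / 2 * (G m A x * cos (z + y))"
          by (simp add: \<open>cos z * cos y = _\<close> algebra_simps add_divide_distrib)
        then have "G m A x * (1 + b * cos z) * cos y
            = G m A x * cos y + b / 2 * (G m A x * cos (z - y)) + b / 2 * (G m A x * cos (z + y))"
          by (simp add: algebra_simps)
        moreover have "(\<Sum>i=m..<n. c0 i * x i) + \<theta>' = y" unfolding c0_def split by (simp add: y_def)
        moreover have "(\<Sum>i=m..<n. c2 i * x i) + (\<theta> - \<theta>') = z - y" unfolding c2_def split by (simp add: y_def z_def)
        moreover have "(\<Sum>i=m..<n. c1 i * x i) + (\<theta> + \<theta>') = z + y" unfolding c1_def split by (simp add: y_def z_def)
        ultimately show ?thesis by (simp only: z_def y_def)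
      qed
      show "(\<integral>\<omega>. G m A (\<lambda>i. \<xi> i \<omega>) * (1 + b * cos ((\<Sum>i=Suc m..<n. c i * \<xi> i \<omega>) + \<theta>)) * cos (s * \<xi> m \<omega> + \<theta>') \<partial>M)
        = (\<integral>\<omega>. G m A (\<lambda>i. \<eta> i \<omega>) * (1 + b * cos ((\<Sum>i=Suc m..<n. c i * \<eta> i \<omega>) + \<theta>)) * cos (s * \<eta> m \<omega> + \<theta>') \<partial>N)"
        (is "?L = ?R")
      proof -
        let ?F = "\<lambda>x. G m A x * cos ((\<Sum>i=m..<n. c0 i * x i) + \<theta>')
          + b / 2 * (G m A x * cos ((\<Sum>i=m..<n. c2 i * x i) + (\<theta> - \<theta>')))
          + b / 2 * (G m A x * cos ((\<Sum>i=m..<n. c1 i * x i) + (\<theta> + \<theta>')))"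
        have "?L = (\<integral>\<omega>. ?F (\<lambda>i. \<xi> i \<omega>) \<partial>M)"
          by (rule Bochner_Integration.integral_cong[OF refl expand])
        also have "\<dots> = (\<integral>\<omega>. ?F (\<lambda>i. \<eta> i \<omega>) \<partial>N)"
          by (simp add: iM iN IH)
        also have "\<dots> = ?R"
          by (rule Bochner_Integration.integral_cong[OF refl expand[symmetric]])
        finally show ?thesis .
      qed
    qed (use A in measurable)
    have sub: "g * (1 + 1 * z) * i - g * (1 + 0 * z) * i = g * i * z" for g z i :: real
      by (simp add: algebra_simps)
    have "(\<integral>\<omega>. G (Suc m) A (\<lambda>i. \<xi> i \<omega>) * cos ((\<Sum>i=Suc m..<n. c i * \<xi> i \<omega>) + \<theta>) \<partial>M)
      = (\<integral>\<omega>. G m A (\<lambda>i. \<xi> i \<omega>) * (1 + 1 * cos ((\<Sum>i=Suc m..<n. c i * \<xi> i \<omega>) + \<theta>)) * indicator (A m) (\<xi> m \<omega>)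
          - G m A (\<lambda>i. \<xi> i \<omega>) * (1 + 0 * cos ((\<Sum>i=Suc m..<n. c i * \<xi> i \<omega>) + \<theta>)) * indicator (A m) (\<xi> m \<omega>) \<partial>M)"
      unfolding sub G_Suc ..
    also have "\<dots> = (\<integral>\<omega>. G m A (\<lambda>i. \<xi> i \<omega>) * (1 + 1 * cos ((\<Sum>i=Suc m..<n. c i * \<xi> i \<omega>) + \<theta>)) * indicator (A m) (\<xi> m \<omega>) \<partial>M)
          - (\<integral>\<omega>. G m A (\<lambda>i. \<xi> i \<omega>) * (1 + 0 * cos ((\<Sum>i=Suc m..<n. c i * \<xi> i \<omega>) + \<theta>)) * indicator (A m) (\<xi> m \<omega>) \<partial>M)"
    proof (rule Bochner_Integration.integral_diff)
      show "integrable M (\<lambda>\<omega>. G m A (\<lambda>i. \<xi> i \<omega>) * (1 + 1 * cos ((\<Sum>i=Suc m..<n. c i * \<xi> i \<omega>) + \<theta>)) * indicator (A m) (\<xi> m \<omega>))"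
        using A by (auto simp: distrib_left distrib_right mult.assoc intro!: iM Bochner_Integration.integrable_add abs_mult1 simp: indicator_def)
      show "integrable M (\<lambda>\<omega>. G m A (\<lambda>i. \<xi> i \<omega>) * (1 + 0 * cos ((\<Sum>i=Suc m..<n. c i * \<xi> i \<omega>) + \<theta>)) * indicator (A m) (\<xi> m \<omega>))"
        using A by (auto intro!: iM simp: indicator_def)
    qed
    also have "\<dots> = (\<integral>\<omega>. G m A (\<lambda>i. \<eta> i \<omega>) * (1 + 1 * cos ((\<Sum>i=Suc m..<n. c i * \<eta> i \<omega>) + \<theta>)) * indicator (A m) (\<eta> m \<omega>) \<partial>N)
          - (\<integral>\<omega>. G m A (\<lambda>i. \<eta> i \<omega>) * (1 + 0 * cos ((\<Sum>i=Suc m..<n. c i * \<eta> i \<omega>) + \<theta>)) * indicator (A m) (\<eta> m \<omega>) \<partial>N)"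
      by (intro arg_cong2[where f = "(-)"] tilt) auto
    also have "\<dots> = (\<integral>\<omega>. G m A (\<lambda>i. \<eta> i \<omega>) * (1 + 1 * cos ((\<Sum>i=Suc m..<n. c i * \<eta> i \<omega>) + \<theta>)) * indicator (A m) (\<eta> m \<omega>)
          - G m A (\<lambda>i. \<eta> i \<omega>) * (1 + 0 * cos ((\<Sum>i=Suc m..<n. c i * \<eta> i \<omega>) + \<theta>)) * indicator (A m) (\<eta> m \<omega>) \<partial>N)"
    proof (rule Bochner_Integration.integral_diff[symmetric])
      show "integrable N (\<lambda>\<omega>. G m A (\<lambda>i. \<eta> i \<omega>) * (1 + 1 * cos ((\<Sum>i=Suc m..<n. c i * \<eta> i \<omega>) + \<theta>)) * indicator (A m) (\<eta> m \<omega>))"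
        using A by (auto simp: distrib_left distrib_right mult.assoc intro!: iN Bochner_Integration.integrable_add abs_mult1 simp: indicator_def)
      show "integrable N (\<lambda>\<omega>. G m A (\<lambda>i. \<eta> i \<omega>) * (1 + 0 * cos ((\<Sum>i=Suc m..<n. c i * \<eta> i \<omega>) + \<theta>)) * indicator (A m) (\<eta> m \<omega>))"
        using A by (auto intro!: iN simp: indicator_def)
    qed
    also have "\<dots> = (\<integral>\<omega>. G (Suc m) A (\<lambda>i. \<eta> i \<omega>) * cos ((\<Sum>i=Suc m..<n. c i * \<eta> i \<omega>) + \<theta>) \<partial>N)"
      unfolding sub G_Suc ..
    finally show ?case .
  qed
  let ?P = "Pi\<^sub>M {..<n} (\<lambda>_. borel :: real measure)"
  have mM[measurable]: "(\<lambda>\<omega>. \<lambda>i\<in>{..<n}. \<xi> i \<omega>) \<in> measurable M ?P" by (intro measurable_restrict xi)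
  have mN[measurable]: "(\<lambda>\<omega>. \<lambda>i\<in>{..<n}. \<eta> i \<omega>) \<in> measurable N ?P" by (intro measurable_restrict eta)
  have rect: "measure (distr M ?P (\<lambda>\<omega>. \<lambda>i\<in>{..<n}. \<xi> i \<omega>)) (Pi\<^sub>E {..<n} A) = (\<integral>\<omega>. G n A (\<lambda>i. \<xi> i \<omega>) \<partial>M)"
    "measure (distr N ?P (\<lambda>\<omega>. \<lambda>i\<in>{..<n}. \<eta> i \<omega>)) (Pi\<^sub>E {..<n} A) = (\<integral>\<omega>. G n A (\<lambda>i. \<eta> i \<omega>) \<partial>N)"
    if A: "\<And>i. A i \<in> sets borel" for A
  proof -
    have ind: "G n A x = indicator (Pi\<^sub>E {..<n} A) (\<lambda>i\<in>{..<n}. x i)" for x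
    proof (cases "\<forall>i<n. x i \<in> A i")
      case True
      then show ?thesis by (auto simp: G_def PiE_iff)
    next
      case False
      then obtain i where i: "i < n" "x i \<notin> A i" by blast
      then have "G n A x = 0" unfolding G_def by (intro prod_zero bexI[of _ i]) auto
      moreover have "(\<lambda>i\<in>{..<n}. x i) \<notin> Pi\<^sub>E {..<n} A" using i by (auto simp: PiE_iff)
      ultimately show ?thesis by simp
    qed
    have S: "Pi\<^sub>E {..<n} A \<in> sets ?P" using A by (intro sets_PiM_I_finite) auto
    show "measure (distr M ?P (\<lambda>\<omega>. \<lambda>i\<in>{..<n}. \<xi> i \<omega>)) (Pi\<^sub>E {..<n} A) = (\<integral>\<omega>. G n A (\<lambda>i. \<xi> i \<omega>) \<partial>M)"
      unfolding ind using S
      by (subst integral_distr[OF mM, symmetric]) (auto simp: sets.sets_into_space Int_absorb2)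
    show "measure (distr N ?P (\<lambda>\<omega>. \<lambda>i\<in>{..<n}. \<eta> i \<omega>)) (Pi\<^sub>E {..<n} A) = (\<integral>\<omega>. G n A (\<lambda>i. \<eta> i \<omega>) \<partial>N)"
      unfolding ind using S
      by (subst integral_distr[OF mN, symmetric]) (auto simp: sets.sets_into_space Int_absorb2)
  qed
  interpret D: prob_space "distr M ?P (\<lambda>\<omega>. \<lambda>i\<in>{..<n}. \<xi> i \<omega>)" by (rule M.prob_space_distr) measurable
  interpret E: prob_space "distr N ?P (\<lambda>\<omega>. \<lambda>i\<in>{..<n}. \<eta> i \<omega>)" by (rule N.prob_space_distr) measurable
  show ?thesis
  proof (rule measure_eqI_PiM_finite)
    fix A :: "nat \<Rightarrow> real set" assume "\<And>i. i \<in> {..<n} \<Longrightarrow> A i \<in> sets borel"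
    \<comment> \<open>\<open>key\<close> asks for measurable sets at all indices, so the sets beyond
      \<open>n\<close> are replaced by the whole line. At m = n with zero phase the cosine is cos 0
      = 1.\<close>
    then have A': "(if i < n then A i else UNIV) \<in> sets borel" for i by simp
    have e: "Pi\<^sub>E {..<n} A = Pi\<^sub>E {..<n} (\<lambda>i. if i < n then A i else UNIV)"
      by (intro PiE_cong) auto
    show "emeasure (distr M ?P (\<lambda>\<omega>. \<lambda>i\<in>{..<n}. \<xi> i \<omega>)) (Pi\<^sub>E {..<n} A)
        = emeasure (distr N ?P (\<lambda>\<omega>. \<lambda>i\<in>{..<n}. \<eta> i \<omega>)) (Pi\<^sub>E {..<n} A)"
      unfolding D.emeasure_eq_measure E.emeasure_eq_measure e rect[OF A']
      using key[of n "\<lambda>i. if i < n then A i else UNIV" "\<lambda>_. 0" 0] A' by simp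
  next
    show "range (\<lambda>_::nat. space ?P) \<subseteq> prod_algebra {..<n} (\<lambda>_. borel :: real measure)"
      using space_in_prod_algebra[of "{..<n}" "\<lambda>_. borel :: real measure"] by (auto simp: space_PiM)
  qed auto
qed

section \<open>One-dimensional Gaussian variables and Gaussian families\<close>

text \<open>Writing the variance as the second moment lets one formula cover the degenerate case and
  the case with a density; the latter reduces to the characteristic function of the standard normal
  law.\<close>

lemma (in prob_space) centered_normal_moments:
  assumes "centered_normal M Y"
  shows centered_normal_square_integrable: "integrable M (\<lambda>\<omega>. (Y \<omega>)\<^sup>2)"
    and centered_normal_cos: "expectation (\<lambda>\<omega>. cos (Y \<omega> + \<theta>)) = exp (- expectation (\<lambda>\<omega>. (Y \<omega>)\<^sup>2) / 2) * cos \<theta>"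
proof -
  have [measurable]: "Y \<in> borel_measurable M" using assms by (simp add: centered_normal_def)
  consider "AE \<omega> in M. Y \<omega> = 0" | \<sigma> where "\<sigma> > 0" "distributed M lborel Y (normal_density 0 \<sigma>)"
    using assms by (auto simp: centered_normal_def)
  then have "integrable M (\<lambda>\<omega>. (Y \<omega>)\<^sup>2) \<and>
     expectation (\<lambda>\<omega>. cos (Y \<omega> + \<theta>)) = exp (- expectation (\<lambda>\<omega>. (Y \<omega>)\<^sup>2) / 2) * cos \<theta>"
  proof cases
    case 1
    have "AE \<omega> in M. (Y \<omega>)\<^sup>2 = 0" using 1 by eventually_elim simp
    then have "integrable M (\<lambda>\<omega>. (Y \<omega>)\<^sup>2) \<longleftrightarrow> integrable M (\<lambda>\<omega>. 0::real)"
      by (intro integrable_cong_AE) auto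
    moreover have "expectation (\<lambda>\<omega>. (Y \<omega>)\<^sup>2) = 0"
      using \<open>AE \<omega> in M. (Y \<omega>)\<^sup>2 = 0\<close> by (rule integral_eq_zero_AE)
    moreover have "AE \<omega> in M. cos (Y \<omega> + \<theta>) = cos \<theta>" using 1 by eventually_elim simp
    then have "expectation (\<lambda>\<omega>. cos (Y \<omega> + \<theta>)) = expectation (\<lambda>\<omega>. cos \<theta>)"
      by (intro integral_cong_AE) auto
    ultimately show ?thesis by (simp add: prob_space)
  next
    case (2 \<sigma>)
    define Z where "Z \<omega> = (Y \<omega> - 0) / \<sigma>" for \<omega>
    have Z: "distributed M lborel Z std_normal_density"
      unfolding Z_def using 2(2) normal_standard_normal_convert[OF 2(1), of Y 0] by simp
    have [measurable]: "Z \<in> borel_measurable M" unfolding Z_def by simp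
    have Y: "Y \<omega> = \<sigma> * Z \<omega>" for \<omega> using 2(1) by (simp add: Z_def)
    have dZ: "distr M lborel Z = std_normal_distribution"
      using Z by (simp add: distributed_def)
    interpret S: real_distribution std_normal_distribution by (rule real_dist_normal_dist)
    have m2: "integrable std_normal_distribution (\<lambda>x. x\<^sup>2)"
      by (rule integrable_std_normal_distribution_moment)
    have "integrable M (\<lambda>\<omega>. (Z \<omega>)\<^sup>2)"
      using m2 unfolding dZ[symmetric] by (subst (asm) integrable_distr_eq) auto
    then have i2: "integrable M (\<lambda>\<omega>. (Y \<omega>)\<^sup>2)" by (simp add: Y power_mult_distrib)
    have "expectation (\<lambda>\<omega>. (Z \<omega>)\<^sup>2) = (\<integral>x. x\<^sup>2 \<partial>std_normal_distribution)"
      unfolding dZ[symmetric] by (subst integral_distr) auto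
    also have "\<dots> = 1" using std_normal_distribution_even_moments(1)[of 1] by simp
    finally have e2: "expectation (\<lambda>\<omega>. (Y \<omega>)\<^sup>2) = \<sigma>\<^sup>2" by (simp add: Y power_mult_distrib)
    have "expectation (\<lambda>\<omega>. cos (Y \<omega> + \<theta>)) = (\<integral>x. cos (\<sigma> * x + \<theta>) \<partial>std_normal_distribution)"
      unfolding dZ[symmetric] Y by (subst integral_distr) auto
    also have "\<dots> = (\<integral>x. Re (exp (\<i> * complex_of_real \<theta>) * iexp (\<sigma> * x)) \<partial>std_normal_distribution)"
      by (intro Bochner_Integration.integral_cong) (auto simp: Re_exp cos_add Im_exp)
    also have "\<dots> = Re (CLINT x|std_normal_distribution. exp (\<i> * complex_of_real \<theta>) * iexp (\<sigma> * x))"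
      by (intro integral_Re integrable_mult_right S.integrable_iexp) auto
    also have "(CLINT x|std_normal_distribution. exp (\<i> * complex_of_real \<theta>) * iexp (\<sigma> * x))
        = exp (\<i> * complex_of_real \<theta>) * char std_normal_distribution \<sigma>"
      unfolding char_def by simp
    also have "Re \<dots> = exp (- \<sigma>\<^sup>2 / 2) * cos \<theta>"
      by (simp add: char_std_normal_distribution Re_exp)
    finally show ?thesis using i2 e2 by simp
  qed
  then show "integrable M (\<lambda>\<omega>. (Y \<omega>)\<^sup>2)"
    "expectation (\<lambda>\<omega>. cos (Y \<omega> + \<theta>)) = exp (- expectation (\<lambda>\<omega>. (Y \<omega>)\<^sup>2) / 2) * cos \<theta>" by auto
qed

text \<open>\<open>gaussian_family\<close> speaks of sums over distinct indices, while different
  increments of \<open>W\<close> may share an end point and a direction. Coefficients belonging to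
  equal indices are therefore added up first.\<close>

lemma gaussian_family_sum:
  assumes X: "gaussian_family M I X" and J: "finite J" "idx ` J \<subseteq> I"
  shows "centered_normal M (\<lambda>\<omega>. \<Sum>j\<in>J. c j * X (idx j) \<omega>)"
proof -
  have "(\<lambda>\<omega>. \<Sum>j\<in>J. c j * X (idx j) \<omega>) = (\<lambda>\<omega>. \<Sum>i\<in>idx ` J. (\<Sum>j\<in>{j\<in>J. idx j = i}. c j) * X i \<omega>)"
  proof
    fix \<omega>
    have "(\<Sum>j\<in>J. c j * X (idx j) \<omega>) = (\<Sum>i\<in>idx ` J. \<Sum>j\<in>{j\<in>J. idx j = i}. c j * X (idx j) \<omega>)"
      by (rule sum.image_gen[OF J(1)])
    also have "\<dots> = (\<Sum>i\<in>idx ` J. (\<Sum>j\<in>{j\<in>J. idx j = i}. c j) * X i \<omega>)"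
      by (intro sum.cong refl) (auto simp: sum_distrib_right)
    finally show "(\<Sum>j\<in>J. c j * X (idx j) \<omega>) = \<dots>" .
  qed
  moreover have "centered_normal M (\<lambda>\<omega>. \<Sum>i\<in>idx ` J. (\<Sum>j\<in>{j\<in>J. idx j = i}. c j) * X i \<omega>)"
    by (intro X[unfolded gaussian_family_def, rule_format]) (use J in auto)
  ultimately show ?thesis by simp
qed

section \<open>Isometry, L2 limits and the cosine transform of the Wiener integral\<close>

text \<open>\<open>W \<tau> x\<close> is the integral of the indicator of (0, \<tau>] in direction
  \<open>x\<close>, and the covariance factor \<open>min\<close> of two times is the length of the
  overlap of their intervals.\<close>

lemma cylindrical_wiener_isometry:
  fixes W :: "real \<Rightarrow> 'h::real_inner \<Rightarrow> 'w \<Rightarrow> real"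
  assumes "prob_space M" and W: "cylindrical_wiener M W"
    and J: "finite J" "\<And>j. j \<in> J \<Longrightarrow> 0 \<le> \<tau> j"
  shows "(\<integral>\<omega>. (\<Sum>j\<in>J. c j * W (\<tau> j) (x j) \<omega>)\<^sup>2 \<partial>M)
      = (\<integral>s. (norm (\<Sum>j\<in>J. (c j * indicator {0<..\<tau> j} s) *\<^sub>R x j))\<^sup>2 \<partial>lborel)"
proof -
  interpret prob_space M by fact
  have G: "gaussian_family M ({0..} \<times> UNIV) (\<lambda>(t, x). W t x)"
    using W by (simp add: cylindrical_wiener_def)
  have normal: "centered_normal M (W t y)" if "t \<ge> 0" for t y
    using gaussian_family_sum[OF G, of "{()}" "\<lambda>_. (t, y)" "\<lambda>_. 1"] that by simp
  have [measurable]: "W t y \<in> borel_measurable M" if "t \<ge> 0" for t y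
    using normal[OF that] by (simp add: centered_normal_def)
  have int: "integrable M (\<lambda>\<omega>. W s y \<omega> * W t z \<omega>)" if "s \<ge> 0" "t \<ge> 0" for s t y z
  proof (rule Bochner_Integration.integrable_bound)
    show "integrable M (\<lambda>\<omega>. (W s y \<omega>)\<^sup>2 + (W t z \<omega>)\<^sup>2)"
      using that by (intro Bochner_Integration.integrable_add centered_normal_square_integrable normal)
    show "(\<lambda>\<omega>. W s y \<omega> * W t z \<omega>) \<in> borel_measurable M" using that by measurable
    have "\<bar>a * b\<bar> \<le> a\<^sup>2 + b\<^sup>2" for a b :: real
    proof -
      have "2 * (\<bar>a\<bar> * \<bar>b\<bar>) \<le> a\<^sup>2 + b\<^sup>2" using sum_squares_bound[of "\<bar>a\<bar>" "\<bar>b\<bar>"] by (simp add: mult.assoc)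
      moreover have "0 \<le> \<bar>a\<bar> * \<bar>b\<bar>" by simp
      ultimately show ?thesis unfolding abs_mult by linarith
    qed
    then show "AE \<omega> in M. norm (W s y \<omega> * W t z \<omega>) \<le> norm ((W s y \<omega>)\<^sup>2 + (W t z \<omega>)\<^sup>2)" by simp
  qed
  have "(\<integral>\<omega>. (\<Sum>j\<in>J. c j * W (\<tau> j) (x j) \<omega>)\<^sup>2 \<partial>M)
      = (\<integral>\<omega>. (\<Sum>j\<in>J. \<Sum>l\<in>J. (c j * c l) * (W (\<tau> j) (x j) \<omega> * W (\<tau> l) (x l) \<omega>)) \<partial>M)"
    unfolding power2_eq_square sum_product by (simp add: ac_simps)
  also have "\<dots> = (\<Sum>j\<in>J. \<Sum>l\<in>J. (c j * c l) * (\<integral>\<omega>. W (\<tau> j) (x j) \<omega> * W (\<tau> l) (x l) \<omega> \<partial>M))"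
    using J(2) by (subst Bochner_Integration.integral_sum; (intro Bochner_Integration.integrable_sum sum.cong refl)?; (subst Bochner_Integration.integral_sum)?)
      (auto intro!: int integrable_mult_right)
  also have "\<dots> = (\<Sum>j\<in>J. \<Sum>l\<in>J. (c j * c l) * (min (\<tau> j) (\<tau> l) * inner (x j) (x l)))"
    using W J(2) unfolding cylindrical_wiener_def by (intro sum.cong refl) simp
  also have "\<dots> = (\<Sum>j\<in>J. \<Sum>l\<in>J. (c j * c l * inner (x j) (x l)) * (\<integral>s. indicator {0<..min (\<tau> j) (\<tau> l)} s \<partial>lborel))"
    using J(2) by (intro sum.cong refl) simp
  also have "\<dots> = (\<integral>s. (\<Sum>j\<in>J. \<Sum>l\<in>J. (c j * c l * inner (x j) (x l)) * indicator {0<..min (\<tau> j) (\<tau> l)} s) \<partial>lborel)"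
  proof -
    have i: "integrable lborel (indicator {0<..b} :: real \<Rightarrow> real)" for b :: real
      by (cases "0 \<le> b") (auto intro!: integrable_real_indicator)
    then show ?thesis
      by (subst Bochner_Integration.integral_sum; (intro Bochner_Integration.integrable_sum sum.cong refl)?; (subst Bochner_Integration.integral_sum)?)
         (auto intro!: integrable_mult_right)
  qed
  also have "\<dots> = (\<integral>s. (norm (\<Sum>j\<in>J. (c j * indicator {0<..\<tau> j} s) *\<^sub>R x j))\<^sup>2 \<partial>lborel)"
  proof (rule Bochner_Integration.integral_cong[OF refl])
    fix s :: real
    have "(norm (\<Sum>j\<in>J. (c j * indicator {0<..\<tau> j} s) *\<^sub>R x j))\<^sup>2
      = (\<Sum>j\<in>J. \<Sum>l\<in>J. inner ((c j * indicator {0<..\<tau> j} s) *\<^sub>R x j) ((c l * indicator {0<..\<tau> l} s) *\<^sub>R x l))"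
      by (simp only: power2_norm_eq_inner inner_sum_left) (simp only: inner_sum_right)
    also have "\<dots> = (\<Sum>j\<in>J. \<Sum>l\<in>J. (c j * c l * inner (x j) (x l)) * indicator {0<..min (\<tau> j) (\<tau> l)} s)"
      by (intro sum.cong refl) (auto simp: indicator_def)
    finally show "(\<Sum>j\<in>J. \<Sum>l\<in>J. (c j * c l * inner (x j) (x l)) * indicator {0<..min (\<tau> j) (\<tau> l)} s)
      = (norm (\<Sum>j\<in>J. (c j * indicator {0<..\<tau> j} s) *\<^sub>R x j))\<^sup>2" ..
  qed
  finally show ?thesis .
qed

text \<open>Squared norms differ by at most (1 + 1 / \<delta>) |a - b|^2 + \<delta> |b|^2, from the
  arithmetic-geometric mean inequality. The first term vanishes in the limit for fixed \<delta>, the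
  second is small with \<delta>.\<close>

lemma integral_norm_sq_tendsto:
  fixes f :: "nat \<Rightarrow> 'a \<Rightarrow> 'b::{real_normed_vector, second_countable_topology}"
  assumes [measurable]: "\<And>n. f n \<in> borel_measurable P" "g \<in> borel_measurable P"
    and f2: "\<And>n. integrable P (\<lambda>x. (norm (f n x))\<^sup>2)" and g2: "integrable P (\<lambda>x. (norm (g x))\<^sup>2)"
    and lim: "(\<lambda>n. \<integral>\<^sup>+x. ennreal ((norm (f n x - g x))\<^sup>2) \<partial>P) \<longlonglongrightarrow> 0"
  shows "(\<lambda>n. \<integral>x. (norm (f n x))\<^sup>2 \<partial>P) \<longlonglongrightarrow> (\<integral>x. (norm (g x))\<^sup>2 \<partial>P)"
proof -
  have d2: "integrable P (\<lambda>x. (norm (f n x - g x))\<^sup>2)" for n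
  proof (rule Bochner_Integration.integrable_bound)
    show "integrable P (\<lambda>x. 2 * (norm (f n x))\<^sup>2 + 2 * (norm (g x))\<^sup>2)" using f2 g2 by simp
    have "(norm (a - b))\<^sup>2 \<le> 2 * (norm a)\<^sup>2 + 2 * (norm b)\<^sup>2" for a b :: 'b
    proof -
      have "(norm (a - b))\<^sup>2 \<le> (norm a + norm b)\<^sup>2" by (intro power_mono norm_triangle_ineq4) auto
      also have "\<dots> \<le> 2 * (norm a)\<^sup>2 + 2 * (norm b)\<^sup>2"
        using sum_squares_bound[of "norm a" "norm b"] by (simp add: power2_sum)
      finally show ?thesis .
    qed
    then show "AE x in P. norm ((norm (f n x - g x))\<^sup>2) \<le> norm (2 * (norm (f n x))\<^sup>2 + 2 * (norm (g x))\<^sup>2)" by simp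
  qed measurable
  define D where "D n = (\<integral>x. (norm (f n x - g x))\<^sup>2 \<partial>P)" for n
  have "(\<integral>\<^sup>+x. ennreal ((norm (f n x - g x))\<^sup>2) \<partial>P) = ennreal (D n)" for n
    unfolding D_def by (intro nn_integral_eq_integral d2) auto
  with lim have "(\<lambda>n. ennreal (D n)) \<longlonglongrightarrow> 0" by simp
  moreover have "D n \<ge> 0" for n by (simp add: D_def)
  ultimately have D0: "D \<longlonglongrightarrow> 0" by (simp add: ennreal_tendsto_0_iff)
  define I where "I = (\<integral>x. (norm (g x))\<^sup>2 \<partial>P)"
  have bound: "\<bar>(\<integral>x. (norm (f n x))\<^sup>2 \<partial>P) - I\<bar> \<le> (1 + 1 / \<delta>) * D n + \<delta> * I" if "\<delta> > 0" for \<delta> n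
  proof -
    have pt: "\<bar>(norm a)\<^sup>2 - (norm b)\<^sup>2\<bar> \<le> (1 + 1 / \<delta>) * (norm (a - b))\<^sup>2 + \<delta> * (norm b)\<^sup>2" for a b :: 'b
    proof -
      define d where "d = norm (a - b)"
      have d: "\<bar>norm a - norm b\<bar> \<le> d" unfolding d_def by (rule norm_triangle_ineq3)
      have "\<bar>(norm a)\<^sup>2 - (norm b)\<^sup>2\<bar> = \<bar>norm a - norm b\<bar> * (norm a + norm b)"
        by (simp add: power2_eq_square square_diff_square_factored abs_mult mult.commute)
      also have "\<dots> \<le> d * (d + 2 * norm b)"
        using d by (intro mult_mono) auto
      also have "\<dots> = d\<^sup>2 + 2 * (d / sqrt \<delta>) * (sqrt \<delta> * norm b)"
        using that by (simp add: power2_eq_square algebra_simps)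
      also have "\<dots> \<le> d\<^sup>2 + ((d / sqrt \<delta>)\<^sup>2 + (sqrt \<delta> * norm b)\<^sup>2)"
        by (intro add_left_mono sum_squares_bound)
      also have "\<dots> = (1 + 1 / \<delta>) * d\<^sup>2 + \<delta> * (norm b)\<^sup>2"
        using that by (simp add: power_mult_distrib power_divide algebra_simps)
      finally show ?thesis by (simp add: d_def)
    qed
    have "\<bar>(\<integral>x. (norm (f n x))\<^sup>2 \<partial>P) - I\<bar> = \<bar>\<integral>x. (norm (f n x))\<^sup>2 - (norm (g x))\<^sup>2 \<partial>P\<bar>"
      unfolding I_def using f2 g2 by simp
    also have "\<dots> \<le> (\<integral>x. \<bar>(norm (f n x))\<^sup>2 - (norm (g x))\<^sup>2\<bar> \<partial>P)" by (rule integral_abs_bound)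
    also have "\<dots> \<le> (\<integral>x. (1 + 1 / \<delta>) * (norm (f n x - g x))\<^sup>2 + \<delta> * (norm (g x))\<^sup>2 \<partial>P)"
      using f2 g2 d2 pt by (intro integral_mono) auto
    also have "\<dots> = (1 + 1 / \<delta>) * D n + \<delta> * I"
      unfolding D_def I_def using g2 d2 by simp
    finally show ?thesis .
  qed
  have I0: "I \<ge> 0" by (simp add: I_def)
  show ?thesis
    unfolding I_def[symmetric]
  proof (rule LIMSEQ_I)
    fix e :: real assume e: "e > 0"
    \<comment> \<open>Chosen to make \<delta> times \<open>I\<close> less than e / 2; the
      \<open>+ 1\<close> covers the case I = 0.\<close>
    define \<delta> where "\<delta> = e / (2 * (I + 1))"
    have \<delta>: "\<delta> > 0" "\<delta> * I < e / 2" 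
      using e I0 by (auto simp: \<delta>_def field_simps)
    have "(\<lambda>n. (1 + 1 / \<delta>) * D n) \<longlonglongrightarrow> (1 + 1 / \<delta>) * 0" by (intro tendsto_intros D0)
    then have "\<forall>\<^sub>F n in sequentially. (1 + 1 / \<delta>) * D n < e / 2"
      using e by (intro order_tendstoD(2)[where y = "(1 + 1 / \<delta>) * 0"]) auto
    then obtain n0 where n0: "\<And>n. n \<ge> n0 \<Longrightarrow> (1 + 1 / \<delta>) * D n < e / 2"
      by (auto simp: eventually_sequentially)
    have "norm ((\<integral>x. (norm (f n x))\<^sup>2 \<partial>P) - I) < e" if "n \<ge> n0" for n
      unfolding real_norm_def using bound[OF \<delta>(1), of n] \<delta>(2) n0[OF that] by linarith
    then show "\<exists>no. \<forall>n\<ge>no. norm ((\<integral>x. (norm (f n x))\<^sup>2 \<partial>P) - I) < e" by blast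
  qed
qed

text \<open>The cosine is 1-Lipschitz, and d <= \<delta> + d^2 / \<delta> replaces the distance by
  its square, which is what \<open>L2_tendsto\<close> controls. The estimate is kept in
  \<open>ennreal\<close> because the squared distances may have infinite integral for some
  \<open>n\<close>.\<close>

lemma (in prob_space) L2_tendsto_cos_inner:
  fixes Z :: "nat \<Rightarrow> 'a \<Rightarrow> 'h::{real_inner, second_countable_topology}"
  assumes lim: "L2_tendsto M Z Y" and [measurable]: "\<And>n. Z n \<in> borel_measurable M" "Y \<in> borel_measurable M"
  shows "(\<lambda>n. expectation (\<lambda>\<omega>. cos (inner (Z n \<omega>) v + \<theta>))) \<longlonglongrightarrow> expectation (\<lambda>\<omega>. cos (inner (Y \<omega>) v + \<theta>))"
proof -
  define D where "D n = (\<integral>\<^sup>+\<omega>. ennreal ((norm (Z n \<omega> - Y \<omega>))\<^sup>2) \<partial>M)" for n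
  have D0: "D \<longlonglongrightarrow> 0" using lim by (simp add: L2_tendsto_def D_def[abs_def])
  have int: "integrable M (\<lambda>\<omega>. cos (inner (V \<omega>) v + \<theta>))" if [measurable]: "V \<in> borel_measurable M" for V
    by (rule integrable_const_bound[where B = 1]) auto
  have bound: "ennreal \<bar>expectation (\<lambda>\<omega>. cos (inner (Z n \<omega>) v + \<theta>)) - expectation (\<lambda>\<omega>. cos (inner (Y \<omega>) v + \<theta>))\<bar>
      \<le> ennreal \<delta> + ennreal ((norm v)\<^sup>2 / \<delta>) * D n" if \<delta>: "\<delta> > 0" for \<delta> n
  proof -
    have pt: "\<bar>cos (inner a v + \<theta>) - cos (inner b v + \<theta>)\<bar> \<le> \<delta> + (norm v)\<^sup>2 / \<delta> * (norm (a - b))\<^sup>2" for a b :: 'h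
    proof -
      define d where "d = norm (a - b) * norm v"
      have d0: "d \<ge> 0" by (simp add: d_def)
      have "\<bar>cos (inner a v + \<theta>) - cos (inner b v + \<theta>)\<bar>
          = 2 * (\<bar>sin ((inner a v + \<theta> + (inner b v + \<theta>)) / 2)\<bar> * \<bar>sin (((inner b v + \<theta>) - (inner a v + \<theta>)) / 2)\<bar>)"
        unfolding cos_diff_cos by (simp add: abs_mult)
      also have "\<dots> \<le> 2 * (1 * \<bar>((inner b v + \<theta>) - (inner a v + \<theta>)) / 2\<bar>)"
        by (intro mult_left_mono mult_mono abs_sin_x_le_abs_x abs_sin_le_one) auto
      also have "\<dots> = \<bar>inner (a - b) v\<bar>" by (simp add: inner_diff_left)
      also have "\<dots> \<le> d" unfolding d_def by (rule Cauchy_Schwarz_ineq2)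
      also have "d \<le> \<delta> + d\<^sup>2 / \<delta>"
      proof (cases "d \<le> \<delta>")
        case True
        then show ?thesis using \<delta> by (simp add: add_increasing2)
      next
        case False
        then have "d * \<delta> \<le> d * d" using d0 by (intro mult_left_mono) auto
        moreover have "0 \<le> \<delta> * \<delta>" by simp
        ultimately have "d * \<delta> \<le> \<delta> * \<delta> + d * d" by linarith
        then show ?thesis using \<delta> by (simp add: field_simps power2_eq_square)
      qed
      finally show ?thesis by (simp add: d_def power_mult_distrib mult.commute)
    qed
    have "ennreal \<bar>expectation (\<lambda>\<omega>. cos (inner (Z n \<omega>) v + \<theta>)) - expectation (\<lambda>\<omega>. cos (inner (Y \<omega>) v + \<theta>))\<bar>
        = ennreal (norm (expectation (\<lambda>\<omega>. cos (inner (Z n \<omega>) v + \<theta>) - cos (inner (Y \<omega>) v + \<theta>))))"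
      by (simp add: int)
    also have "\<dots> \<le> (\<integral>\<^sup>+\<omega>. norm (cos (inner (Z n \<omega>) v + \<theta>) - cos (inner (Y \<omega>) v + \<theta>)) \<partial>M)"
      by (intro integral_norm_bound_ennreal) (simp add: int)
    also have "\<dots> \<le> (\<integral>\<^sup>+\<omega>. ennreal \<delta> + ennreal ((norm v)\<^sup>2 / \<delta>) * ennreal ((norm (Z n \<omega> - Y \<omega>))\<^sup>2) \<partial>M)"
      using \<delta> pt by (intro nn_integral_mono) (simp flip: ennreal_mult ennreal_plus)
    also have "\<dots> = ennreal \<delta> + ennreal ((norm v)\<^sup>2 / \<delta>) * D n"
      unfolding D_def by (subst nn_integral_add) (auto simp: nn_integral_cmult emeasure_space_1)
    finally show ?thesis .
  qed
  show ?thesis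
  proof (rule LIMSEQ_I)
    fix e :: real assume e: "e > 0"
    define K where "K = ennreal ((norm v)\<^sup>2 / (e / 2))"
    have "(\<lambda>n. K * D n) \<longlonglongrightarrow> K * 0"
      by (rule ennreal_tendsto_cmult[OF _ D0]) (simp add: K_def)
    then have "\<forall>\<^sub>F n in sequentially. K * D n < ennreal (e / 2)"
      using e by (intro order_tendstoD(2)[where y = "K * 0"]) auto
    then obtain n0 where n0: "\<And>n. n \<ge> n0 \<Longrightarrow> K * D n < ennreal (e / 2)"
      by (auto simp: eventually_sequentially)
    have "norm (expectation (\<lambda>\<omega>. cos (inner (Z n \<omega>) v + \<theta>)) - expectation (\<lambda>\<omega>. cos (inner (Y \<omega>) v + \<theta>))) < e"
      if n: "n \<ge> n0" for n
    proof -
      have "ennreal \<bar>expectation (\<lambda>\<omega>. cos (inner (Z n \<omega>) v + \<theta>)) - expectation (\<lambda>\<omega>. cos (inner (Y \<omega>) v + \<theta>))\<bar>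
        \<le> ennreal (e / 2) + K * D n"
        using bound[of "e / 2" n] e by (simp add: K_def)
      also have "\<dots> < ennreal (e / 2) + ennreal (e / 2)"
        using n0[OF n] by (intro ennreal_add_left_cancel_less[THEN iffD2]) auto
      also have "\<dots> = ennreal e" using e by (simp flip: ennreal_plus)
      finally show ?thesis using e by (simp add: ennreal_less_iff)
    qed
    then show "\<exists>no. \<forall>n\<ge>no. norm (expectation (\<lambda>\<omega>. cos (inner (Z n \<omega>) v + \<theta>)) - expectation (\<lambda>\<omega>. cos (inner (Y \<omega>) v + \<theta>))) < e"
      by blast
  qed
qed

text \<open>Here \<open>g\<close> is the adjoint of \<open>T\<close> applied to \<open>v\<close>.
  Testing \<open>T\<close> on the unit vector in direction \<open>g\<close>, a one-element
  orthonormal set, bounds \<open>norm g\<close> through the Hilbert-Schmidt norm.\<close>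

lemma norm_sq_le_hs_sq:
  assumes "\<And>h. inner (T h) v = inner h g"
  shows "ennreal ((norm g)\<^sup>2) \<le> ennreal ((norm v)\<^sup>2) * hs_sq T"
proof (cases "g = 0")
  case False
  define h where "h = g /\<^sub>R norm g"
  have h: "norm h = 1" "inner h g = norm g"
    using False by (auto simp: h_def power2_norm_eq_inner[symmetric] power2_eq_square)
  have "norm g = inner (T h) v" by (simp add: assms h)
  also have "\<dots> \<le> norm (T h) * norm v" by (rule norm_cauchy_schwarz)
  finally have "(norm g)\<^sup>2 \<le> (norm (T h) * norm v)\<^sup>2" by (intro power_mono) auto
  then have "ennreal ((norm g)\<^sup>2) \<le> ennreal ((norm v)\<^sup>2) * ennreal ((norm (T h))\<^sup>2)"
    by (simp add: power_mult_distrib mult.commute flip: ennreal_mult)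
  also have "ennreal ((norm (T h))\<^sup>2) \<le> hs_sq T"
  proof -
    have "(\<Sum>b\<in>{h}. ennreal ((norm (T b))\<^sup>2)) \<le> hs_sq T"
      unfolding hs_sq_def by (rule SUP_upper) (auto simp: orthonormal_def h)
    then show ?thesis by simp
  qed
  finally show ?thesis by (simp add: mult_left_mono)
qed simp

text \<open>The vector \<open>w s\<close> below is \<open>\<Phi>(s)\<^sup>* v\<close>.\<close>

lemma wiener_integral_cos:
  fixes W :: "real \<Rightarrow> 'h::{real_inner, second_countable_topology} \<Rightarrow> 'w \<Rightarrow> real"
  assumes "prob_space M" and W: "cylindrical_wiener M W" and Z: "wiener_integral M W T \<Phi> Z"
    and w: "continuous_on {0..T} w"
    and adj: "\<And>s h. s \<in> {0..T} \<Longrightarrow> inner (\<Phi> s h) v = inner h (w s)"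
  shows "(\<integral>\<omega>. cos (inner (Z \<omega>) v + \<theta>) \<partial>M)
    = exp (- (\<integral>s. indicator {0..T} s *\<^sub>R (norm (w s))\<^sup>2 \<partial>lborel) / 2) * cos \<theta>"
proof -
  interpret prob_space M by fact
  have G: "gaussian_family M ({0..} \<times> UNIV) (\<lambda>(t, x). W t x)"
    using W by (simp add: cylindrical_wiener_def)
  have Wm: "W t y \<in> borel_measurable M" if "t \<ge> 0" for t y
    using gaussian_family_sum[OF G, of "{()}" "\<lambda>_. (t, y)" "\<lambda>_. 1"] that
    by (simp add: centered_normal_def)
  from Z obtain N :: "nat \<Rightarrow> nat" and a b :: "nat \<Rightarrow> nat \<Rightarrow> real" and x y :: "nat \<Rightarrow> nat \<Rightarrow> 'h" where
    ab: "\<And>n j. j < N n \<Longrightarrow> 0 \<le> a n j \<and> a n j \<le> b n j \<and> b n j \<le> T"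
    and hs: "(\<lambda>n. \<integral>\<^sup>+s\<in>{0..T}. hs_sq (blinfun_apply
           ((\<Sum>j<N n. indicator {a n j<..b n j} s *\<^sub>R rank_one (y n j) (x n j)) - \<Phi> s)) \<partial>lborel) \<longlonglongrightarrow> 0"
    and lim: "L2_tendsto M (\<lambda>n \<omega>. \<Sum>j<N n. (W (b n j) (x n j) \<omega> - W (a n j) (x n j) \<omega>) *\<^sub>R y n j) Z"
    and [measurable]: "Z \<in> borel_measurable M"
    unfolding wiener_integral_def by blast
  have b0: "0 \<le> b n j" if "j < N n" for n j
    using ab[OF that] by linarith
  define Zn where "Zn n \<omega> = (\<Sum>j<N n. (W (b n j) (x n j) \<omega> - W (a n j) (x n j) \<omega>) *\<^sub>R y n j)" for n \<omega>
  \<comment> \<open>The adjoint of the n-th step operator applied to \<open>v\<close>, the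
    counterpart of \<open>w s\<close> for the approximation.\<close>
  define wn where "wn n s = (\<Sum>j<N n. (inner (y n j) v * indicator {a n j<..b n j} s) *\<^sub>R x n j)" for n and s :: real
  have Znm[measurable]: "Zn n \<in> borel_measurable M" for n
    unfolding Zn_def using ab b0
    by (intro borel_measurable_sum borel_measurable_scaleR borel_measurable_diff Wm borel_measurable_const) auto
  have wnm[measurable]: "wn n \<in> borel_measurable borel" for n
    unfolding wn_def by measurable
  \<comment> \<open>an increment over \<open>(a, b]\<close> is split into its two endpoints, indexed by \<open>bool\<close>\<close>
  define J where "J n = {..<N n} \<times> (UNIV :: bool set)" for n
  define \<tau> where "\<tau> n = (\<lambda>(j, e). if e then b n j else a n j)" for n
  define c where "c n = (\<lambda>(j, e). (if e then 1 else - 1) * inner (y n j) v)" for n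
  have \<tau>: "0 \<le> \<tau> n i" if "i \<in> J n" for n i
    using that ab b0 by (auto simp: J_def \<tau>_def)
  have sumJ: "(\<Sum>i\<in>J n. F i) = (\<Sum>j<N n. F (j, True) + F (j, False))" for n and F :: "nat \<times> bool \<Rightarrow> 'z::comm_monoid_add"
    using sum.cartesian_product[of "\<lambda>j e. F (j, e)" UNIV "{..<N n}"]
    by (simp add: J_def UNIV_bool add.commute)
  have Zn_J: "inner (Zn n \<omega>) v = (\<Sum>i\<in>J n. c n i * W (\<tau> n i) (x n (fst i)) \<omega>)" for n \<omega>
    unfolding sumJ Zn_def inner_sum_left c_def \<tau>_def by (intro sum.cong refl) (simp add: algebra_simps)
  have wn_J: "wn n s = (\<Sum>i\<in>J n. (c n i * indicator {0<..\<tau> n i} s) *\<^sub>R x n (fst i))" for n s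
    unfolding sumJ wn_def
  proof (intro sum.cong refl)
    fix j assume "j \<in> {..<N n}"
    then have "0 \<le> a n j" "a n j \<le> b n j" using ab by auto
    then have "(indicator {a n j<..b n j} s :: real) = indicator {0<..b n j} s - indicator {0<..a n j} s"
      by (auto simp: indicator_def)
    then show "(inner (y n j) v * indicator {a n j<..b n j} s) *\<^sub>R x n j =
      (c n (j, True) * indicator {0<..\<tau> n (j, True)} s) *\<^sub>R x n (fst (j, True)) +
      (c n (j, False) * indicator {0<..\<tau> n (j, False)} s) *\<^sub>R x n (fst (j, False))"
      by (simp add: c_def \<tau>_def right_diff_distrib scaleR_diff_left)
  qed
  \<comment> \<open>For a step integrand the pairing with \<open>v\<close> is a finite Gaussian sum,
    and the isometry gives its variance as the squared norm of \<open>wn n\<close>.\<close>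
  have cos_n: "expectation (\<lambda>\<omega>. cos (inner (Zn n \<omega>) v + \<theta>)) = exp (- (\<integral>s. (norm (wn n s))\<^sup>2 \<partial>lborel) / 2) * cos \<theta>" for n
  proof -
    have "centered_normal M (\<lambda>\<omega>. \<Sum>i\<in>J n. c n i * W (\<tau> n i) (x n (fst i)) \<omega>)"
      using gaussian_family_sum[OF G, of "J n" "\<lambda>i. (\<tau> n i, x n (fst i))" "c n"] \<tau>
      by (auto simp: J_def)
    then have "centered_normal M (\<lambda>\<omega>. inner (Zn n \<omega>) v)" unfolding Zn_J .
    then have "expectation (\<lambda>\<omega>. cos (inner (Zn n \<omega>) v + \<theta>)) = exp (- expectation (\<lambda>\<omega>. (inner (Zn n \<omega>) v)\<^sup>2) / 2) * cos \<theta>"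
      by (rule centered_normal_cos)
    also have "expectation (\<lambda>\<omega>. (inner (Zn n \<omega>) v)\<^sup>2) = (\<integral>s. (norm (wn n s))\<^sup>2 \<partial>lborel)"
      unfolding Zn_J wn_J
      by (rule cylindrical_wiener_isometry[OF \<open>prob_space M\<close> W]) (auto simp: J_def \<tau>)
    finally show ?thesis .
  qed
  \<comment> \<open>Extension of \<open>w\<close> by zero. The functions \<open>wn n\<close> vanish
    off [0, T] too, so the comparison can be made on the whole line.\<close>
  define wi where "wi s = (if s \<in> {0..T} then w s else 0)" for s
  have wim[measurable]: "wi \<in> borel_measurable borel"
    unfolding wi_def using w by (intro borel_measurable_continuous_on_if) auto
  have wn_out: "wn n s = 0" if "s \<notin> {0..T}" for n s
    unfolding wn_def
  proof (intro sum.neutral ballI)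
    fix j assume "j \<in> {..<N n}"
    then have "s \<notin> {a n j<..b n j}" using ab[of j n] that by auto
    then show "(inner (y n j) v * indicator {a n j<..b n j} s) *\<^sub>R x n j = 0" by simp
  qed
  \<comment> \<open>The variances converge because \<open>wn n s - w s\<close> is the adjoint of the
    approximation error applied to \<open>v\<close>, whose squared norm is at most that of
    \<open>v\<close> times the squared Hilbert-Schmidt norm assumed to tend to 0 in the
    mean.\<close>
  have "(\<lambda>n. \<integral>s. (norm (wn n s))\<^sup>2 \<partial>lborel) \<longlonglongrightarrow> (\<integral>s. (norm (wi s))\<^sup>2 \<partial>lborel)"
  proof (rule integral_norm_sq_tendsto)
    have bnd: "integrable lborel (\<lambda>s. (norm (g s))\<^sup>2)"
      if [measurable]: "g \<in> borel_measurable borel" and g: "\<And>s. s \<notin> {0..T} \<Longrightarrow> g s = 0" "\<And>s. s \<in> {0..T} \<Longrightarrow> norm (g s) \<le> C"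
      for g :: "real \<Rightarrow> 'h" and C
    proof (rule Bochner_Integration.integrable_bound)
      show "integrable lborel (\<lambda>s. indicator {0..T} s * C\<^sup>2)" by (intro integrable_mult_left integrable_real_indicator) (auto simp: emeasure_lborel_Icc_eq)
      show "AE s in lborel. norm ((norm (g s))\<^sup>2) \<le> norm (indicator {0..T} s * C\<^sup>2)"
        using g by (auto intro!: AE_I2 power_mono simp: indicator_def)
    qed simp
    obtain C where "\<And>s. s \<in> {0..T} \<Longrightarrow> norm (w s) \<le> C"
      using compact_imp_bounded[OF compact_continuous_image[OF w compact_Icc]]
      unfolding bounded_iff by blast
    then show "integrable lborel (\<lambda>s. (norm (wi s))\<^sup>2)"
      by (intro bnd[of wi C]) (auto simp: wi_def)
    show "integrable lborel (\<lambda>s. (norm (wn n s))\<^sup>2)" for n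
    proof (rule bnd[of "wn n" "\<Sum>j<N n. \<bar>inner (y n j) v\<bar> * norm (x n j)"])
      show "norm (wn n s) \<le> (\<Sum>j<N n. \<bar>inner (y n j) v\<bar> * norm (x n j))" for s
        unfolding wn_def by (intro sum_norm_le) (auto simp: abs_mult indicator_def intro!: mult_right_mono)
    qed (auto simp: wn_out)
    have "(\<lambda>n. ennreal ((norm v)\<^sup>2) * (\<integral>\<^sup>+s\<in>{0..T}. hs_sq (blinfun_apply
           ((\<Sum>j<N n. indicator {a n j<..b n j} s *\<^sub>R rank_one (y n j) (x n j)) - \<Phi> s)) \<partial>lborel))
         \<longlonglongrightarrow> ennreal ((norm v)\<^sup>2) * 0"
      by (rule ennreal_tendsto_cmult[OF _ hs]) simp
    then have hs': "(\<lambda>n. ennreal ((norm v)\<^sup>2) * (\<integral>\<^sup>+s\<in>{0..T}. hs_sq (blinfun_apply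
           ((\<Sum>j<N n. indicator {a n j<..b n j} s *\<^sub>R rank_one (y n j) (x n j)) - \<Phi> s)) \<partial>lborel))
         \<longlonglongrightarrow> 0" by simp
    show "(\<lambda>n. \<integral>\<^sup>+s. ennreal ((norm (wn n s - wi s))\<^sup>2) \<partial>lborel) \<longlonglongrightarrow> 0"
    proof (rule tendsto_sandwich[OF _ _ tendsto_const hs'])
      show "\<forall>\<^sub>F n in sequentially. (\<integral>\<^sup>+s. ennreal ((norm (wn n s - wi s))\<^sup>2) \<partial>lborel)
        \<le> ennreal ((norm v)\<^sup>2) * (\<integral>\<^sup>+s\<in>{0..T}. hs_sq (blinfun_apply
           ((\<Sum>j<N n. indicator {a n j<..b n j} s *\<^sub>R rank_one (y n j) (x n j)) - \<Phi> s)) \<partial>lborel)"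
      proof (intro always_eventually allI)
        fix n
        define R where "R s = (\<Sum>j<N n. indicator {a n j<..b n j} s *\<^sub>R rank_one (y n j) (x n j)) - \<Phi> s" for s
        have pt: "ennreal ((norm (wn n s - w s))\<^sup>2) \<le> ennreal ((norm v)\<^sup>2) * hs_sq (R s)" if s: "s \<in> {0..T}" for s
        proof (rule norm_sq_le_hs_sq)
          fix h
          have "inner (R s h) v = (\<Sum>j<N n. indicator {a n j<..b n j} s * (inner h (x n j) * inner (y n j) v)) - inner h (w s)"
            unfolding R_def
            by (simp add: blinfun.diff_left blinfun.sum_left blinfun.scaleR_left rank_one.rep_eq inner_diff_left
                inner_sum_left adj[OF s])
          also have "\<dots> = inner h (wn n s - w s)"
            by (simp add: wn_def inner_diff_right inner_sum_right ac_simps)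
          finally show "inner (R s h) v = inner h (wn n s - w s)" .
        qed
        have "(\<integral>\<^sup>+s. ennreal ((norm (wn n s - wi s))\<^sup>2) \<partial>lborel)
            = (\<integral>\<^sup>+s\<in>{0..T}. ennreal ((norm (wn n s - w s))\<^sup>2) \<partial>lborel)"
          by (intro nn_integral_cong) (auto simp: wi_def wn_out indicator_def)
        \<comment> \<open>\<open>hs_sq \<circ> R\<close> need not be measurable, so the constant is taken out of the other integral\<close>
        show "(\<integral>\<^sup>+s. ennreal ((norm (wn n s - wi s))\<^sup>2) \<partial>lborel) \<le> ennreal ((norm v)\<^sup>2) * (\<integral>\<^sup>+s\<in>{0..T}. hs_sq (R s) \<partial>lborel)"
        proof (cases "v = 0")
          case True
          have "(norm (wn n s - wi s))\<^sup>2 = 0" for s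
            using pt[of s] True by (cases "s \<in> {0..T}") (auto simp: wi_def wn_out)
          then show ?thesis by simp
        next
          case False
          then have v: "(norm v)\<^sup>2 > 0" by simp
          have "(\<integral>\<^sup>+s. ennreal ((norm (wn n s - wi s))\<^sup>2) \<partial>lborel)
              = (\<integral>\<^sup>+s. ennreal ((norm v)\<^sup>2) * ennreal ((norm (wn n s - wi s))\<^sup>2 / (norm v)\<^sup>2) \<partial>lborel)"
            using v by (intro nn_integral_cong) (simp flip: ennreal_mult)
          also have "\<dots> = ennreal ((norm v)\<^sup>2) * (\<integral>\<^sup>+s. ennreal ((norm (wn n s - wi s))\<^sup>2 / (norm v)\<^sup>2) \<partial>lborel)"
            by (rule nn_integral_cmult) simp
          also have "\<dots> \<le> ennreal ((norm v)\<^sup>2) * (\<integral>\<^sup>+s\<in>{0..T}. hs_sq (R s) \<partial>lborel)"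
          proof (intro mult_left_mono nn_integral_mono)
            fix s
            show "ennreal ((norm (wn n s - wi s))\<^sup>2 / (norm v)\<^sup>2) \<le> hs_sq (R s) * indicator {0..T} s"
            proof (cases "s \<in> {0..T}")
              case True
              have "ennreal ((norm (wn n s - w s))\<^sup>2 / (norm v)\<^sup>2) = ennreal ((norm (wn n s - w s))\<^sup>2) / ennreal ((norm v)\<^sup>2)"
                using v by (intro divide_ennreal[symmetric]) auto
              also have "\<dots> \<le> (ennreal ((norm v)\<^sup>2) * hs_sq (R s)) / ennreal ((norm v)\<^sup>2)"
                by (intro divide_right_mono_ennreal pt True)
              also have "\<dots> = hs_sq (R s)"
                using v by (subst mult.commute, intro ennreal_mult_divide_eq) auto
              finally show ?thesis using True by (simp add: wi_def)
            next
              case False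
              then show ?thesis by (auto simp: wi_def wn_out)
            qed
          qed simp
          finally show ?thesis .
        qed
      qed
    qed simp
  qed simp_all
  then have "(\<lambda>n. exp (- (\<integral>s. (norm (wn n s))\<^sup>2 \<partial>lborel) / 2) * cos \<theta>)
      \<longlonglongrightarrow> exp (- (\<integral>s. (norm (wi s))\<^sup>2 \<partial>lborel) / 2) * cos \<theta>"
    by (intro tendsto_intros) auto
  moreover have "(\<lambda>n. expectation (\<lambda>\<omega>. cos (inner (Zn n \<omega>) v + \<theta>))) \<longlonglongrightarrow> expectation (\<lambda>\<omega>. cos (inner (Z \<omega>) v + \<theta>))"
    using lim unfolding Zn_def[symmetric] by (intro L2_tendsto_cos_inner) auto
  ultimately have "expectation (\<lambda>\<omega>. cos (inner (Z \<omega>) v + \<theta>)) = exp (- (\<integral>s. (norm (wi s))\<^sup>2 \<partial>lborel) / 2) * cos \<theta>"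
    unfolding cos_n by (rule LIMSEQ_unique[rotated])
  also have "(\<integral>s. (norm (wi s))\<^sup>2 \<partial>lborel) = (\<integral>s. indicator {0..T} s *\<^sub>R (norm (w s))\<^sup>2 \<partial>lborel)"
    by (intro Bochner_Integration.integral_cong) (auto simp: wi_def indicator_def)
  finally show ?thesis .
qed

section \<open>Convergence of laws\<close>

text \<open>The cosine hypothesis fixes the joint law of the first n coordinates, hence the mean of
  \<open>h\<close> on the n-th partial sum of the sine expansion. These partial sums converge, and
  boundedness of \<open>h\<close> passes the equality to the limit.\<close>

lemma L2_expectation_eq:
  fixes h :: "L2 \<Rightarrow> real"
  assumes M: "prob_space M" and N: "prob_space N"
    and Z[measurable]: "Z \<in> borel_measurable M" and Y[measurable]: "Y \<in> borel_measurable N"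
    and char: "\<And>n c \<theta>. (\<integral>\<omega>. cos (inner (Z \<omega>) (\<Sum>i<n. c i *\<^sub>R sine (Suc i)) + \<theta>) \<partial>M)
        = (\<integral>\<omega>. cos (inner (Y \<omega>) (\<Sum>i<n. c i *\<^sub>R sine (Suc i)) + \<theta>) \<partial>N)"
    and h: "continuous_on UNIV h" "\<And>x. \<bar>h x\<bar> \<le> B"
  shows "(\<integral>\<omega>. h (Z \<omega>) \<partial>M) = (\<integral>\<omega>. h (Y \<omega>) \<partial>N)"
proof -
  interpret M: prob_space M by (rule M)
  interpret N: prob_space N by (rule N)
  define P where "P n F = (\<Sum>i<n. inner F (sine (Suc i)) *\<^sub>R sine (Suc i))" for n and F :: L2
  have [measurable]: "h \<in> borel_measurable borel" using h(1) by (rule borel_measurable_continuous_onI)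
  have [measurable]: "P n \<in> borel_measurable borel" for n unfolding P_def by measurable
  have hP: "isCont h F" for F using h(1) by (simp add: continuous_on_eq_continuous_at)
  have lim: "(\<lambda>n. h (P n F)) \<longlonglongrightarrow> h F" for F
    using sums_sine[of F] unfolding sums_def P_def[symmetric] by (rule isCont_tendsto_compose[OF hP])
  have eq: "(\<integral>\<omega>. h (P n (Z \<omega>)) \<partial>M) = (\<integral>\<omega>. h (P n (Y \<omega>)) \<partial>N)" for n
  proof -
    let ?\<xi> = "\<lambda>i \<omega>. inner (Z \<omega>) (sine (Suc i))" and ?\<eta> = "\<lambda>i \<omega>. inner (Y \<omega>) (sine (Suc i))"
    let ?Pi = "Pi\<^sub>M {..<n} (\<lambda>_. borel :: real measure)"
    let ?H = "\<lambda>x. h (\<Sum>i<n. x i *\<^sub>R sine (Suc i))"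
    have law: "distr M ?Pi (\<lambda>\<omega>. \<lambda>i\<in>{..<n}. ?\<xi> i \<omega>) = distr N ?Pi (\<lambda>\<omega>. \<lambda>i\<in>{..<n}. ?\<eta> i \<omega>)"
    proof (rule joint_law_eq[OF M N])
      fix c \<theta>
      have "(\<Sum>i<n. c i * inner F (sine (Suc i))) = inner F (\<Sum>i<n. c i *\<^sub>R sine (Suc i))" for F :: L2
        by (simp add: inner_sum_right)
      then show "(\<integral>\<omega>. cos ((\<Sum>i<n. c i * ?\<xi> i \<omega>) + \<theta>) \<partial>M) = (\<integral>\<omega>. cos ((\<Sum>i<n. c i * ?\<eta> i \<omega>) + \<theta>) \<partial>N)"
        using char[of c n \<theta>] by simp
    qed measurable
    have "(\<lambda>x. \<Sum>i<n. x i *\<^sub>R sine (Suc i)) \<in> borel_measurable ?Pi"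
      by (intro borel_measurable_sum borel_measurable_scaleR borel_measurable_const measurable_component_singleton) auto
    then have H: "?H \<in> borel_measurable ?Pi" by measurable
    have mM: "(\<lambda>\<omega>. \<lambda>i\<in>{..<n}. ?\<xi> i \<omega>) \<in> measurable M ?Pi" by (intro measurable_restrict) measurable
    have mN: "(\<lambda>\<omega>. \<lambda>i\<in>{..<n}. ?\<eta> i \<omega>) \<in> measurable N ?Pi" by (intro measurable_restrict) measurable
    have "(\<integral>\<omega>. h (P n (Z \<omega>)) \<partial>M) = (\<integral>x. ?H x \<partial>distr M ?Pi (\<lambda>\<omega>. \<lambda>i\<in>{..<n}. ?\<xi> i \<omega>))"
      by (subst integral_distr[OF mM H]) (simp add: P_def)
    also have "\<dots> = (\<integral>\<omega>. h (P n (Y \<omega>)) \<partial>N)"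
      unfolding law by (subst integral_distr[OF mN H]) (simp add: P_def)
    finally show ?thesis .
  qed
  have "(\<lambda>n. \<integral>\<omega>. h (P n (Z \<omega>)) \<partial>M) \<longlonglongrightarrow> (\<integral>\<omega>. h (Z \<omega>) \<partial>M)"
    by (rule integral_dominated_convergence[where w = "\<lambda>_. B"]) (use lim h(2) in auto)
  moreover have "(\<lambda>n. \<integral>\<omega>. h (P n (Y \<omega>)) \<partial>N) \<longlonglongrightarrow> (\<integral>\<omega>. h (Y \<omega>) \<partial>N)"
    by (rule integral_dominated_convergence[where w = "\<lambda>_. B"]) (use lim h(2) in auto)
  ultimately show ?thesis unfolding eq by (rule LIMSEQ_unique)
qed

section \<open>From bounded Lipschitz functions to the distance \<open>d2\<close> and to convergence
  in distribution\<close>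

text \<open>The truncation at \<open>C\<close> supplies the constant majorant for dominated
  convergence.\<close>

lemma (in prob_space) expectation_min_tendsto_0:
  fixes V :: "'a \<Rightarrow> 'h::real_normed_vector"
  assumes [measurable]: "V \<in> borel_measurable M" and a: "a \<longlonglongrightarrow> 0" "\<And>t. 0 \<le> a t" and C: "0 \<le> C"
  shows "(\<lambda>t. expectation (\<lambda>\<omega>. min C (a t * norm (V \<omega>)))) \<longlonglongrightarrow> 0"
proof -
  have "(\<lambda>t. expectation (\<lambda>\<omega>. min C (a t * norm (V \<omega>)))) \<longlonglongrightarrow> expectation (\<lambda>\<omega>. 0)"
  proof (rule integral_dominated_convergence[where w = "\<lambda>_. C"])
    have "(\<lambda>t. min C (a t * norm (V \<omega>))) \<longlonglongrightarrow> min C (0 * norm (V \<omega>))" for \<omega>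
      by (intro tendsto_intros a)
    then show "AE \<omega> in M. (\<lambda>t. min C (a t * norm (V \<omega>))) \<longlonglongrightarrow> 0" using C by simp
  qed (use a C in auto)
  then show ?thesis by simp
qed

lemma (in prob_space) expectation_diff_le_min:
  fixes h :: "'h::{real_normed_vector, second_countable_topology} \<Rightarrow> real"
  assumes h: "\<And>x. \<bar>h x\<bar> \<le> B" "\<And>x y. \<bar>h x - h y\<bar> \<le> K * norm (x - y)" "0 \<le> K"
    and [measurable]: "U \<in> borel_measurable M" "V \<in> borel_measurable M" "D \<in> borel_measurable M"
    and D: "AE \<omega> in M. norm (U \<omega> - V \<omega>) \<le> D \<omega>"
  shows "\<bar>expectation (\<lambda>\<omega>. h (U \<omega>)) - expectation (\<lambda>\<omega>. h (V \<omega>))\<bar> \<le> expectation (\<lambda>\<omega>. min (2 * B) (K * D \<omega>))"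
proof -
  have "continuous_on UNIV h"
  proof (rule lipschitz_on_continuous_on)
    show "K-lipschitz_on UNIV h" using h by (intro lipschitz_onI) (auto simp: dist_norm)
  qed
  then have [measurable]: "h \<in> borel_measurable borel" by (rule borel_measurable_continuous_onI)
  have B: "0 \<le> B" using h(1)[of 0] by linarith
  have int: "integrable M (\<lambda>\<omega>. h (A \<omega>))" if [measurable]: "A \<in> borel_measurable M" for A
    using h(1) by (intro integrable_const_bound[where B = B]) auto
  have "\<bar>expectation (\<lambda>\<omega>. h (U \<omega>)) - expectation (\<lambda>\<omega>. h (V \<omega>))\<bar> = \<bar>expectation (\<lambda>\<omega>. h (U \<omega>) - h (V \<omega>))\<bar>"
    by (simp add: int)
  also have "\<dots> \<le> expectation (\<lambda>\<omega>. \<bar>h (U \<omega>) - h (V \<omega>)\<bar>)" by (rule integral_abs_bound)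
  also have "\<dots> \<le> expectation (\<lambda>\<omega>. min (2 * B) (K * D \<omega>))"
  proof (rule integral_mono_AE)
    show "integrable M (\<lambda>\<omega>. \<bar>h (U \<omega>) - h (V \<omega>)\<bar>)" by (intro integrable_abs Bochner_Integration.integrable_diff int) auto
    show "integrable M (\<lambda>\<omega>. min (2 * B) (K * D \<omega>))"
    proof (rule integrable_const_bound[where B = "2 * B"])
      show "AE \<omega> in M. norm (min (2 * B) (K * D \<omega>)) \<le> 2 * B"
        using D
      proof eventually_elim
        case (elim \<omega>)
        then have "0 \<le> K * D \<omega>" using h(3) order_trans[OF norm_ge_zero elim] by simp
        then show ?case using B by (simp add: min_def)
      qed
    qed measurable
    show "AE \<omega> in M. \<bar>h (U \<omega>) - h (V \<omega>)\<bar> \<le> min (2 * B) (K * D \<omega>)"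
      using D
    proof eventually_elim
      case (elim \<omega>)
      have "\<bar>h (U \<omega>) - h (V \<omega>)\<bar> \<le> K * norm (U \<omega> - V \<omega>)" by (rule h(2))
      also have "\<dots> \<le> K * D \<omega>" using elim h(3) by (rule mult_left_mono)
      finally show ?case using h(1)[of "U \<omega>"] h(1)[of "V \<omega>"] by simp
    qed
  qed
  finally show ?thesis .
qed

text \<open>\<open>G m\<close> is the infimal convolution of \<open>g\<close> with m times the
  distance. Raising m raises the price of moving away from \<open>x\<close>, which forces the
  infimum towards \<open>g x\<close> by continuity.\<close>

lemma lipschitz_approximation_below:
  fixes g :: "'a::metric_space \<Rightarrow> real"
  assumes g: "continuous_on UNIV g" "\<And>x. \<bar>g x\<bar> \<le> B"
  obtains G :: "nat \<Rightarrow> 'a \<Rightarrow> real" where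
    "\<And>m x. \<bar>G m x\<bar> \<le> B" "\<And>m x. G m x \<le> g x" "\<And>m x y. \<bar>G m x - G m y\<bar> \<le> real m * dist x y"
    "\<And>x. (\<lambda>m. G m x) \<longlonglongrightarrow> g x"
proof -
  define G where "G m x = (INF y. g y + real m * dist x y)" for m x
  have lower: "- B \<le> g y + real m * dist x y" for m x y
    using g(2)[of y] by (smt (verit) mult_nonneg_nonneg of_nat_0_le_iff zero_le_dist)
  have bdd: "bdd_below (range (\<lambda>y. g y + real m * dist x y))" for m x
    using lower by (intro bdd_belowI[of _ "- B"]) auto
  have le: "G m x \<le> g y + real m * dist x y" for m x y
    unfolding G_def by (rule cINF_lower[OF bdd]) simp
  have Gg: "G m x \<le> g x" for m x using le[of m x x] by simp
  have GB: "- B \<le> G m x" for m x unfolding G_def by (rule cINF_greatest) (use lower in auto)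
  have lip: "G m x \<le> G m y + real m * dist x y" for m x y
  proof -
    have "G m x - real m * dist x y \<le> G m y"
      unfolding G_def[of m y]
    proof (rule cINF_greatest)
      fix z
      have "real m * dist x z \<le> real m * (dist x y + dist y z)"
        by (intro mult_left_mono dist_triangle) auto
      then show "G m x - real m * dist x y \<le> g z + real m * dist y z"
        using le[of m x z] by (simp add: distrib_left)
    qed simp
    then show ?thesis by simp
  qed
  have lim: "(\<lambda>m. G m x) \<longlonglongrightarrow> g x" for x
  proof (rule LIMSEQ_I)
    fix e :: real assume e: "e > 0"
    obtain d where d: "d > 0" "\<And>y. dist y x < d \<Longrightarrow> dist (g y) (g x) < e / 2"
      using g(1) e unfolding continuous_on_iff by (metis UNIV_I half_gt_zero)
    \<comment> \<open>Points at distance at least \<open>d\<close> then pay more than 2 B, the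
      largest possible drop of \<open>g\<close>, so only points near \<open>x\<close> can compete in
      the infimum.\<close>
    obtain m0 :: nat where m0: "2 * B / d < real m0" using reals_Archimedean2 by blast
    have "norm (G m x - g x) < e" if m: "m \<ge> m0" for m
    proof -
      have "g x - e / 2 \<le> G m x"
        unfolding G_def
      proof (rule cINF_greatest)
        fix y
        show "g x - e / 2 \<le> g y + real m * dist x y"
        proof (cases "dist y x < d")
          case True
          then have "g x - e / 2 \<le> g y" using d(2)[of y] unfolding dist_real_def by linarith
          then show ?thesis by (simp add: add_increasing2)
        next
          case False
          have "2 * B < real m0 * d" using m0 d(1) by (simp add: field_simps)
          also have "\<dots> \<le> real m * dist x y"
            using m False d(1) by (intro mult_mono) (auto simp: dist_commute)
          finally show ?thesis using g(2)[of x] g(2)[of y] e by linarith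
        qed
      qed simp
      then show ?thesis using Gg[of m x] e by simp
    qed
    then show "\<exists>no. \<forall>m\<ge>no. norm (G m x - g x) < e" by blast
  qed
  show ?thesis
  proof (rule that[of G])
    show "\<bar>G m x\<bar> \<le> B" for m x using GB[of m x] Gg[of m x] g(2)[of x] by linarith
    show "\<bar>G m x - G m y\<bar> \<le> real m * dist x y" for m x y
      using lip[of m x y] lip[of m y x] by (simp add: dist_commute abs_le_iff)
  qed (fact Gg lim)+
qed

text \<open>Approximation from below gives a lower bound on the limiting means of
  \<open>g (u t \<omega>)\<close>, because each \<open>G m\<close> lies under \<open>g\<close>. The
  same bound for \<open>- g\<close> is the upper half.\<close>

lemma tendsto_in_distributionI_lipschitz:
  fixes u :: "nat \<Rightarrow> 'w \<Rightarrow> 'h::real_normed_vector"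
  assumes M: "prob_space M" and N: "prob_space N"
    and u[measurable]: "\<And>t. u t \<in> borel_measurable M" and Y[measurable]: "Y \<in> borel_measurable N"
    and lip: "\<And>h B K. (\<And>x. \<bar>h x\<bar> \<le> B) \<Longrightarrow> (\<And>x y. \<bar>h x - h y\<bar> \<le> K * norm (x - y)) \<Longrightarrow> 0 \<le> K \<Longrightarrow>
      (\<lambda>t. \<integral>\<omega>. h (u t \<omega>) \<partial>M) \<longlonglongrightarrow> (\<integral>\<omega>. h (Y \<omega>) \<partial>N)"
  shows "tendsto_in_distribution M u N Y"
proof -
  interpret M: prob_space M by (rule M)
  interpret N: prob_space N by (rule N)
  have lower: "\<forall>\<^sub>F t in sequentially. (\<integral>\<omega>. g (Y \<omega>) \<partial>N) - e < (\<integral>\<omega>. g (u t \<omega>) \<partial>M)"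
    if g: "continuous_on UNIV g" "\<And>x. \<bar>g x\<bar> \<le> B" and e: "e > 0" for g :: "'h \<Rightarrow> real" and B e
  proof -
    have [measurable]: "g \<in> borel_measurable borel" using g(1) by (rule borel_measurable_continuous_onI)
    obtain G where G: "\<And>m x. \<bar>G m x\<bar> \<le> B" "\<And>m x. G m x \<le> g x"
        "\<And>m x y. \<bar>G m x - G m y\<bar> \<le> real m * dist x y" "\<And>x. (\<lambda>m. G m x) \<longlonglongrightarrow> g x"
      using lipschitz_approximation_below[OF g] by blast
    have [measurable]: "G m \<in> borel_measurable borel" for m
    proof (rule borel_measurable_continuous_onI, rule lipschitz_on_continuous_on)
      show "(real m)-lipschitz_on UNIV (G m)" using G(3) by (intro lipschitz_onI) (auto simp: dist_real_def)
    qed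
    have "(\<lambda>m. \<integral>\<omega>. G m (Y \<omega>) \<partial>N) \<longlonglongrightarrow> (\<integral>\<omega>. g (Y \<omega>) \<partial>N)"
      by (rule integral_dominated_convergence[where w = "\<lambda>_. B"]) (use G in auto)
    then have "\<forall>\<^sub>F m in sequentially. (\<integral>\<omega>. g (Y \<omega>) \<partial>N) - e < (\<integral>\<omega>. G m (Y \<omega>) \<partial>N)"
      using e by (intro order_tendstoD(1)) auto
    then obtain m where m: "(\<integral>\<omega>. g (Y \<omega>) \<partial>N) - e < (\<integral>\<omega>. G m (Y \<omega>) \<partial>N)"
      by (auto simp: eventually_sequentially)
    have "(\<lambda>t. \<integral>\<omega>. G m (u t \<omega>) \<partial>M) \<longlonglongrightarrow> (\<integral>\<omega>. G m (Y \<omega>) \<partial>N)"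
      using G(1,3) by (intro lip[where K = "real m"]) (auto simp: dist_norm)
    then have "\<forall>\<^sub>F t in sequentially. (\<integral>\<omega>. g (Y \<omega>) \<partial>N) - e < (\<integral>\<omega>. G m (u t \<omega>) \<partial>M)"
      using m by (rule order_tendstoD(1))
    then show ?thesis
    proof eventually_elim
      case (elim t)
      have "(\<integral>\<omega>. G m (u t \<omega>) \<partial>M) \<le> (\<integral>\<omega>. g (u t \<omega>) \<partial>M)"
        using G(1,2) g(2) by (intro integral_mono M.integrable_const_bound[where B = B]) auto
      with elim show ?case by linarith
    qed
  qed
  show ?thesis
    unfolding tendsto_in_distribution_def
  proof (intro allI impI, elim conjE)
    fix g :: "'h \<Rightarrow> real" assume g: "continuous_on UNIV g" "bounded (range g)"
    then obtain B where B: "\<And>x. \<bar>g x\<bar> \<le> B" by (auto simp: bounded_iff)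
    show "(\<lambda>n. \<integral>\<omega>. g (u n \<omega>) \<partial>M) \<longlonglongrightarrow> (\<integral>\<omega>. g (Y \<omega>) \<partial>N)"
    proof (rule order_tendstoI)
      fix a assume "a < (\<integral>\<omega>. g (Y \<omega>) \<partial>N)"
      then show "\<forall>\<^sub>F t in sequentially. a < (\<integral>\<omega>. g (u t \<omega>) \<partial>M)"
        using lower[OF g(1) B, of "(\<integral>\<omega>. g (Y \<omega>) \<partial>N) - a"] by simp
    next
      fix a assume "(\<integral>\<omega>. g (Y \<omega>) \<partial>N) < a"
      then show "\<forall>\<^sub>F t in sequentially. (\<integral>\<omega>. g (u t \<omega>) \<partial>M) < a"
        using lower[of "\<lambda>x. - g x" B "a - (\<integral>\<omega>. g (Y \<omega>) \<partial>N)"] B g(1)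
        by (simp add: continuous_on_minus)
    qed
  qed
qed

text \<open>The mean value inequality makes the bound on the first derivative a Lipschitz bound.
  Every test function of \<open>d2\<close> thus obeys the general estimate with B = K = 1, which
  makes that estimate uniform over the class.\<close>

lemma d2_class_bounds:
  assumes "h \<in> d2_class"
  shows "\<bar>h x\<bar> \<le> 1" "\<bar>h x - h y\<bar> \<le> 1 * norm (x - y)"
proof -
  obtain D1 D2 where b: "bounded (range h)"
    and D: "\<And>x. (h has_derivative blinfun_apply (D1 x)) (at x)"
    and le: "\<And>x. (SUP y. \<bar>h y\<bar>) + norm (D1 x :: 'a \<Rightarrow>\<^sub>L real) + norm (D2 x :: 'a \<Rightarrow>\<^sub>L 'a \<Rightarrow>\<^sub>L real) \<le> 1"
    using assms unfolding d2_class_def by blast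
  have "bdd_above (range (\<lambda>y. \<bar>h y\<bar>))"
    using b unfolding bounded_iff bdd_above_def by auto
  then have sup: "\<bar>h x\<bar> \<le> (SUP y. \<bar>h y\<bar>)" for x by (intro cSUP_upper) auto
  show "\<bar>h x\<bar> \<le> 1" using sup[of x] le[of x] norm_ge_zero[of "D1 x"] norm_ge_zero[of "D2 x"] by linarith
  have "norm (D1 x) \<le> 1" for x
    using sup[of x] le[of x] abs_ge_zero[of "h x"] norm_ge_zero[of "D2 x"] by linarith
  then show "\<bar>h x - h y\<bar> \<le> 1 * norm (x - y)"
    using differentiable_bound[of UNIV h "\<lambda>x. blinfun_apply (D1 x)" 1 x y] D
    by (simp add: norm_blinfun.rep_eq)
qed

text \<open>\<open>d2\<close> is a supremum of reals, so bounding it from above needs a nonempty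
  class. The zero function also witnesses that \<open>d2\<close> is nonnegative.\<close>

lemma zero_in_d2_class: "(\<lambda>_. 0) \<in> (d2_class :: ('h::real_normed_vector \<Rightarrow> real) set)"
  unfolding d2_class_def
  by (auto intro!: exI[of _ "\<lambda>_. 0"] simp: zero_blinfun.rep_eq)

section \<open>Laws of the stochastic convolution and of the coupled Gaussian variable\<close>

text \<open>Both operators in the integrand are diagonal in the sine basis, so the variance splits
  into integrals of exp (-2 \<open>eigval (Suc i)\<close> (t - s)) over [0, t].\<close>

lemma stochastic_convolution_cos:
  fixes W :: "real \<Rightarrow> L2 \<Rightarrow> 'w \<Rightarrow> real"
  assumes "prob_space M" "cylindrical_wiener M W"
    and S: "C0_semigroup S" "generator S = dirichlet_laplacian"
    and Q: "is_sqrt_op Q Qh" "\<forall>k\<ge>1. Q (sine k) = q k *\<^sub>R sine k" "\<forall>k\<ge>1. q k > 0"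
    and t: "0 \<le> t" and Z: "wiener_integral M W t (\<lambda>s. S (t - s) o\<^sub>L Qh) Z"
  shows "(\<integral>\<omega>. cos (inner (Z \<omega>) (\<Sum>i<n. c i *\<^sub>R sine (Suc i)) + \<theta>) \<partial>M) =
    exp (- (\<Sum>i<n. (c i)\<^sup>2 * (q (Suc i) / (2 * eigval (Suc i)) * (1 - exp (- 2 * eigval (Suc i) * t)))) / 2) * cos \<theta>"
proof -
  \<comment> \<open>The adjoint of the integrand at time \<open>s\<close>, applied to the finite
    sine combination with coefficients \<open>c\<close>.\<close>
  define w where "w s = (\<Sum>i<n. (c i * exp (- eigval (Suc i) * (t - s)) * sqrt (q (Suc i))) *\<^sub>R sine (Suc i))" for s
  have Qh: "inner (Qh h) (sine (Suc i)) = sqrt (q (Suc i)) * inner h (sine (Suc i))" for h i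
  proof -
    have "inner (Qh h) (sine (Suc i)) = inner h (Qh (sine (Suc i)))"
      using Q(1) by (simp add: is_sqrt_op_def symmetric_op_def)
    also have "Qh (sine (Suc i)) = sqrt (q (Suc i)) *\<^sub>R sine (Suc i)"
      using Q by (intro sqrt_op_eigenvector[OF Q(1)]) auto
    finally show ?thesis by simp
  qed
  have "(\<integral>\<omega>. cos (inner (Z \<omega>) (\<Sum>i<n. c i *\<^sub>R sine (Suc i)) + \<theta>) \<partial>M)
    = exp (- (\<integral>s. indicator {0..t} s *\<^sub>R (norm (w s))\<^sup>2 \<partial>lborel) / 2) * cos \<theta>"
  proof (rule wiener_integral_cos[OF assms(1,2) Z])
    show "continuous_on {0..t} w" unfolding w_def by (intro continuous_intros)
    fix s h assume "s \<in> {0..t}"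
    then have "0 \<le> t - s" by simp
    then show "inner ((S (t - s) o\<^sub>L Qh) h) (\<Sum>i<n. c i *\<^sub>R sine (Suc i)) = inner h (w s)"
      by (simp add: w_def inner_sum_right heat_semigroup_coeff[OF S] Qh mult.assoc)
  qed
  also have "(\<integral>s. indicator {0..t} s *\<^sub>R (norm (w s))\<^sup>2 \<partial>lborel)
    = (\<integral>s. indicator {0..t} s *\<^sub>R (\<Sum>i<n. (c i)\<^sup>2 * q (Suc i) * exp (- 2 * eigval (Suc i) * (t - s))) \<partial>lborel)"
  proof (intro Bochner_Integration.integral_cong refl)
    fix s
    have "exp (- eigval (Suc i) * (t - s)) ^ 2 = exp (- 2 * eigval (Suc i) * (t - s))" for i
      by (simp flip: exp_double add: algebra_simps)
    then have "(norm (w s))\<^sup>2 = (\<Sum>i<n. (c i)\<^sup>2 * q (Suc i) * exp (- 2 * eigval (Suc i) * (t - s)))"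
      unfolding w_def using Q(3) by (subst norm_sum_sine) (auto simp: power_mult_distrib less_imp_le intro!: sum.cong)
    then show "indicator {0..t} s *\<^sub>R (norm (w s))\<^sup>2 = indicator {0..t} s *\<^sub>R (\<Sum>i<n. (c i)\<^sup>2 * q (Suc i) * exp (- 2 * eigval (Suc i) * (t - s)))"
      by simp
  qed
  also have "\<dots> = (\<Sum>i<n. (c i)\<^sup>2 * q (Suc i) * (exp (- 2 * eigval (Suc i) * (t - t)) / (2 * eigval (Suc i))))
    - (\<Sum>i<n. (c i)\<^sup>2 * q (Suc i) * (exp (- 2 * eigval (Suc i) * (t - 0)) / (2 * eigval (Suc i))))"
  proof (rule integral_FTC_atLeastAtMost[OF t])
    fix s
    have ne: "eigval (Suc i) \<noteq> 0" for i using eigval_pos[of "Suc i"] by simp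
    have "((\<lambda>s. \<Sum>i<n. (c i)\<^sup>2 * q (Suc i) * (exp (- 2 * eigval (Suc i) * (t - s)) / (2 * eigval (Suc i))))
       has_real_derivative (\<Sum>i<n. (c i)\<^sup>2 * q (Suc i) * exp (- 2 * eigval (Suc i) * (t - s)))) (at s within {0..t})"
      using ne by (intro DERIV_sum) (auto intro!: derivative_eq_intros)
    then show "((\<lambda>s. \<Sum>i<n. (c i)\<^sup>2 * q (Suc i) * (exp (- 2 * eigval (Suc i) * (t - s)) / (2 * eigval (Suc i))))
       has_vector_derivative (\<Sum>i<n. (c i)\<^sup>2 * q (Suc i) * exp (- 2 * eigval (Suc i) * (t - s)))) (at s within {0..t})"
      by (simp add: has_real_derivative_iff_has_vector_derivative)
  qed (intro continuous_intros)
  also have "\<dots> = (\<Sum>i<n. (c i)\<^sup>2 * (q (Suc i) / (2 * eigval (Suc i)) * (1 - exp (- 2 * eigval (Suc i) * t))))"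
    by (simp flip: sum_subtractf add: algebra_simps diff_divide_distrib)
  finally show ?thesis .
qed

text \<open>Moving the diagonal operator to the other side of the inner product leaves a centered
  normal functional of \<open>Y\<close>, whose variance is read off the covariance. With (m i)^2 = 1
  - exp (-2 \<open>eigval (Suc i)\<close> t) the result coincides with the transform of the
  stochastic convolution.\<close>

lemma gaussian_multiplier_cos:
  fixes Y :: "'v \<Rightarrow> L2"
  assumes "prob_space N" and Y: "gaussian_rv N Y" and cov: "covariance_op N Y (limit_covariance q)"
    and q: "\<forall>k\<ge>1. q k > 0" "summable (\<lambda>k. q (Suc k))" and m: "\<And>k. \<bar>m k\<bar> \<le> 1"
  shows "(\<integral>\<omega>. cos (inner (sine_multiplier m (Y \<omega>)) (\<Sum>i<n. c i *\<^sub>R sine (Suc i)) + \<theta>) \<partial>N) =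
    exp (- (\<Sum>i<n. (c i)\<^sup>2 * (q (Suc i) / (2 * eigval (Suc i)) * (m i)\<^sup>2)) / 2) * cos \<theta>"
proof -
  interpret prob_space N by fact
  define v where "v = (\<Sum>i<n. (c i * m i) *\<^sub>R sine (Suc i))"
  have inner_v: "inner (sine_multiplier m F) (\<Sum>i<n. c i *\<^sub>R sine (Suc i)) = inner F v" for F
    by (simp add: v_def inner_sum_right sine_multiplier_coeff[OF m] mult.assoc)
  have v_k: "inner v (sine (Suc k)) = (if k < n then c k * m k else 0)" for k
  proof -
    have "inner v (sine (Suc k)) = (\<Sum>i<n. if i = k then c i * m i else 0)"
      unfolding v_def inner_sum_left by (intro sum.cong refl) (simp add: inner_sine)
    then show ?thesis by simp
  qed
  have "centered_normal N (\<lambda>\<omega>. inner (Y \<omega>) v)" using Y by (simp add: gaussian_rv_def)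
  then have "expectation (\<lambda>\<omega>. cos (inner (Y \<omega>) v + \<theta>)) = exp (- expectation (\<lambda>\<omega>. (inner (Y \<omega>) v)\<^sup>2) / 2) * cos \<theta>"
    by (rule centered_normal_cos)
  also have "expectation (\<lambda>\<omega>. (inner (Y \<omega>) v)\<^sup>2) = inner (limit_covariance q v) v"
    using cov by (simp add: covariance_op_def power2_eq_square)
  \<comment> \<open>The covariance series is finite here, as \<open>v\<close> has no coefficients
    from \<open>n\<close> on.\<close>
  also have "\<dots> = (\<Sum>i<n. q (Suc i) / (2 * eigval (Suc i)) * (inner v (sine (Suc i)))\<^sup>2)"
    by (rule sums_unique2[OF limit_covariance_quadratic[OF q] sums_finite]) (auto simp: v_k)
  also have "\<dots> = (\<Sum>i<n. (c i)\<^sup>2 * (q (Suc i) / (2 * eigval (Suc i)) * (m i)\<^sup>2))"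
    by (intro sum.cong refl) (simp add: v_k power_mult_distrib)
  finally show ?thesis by (simp only: inner_v)
qed

theorem proposition4p3:
  fixes M :: "'w measure"
    and N :: "'v measure"
    and X :: "'g::{real_inner, complete_space, second_countable_topology} \<Rightarrow> 'w \<Rightarrow> real"
    and W :: "real \<Rightarrow> L2 \<Rightarrow> 'w \<Rightarrow> real"
    and S :: "real \<Rightarrow> L2 \<Rightarrow>\<^sub>L L2"
    and Q Qh :: "L2 \<Rightarrow>\<^sub>L L2"
    and q :: "nat \<Rightarrow> real"
    and f :: "nat \<Rightarrow> 'g list \<Rightarrow> L2"
    and u0 :: "'w \<Rightarrow> L2"
    and u :: "nat \<Rightarrow> 'w \<Rightarrow> L2"
    and u_inf :: "'v \<Rightarrow> L2"
  assumes "prob_space M"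
    and "isonormal M X"
    and "cylindrical_wiener M W"
    and W_in_first_chaos: "\<forall>t\<ge>0. \<forall>x. \<exists>g. AE \<omega> in M. W t x \<omega> = X g \<omega>"
    and "C0_semigroup S"
    and "generator S = dirichlet_laplacian"
    and "symmetric_op Q" and "nonneg_op Q" and "trace_class Q"
    and "\<forall>k\<ge>1. Q (sine k) = q k *\<^sub>R sine k"
    and "\<forall>k\<ge>1. q k > 0"
    and "summable (\<lambda>k. q (Suc k))"
    and "is_sqrt_op Q Qh"
    and "u0 \<in> borel_measurable M"
    and "integrable M (\<lambda>\<omega>. (norm (u0 \<omega>))\<^sup>2)"
    and "indep_of_wiener M u0 W"
    and "centered_chaos_expansion M X f u0"
    and "mild_solution M W S Qh u0 u"
    and "prob_space N"
    and "gaussian_rv N u_inf"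
    and "covariance_op N u_inf (limit_covariance q)"
  shows "(\<lambda>t. d2 M (u t) N u_inf) \<longlonglongrightarrow> 0 \<and> tendsto_in_distribution M u N u_inf"
proof -
  interpret M: prob_space M by fact
  interpret N: prob_space N by fact
  note [measurable] = \<open>u0 \<in> borel_measurable M\<close>
  have [measurable]: "u_inf \<in> borel_measurable N"
    using \<open>gaussian_rv N u_inf\<close> by (simp add: gaussian_rv_def)
  have u[measurable]: "u t \<in> borel_measurable M" for t
    using \<open>mild_solution M W S Qh u0 u\<close> by (simp add: mild_solution_def)
  define a where "a t = exp (- eigval 1 * real t)" for t
  \<comment> \<open>The error bound depends on a test function only through its bound
    \<open>B\<close> and Lipschitz constant \<open>K\<close>. One term is the fading initial
    condition on \<open>M\<close>, the other the coupling error on \<open>N\<close>.\<close>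
  define r where "r B K t = M.expectation (\<lambda>\<omega>. min (2 * B) ((K * a t) * norm (u0 \<omega>)))
    + N.expectation (\<lambda>\<omega>. min (2 * B) ((K * a t) * norm (u_inf \<omega>)))" for B K t
  have a0: "a \<longlonglongrightarrow> 0"
  proof -
    have "(\<lambda>t. exp (- eigval 1) ^ t) \<longlonglongrightarrow> 0"
      using eigval_pos[of 1] by (intro LIMSEQ_realpow_zero) auto
    then show ?thesis by (simp add: a_def[abs_def] exp_of_nat_mult[symmetric] mult.commute)
  qed
  have r0: "r B K \<longlonglongrightarrow> 0" if "0 \<le> B" "0 \<le> K" for B K
  proof -
    have "(\<lambda>t. K * a t) \<longlonglongrightarrow> K * 0" by (intro tendsto_intros a0)
    then have Ka: "(\<lambda>t. K * a t) \<longlonglongrightarrow> 0" by simp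
    have "(\<lambda>t. r B K t) \<longlonglongrightarrow> 0 + 0"
      unfolding r_def using that
      by (intro tendsto_add M.expectation_min_tendsto_0[OF _ Ka] N.expectation_min_tendsto_0[OF _ Ka]) (auto simp: a_def)
    then show ?thesis by simp
  qed
  have key: "\<bar>M.expectation (\<lambda>\<omega>. h (u t \<omega>)) - N.expectation (\<lambda>\<omega>. h (u_inf \<omega>))\<bar> \<le> r B K t"
    if h: "\<And>x. \<bar>h x\<bar> \<le> B" "\<And>x y. \<bar>h x - h y\<bar> \<le> K * norm (x - y)" "0 \<le> K"
    for h :: "L2 \<Rightarrow> real" and B K t
  proof -
    obtain Z where Z: "wiener_integral M W (real t) (\<lambda>s. S (real t - s) o\<^sub>L Qh) Z"
      and uZ: "AE \<omega> in M. u t \<omega> = S (real t) (u0 \<omega>) + Z \<omega>"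
      using \<open>mild_solution M W S Qh u0 u\<close> unfolding mild_solution_def by blast
    have [measurable]: "Z \<in> borel_measurable M" using Z by (simp add: wiener_integral_def)
    \<comment> \<open>coupling: \<open>sine_multiplier m u_inf\<close> has the law of the stochastic convolution at time \<open>t\<close>\<close>
    define m where "m k = sqrt (1 - exp (- 2 * eigval (Suc k) * real t))" for k
    define Y where "Y \<omega> = sine_multiplier m (u_inf \<omega>)" for \<omega>
    have z: "0 \<le> 1 - exp (- 2 * eigval (Suc k) * real t)" "1 - exp (- 2 * eigval (Suc k) * real t) \<le> 1" for k
      using eigval_pos[of "Suc k"] by auto
    have m1: "\<bar>m k\<bar> \<le> 1" and m2: "(m k)\<^sup>2 = 1 - exp (- 2 * eigval (Suc k) * real t)" for k
      using z[of k] by (auto simp: m_def)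
    have m3: "\<bar>m k - 1\<bar> \<le> a t" for k
    proof -
      have m0: "0 \<le> m k" "m k \<le> 1" using z[of k] by (auto simp: m_def)
      \<comment> \<open>A number in [0, 1] dominates its square, so 1 - \<open>m k\<close> is at
        most 1 - (m k)^2, which is the exponential itself.\<close>
      have "(m k)\<^sup>2 \<le> m k" using m0 by (simp add: power2_eq_square mult_left_le)
      then have "1 - m k \<le> exp (- 2 * eigval (Suc k) * real t)" using m2[of k] by linarith
      also have "\<dots> \<le> a t"
      proof -
        have "eigval 1 * real t \<le> 2 * eigval (Suc k) * real t"
          using eigval_mono[of 1 "Suc k"] eigval_pos[of "Suc k"] by (intro mult_right_mono) auto
        then show ?thesis by (simp add: a_def)
      qed
      finally show ?thesis using m0 by simp
    qed
    have "sine_multiplier m \<in> borel_measurable borel"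
      using continuous_on_sine_multiplier[OF m1] by (rule borel_measurable_continuous_onI)
    then have [measurable]: "Y \<in> borel_measurable N" unfolding Y_def by measurable
    have hc: "continuous_on UNIV h"
    proof (rule lipschitz_on_continuous_on)
      show "K-lipschitz_on UNIV h" using h by (intro lipschitz_onI) (auto simp: dist_norm)
    qed
    \<comment> \<open>The two cosine transforms agree on all finite sine combinations. This identity
      of means is the only link between the spaces \<open>M\<close> and \<open>N\<close>.\<close>
    have "M.expectation (\<lambda>\<omega>. h (Z \<omega>)) = N.expectation (\<lambda>\<omega>. h (Y \<omega>))"
    proof (rule L2_expectation_eq[OF \<open>prob_space M\<close> \<open>prob_space N\<close> _ _ _ hc h(1)])
      fix n c \<theta>
      show "(\<integral>\<omega>. cos (inner (Z \<omega>) (\<Sum>i<n. c i *\<^sub>R sine (Suc i)) + \<theta>) \<partial>M)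
        = (\<integral>\<omega>. cos (inner (Y \<omega>) (\<Sum>i<n. c i *\<^sub>R sine (Suc i)) + \<theta>) \<partial>N)"
        unfolding Y_def
        using stochastic_convolution_cos[OF assms(1,3,5,6,13,10,11) _ Z]
          gaussian_multiplier_cos[OF assms(19-21,11,12) m1]
        by (simp add: m2)
    qed measurable
    moreover have "\<bar>M.expectation (\<lambda>\<omega>. h (u t \<omega>)) - M.expectation (\<lambda>\<omega>. h (Z \<omega>))\<bar>
      \<le> M.expectation (\<lambda>\<omega>. min (2 * B) (K * (a t * norm (u0 \<omega>))))"
    proof (rule M.expectation_diff_le_min[OF h])
      show "AE \<omega> in M. norm (u t \<omega> - Z \<omega>) \<le> a t * norm (u0 \<omega>)"
        using uZ
      proof eventually_elim
        case (elim \<omega>)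
        then show ?case
          using heat_semigroup_decay[OF assms(5,6), of "real t" "u0 \<omega>"] by (simp add: a_def)
      qed
    qed measurable
    moreover have "\<bar>N.expectation (\<lambda>\<omega>. h (Y \<omega>)) - N.expectation (\<lambda>\<omega>. h (u_inf \<omega>))\<bar>
      \<le> N.expectation (\<lambda>\<omega>. min (2 * B) (K * (a t * norm (u_inf \<omega>))))"
    proof (rule N.expectation_diff_le_min[OF h])
      show "AE \<omega> in N. norm (Y \<omega> - u_inf \<omega>) \<le> a t * norm (u_inf \<omega>)"
        unfolding Y_def by (intro always_eventually allI sine_multiplier_diff_le m1 m3)
    qed measurable
    ultimately show ?thesis unfolding r_def mult.assoc by linarith
  qed
  have "(\<lambda>t. d2 M (u t) N u_inf) \<longlonglongrightarrow> 0"
  proof (rule tendsto_sandwich[OF _ _ tendsto_const r0])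
    let ?E = "\<lambda>t h. \<bar>M.expectation (\<lambda>\<omega>. h (u t \<omega>)) - N.expectation (\<lambda>\<omega>. h (u_inf \<omega>))\<bar>"
    have le: "?E t h \<le> r 1 1 t" if "h \<in> d2_class" for h t
      using d2_class_bounds[OF that] by (intro key) auto
    show "\<forall>\<^sub>F t in sequentially. d2 M (u t) N u_inf \<le> r 1 1 t"
      unfolding d2_def using zero_in_d2_class le by (intro always_eventually allI cSUP_least) blast+
    show "\<forall>\<^sub>F t in sequentially. 0 \<le> d2 M (u t) N u_inf"
    proof (intro always_eventually allI)
      fix t
      have "bdd_above (?E t ` d2_class)" using le by (intro bdd_aboveI[of _ "r 1 1 t"]) auto
      then show "0 \<le> d2 M (u t) N u_inf"
        unfolding d2_def by (intro cSUP_upper2[OF _ zero_in_d2_class]) auto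
    qed
  qed auto
  moreover have "tendsto_in_distribution M u N u_inf"
  proof (rule tendsto_in_distributionI_lipschitz)
    fix h :: "L2 \<Rightarrow> real" and B K
    assume h: "\<And>x. \<bar>h x\<bar> \<le> B" "\<And>x y. \<bar>h x - h y\<bar> \<le> K * norm (x - y)" "0 \<le> K"
    have "0 \<le> B" using h(1)[of 0] by linarith
    show "(\<lambda>t. M.expectation (\<lambda>\<omega>. h (u t \<omega>))) \<longlonglongrightarrow> N.expectation (\<lambda>\<omega>. h (u_inf \<omega>))"
      by (rule LIM_zero_cancel, rule Lim_null_comparison[OF _ r0[OF \<open>0 \<le> B\<close> h(3)]])
         (use key[OF h] in auto)
  qed (use assms in auto)
  ultimately show ?thesis ..
qed

end
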